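(* Assume the Riemann Hypothesis. Then for $x\ge2$, $T>1$, and any sequence $\{a_n\}$ of complex numbers, $$\sum_{0<\gamma\le T}\Big|\sum_{n\le x}\frac{a_n}{n^{\rho}}\Big|^2 = N(T)\sum_{n\le x}\frac{|a_n|^2}{n} - \frac{T}{\pi}\,\Re\Big(\sum_{kn\le x}\frac{\overline{a_{kn}}\,a_n\,\Lambda(k)}{kn}\Big) + O\Big(x\,(\log(xT))^2\sum_{n\le x}\frac{|a_n|^2}{n}\Big),$$ where the implied constant is absolute.
   Context: The sum on the left runs over nontrivial zeros $\rho=\beta+i\gamma$ of the Riemann zeta-function with $0<\gamma\le T$, counted with multiplicity. $N(T)$ denotes the number of nontrivial zeros with $0<\gamma\le T$. $\Lambda$ is the von Mangoldt function; the second sum runs over pairs of positive integers $k,n$ with $kn\le x$. *)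

theory Defs
  imports "HOL-Complex_Analysis.Complex_Analysis" "HOL-Number_Theory.Prime_Powers"
begin

text \<open>The Riemann zeta function is the analytic continuation of the Dirichlet series to
  the complex plane without 1. The value 0 at the pole is arbitrary; it makes the continuation
  unique as a total function, and 1 is never counted as a zero.\<close>

definition is_zeta :: "(complex \<Rightarrow> complex) \<Rightarrow> bool" where
  "is_zeta f \<longleftrightarrow> f holomorphic_on (- {1}) \<and> f 1 = 0 \<and>
     (\<forall>s. Re s > 1 \<longrightarrow> (\<lambda>n. 1 / of_nat (Suc n) powr s) sums f s)"

definition zeta :: "complex \<Rightarrow> complex" where
  "zeta = (THE f. is_zeta f)"

text \<open>The trivial zeros are the negative even integers.\<close>

definition nontrivial_zeros :: "complex set" where
  "nontrivial_zeros = {\<rho>. \<rho> \<noteq> 1 \<and> zeta \<rho> = 0 \<and> \<not> (\<exists>k::nat. k > 0 \<and> \<rho> = - of_nat (2 * k))}"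

definition Riemann_Hypothesis :: bool where
  "Riemann_Hypothesis \<longleftrightarrow> (\<forall>\<rho>\<in>nontrivial_zeros. Re \<rho> = 1 / 2)"

definition zeros_upto :: "real \<Rightarrow> complex set" where
  "zeros_upto T = {\<rho> \<in> nontrivial_zeros. 0 < Im \<rho> \<and> Im \<rho> \<le> T}"

definition zero_mult :: "complex \<Rightarrow> nat" where
  "zero_mult \<rho> = nat (zorder zeta \<rho>)"

text \<open>This is $N(T)$; zeros are counted with multiplicity.\<close>

definition zero_count :: "real \<Rightarrow> nat" where
  "zero_count T = (\<Sum>\<rho>\<in>zeros_upto T. zero_mult \<rho>)"

subsection \<open>Well-definedness\<close>

lemma holomorphic_suminf:
  fixes f :: "nat \<Rightarrow> complex \<Rightarrow> complex"
  assumes "open S" "\<And>n. f n holomorphic_on S"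
    and "\<And>x. x \<in> S \<Longrightarrow> \<exists>d M. d > 0 \<and> cball x d \<subseteq> S \<and> summable M \<and> (\<forall>n. \<forall>y\<in>cball x d. norm (f n y) \<le> M n)"
  shows "(\<lambda>s. \<Sum>n. f n s) holomorphic_on S"
proof (rule holomorphic_uniform_sequence[where f = "\<lambda>n s. \<Sum>i<n. f i s"])
  show "open S" by fact
  show "(\<lambda>s. \<Sum>i<n. f i s) holomorphic_on S" for n
    using assms(2) by (intro holomorphic_intros)
  show "\<exists>d>0. cball x d \<subseteq> S \<and> uniform_limit (cball x d) (\<lambda>n s. \<Sum>i<n. f i s) (\<lambda>s. \<Sum>n. f n s) sequentially"
    if x: "x \<in> S" for x
  proof -
    obtain d M where *: "d > 0" "cball x d \<subseteq> S" "summable M" "\<And>n y. y \<in> cball x d \<Longrightarrow> norm (f n y) \<le> M n"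
      using assms(3)[OF x] by blast
    have "uniform_limit (cball x d) (\<lambda>n s. \<Sum>i<n. f i s) (\<lambda>s. \<Sum>n. f n s) sequentially"
      by (rule Weierstrass_m_test[OF *(4) *(3)])
    with * show ?thesis by blast
  qed
qed

lemma summable_Suc_powr: "e < -1 \<Longrightarrow> summable (\<lambda>n. real (Suc n) powr e)"
  by (subst summable_Suc_iff) (simp add: summable_real_powr_iff)

lemma norm_of_nat_powr: "norm (of_nat (Suc n) powr s) = real (Suc n) powr Re s"
  using norm_powr_real_powr[of "of_nat (Suc n)" s] by (simp del: of_nat_Suc)

definition zeta_series :: "complex \<Rightarrow> complex" where
  "zeta_series s = (\<Sum>n. of_nat (Suc n) powr (-s))"

lemma zeta_series_sums:
  assumes "Re s > 1"
  shows "(\<lambda>n. of_nat (Suc n) powr (-s)) sums zeta_series s"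
  unfolding zeta_series_def
  by (rule summable_sums, rule summable_norm_cancel)
     (use assms in \<open>simp only: norm_of_nat_powr, intro summable_Suc_powr, simp\<close>)

lemma cball_half_plane:
  assumes "c < Re x"
  shows "\<exists>d>0. \<exists>e>0. cball x d \<subseteq> {s. Re s > c} \<and> (\<forall>y\<in>cball x d. Re y \<ge> c + e)"
proof -
  let ?d = "(Re x - c) / 2"
  have *: "Re y \<ge> c + ?d" if "y \<in> cball x ?d" for y
    using that abs_Re_le_cmod[of "x - y"] by (auto simp: dist_norm field_simps)
  have d: "?d > 0" using assms by simp
  moreover have "cball x ?d \<subseteq> {s. Re s > c}"
  proof
    fix y assume "y \<in> cball x ?d"
    from *[OF this] d have "Re y > c" by linarith
    thus "y \<in> {s. Re s > c}" by simp
  qed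
  ultimately show ?thesis using * by blast
qed

lemma zeta_series_holomorphic: "zeta_series holomorphic_on {s. Re s > 1}"
proof -
  have "(\<lambda>s. \<Sum>n. of_nat (Suc n) powr (-s)) holomorphic_on {s. Re s > 1}"
  proof (rule holomorphic_suminf)
    show "open {s. Re s > 1}" by (rule open_halfspace_Re_gt)
    show "(\<lambda>s. of_nat (Suc n) powr (-s)) holomorphic_on {s. Re s > 1}" for n
      by (intro holomorphic_intros) (auto simp del: of_nat_Suc)
    fix x assume "x \<in> {s. Re s > 1}"
    then obtain d e where *: "d > 0" "e > 0" "cball x d \<subseteq> {s. Re s > 1}" "\<And>y. y \<in> cball x d \<Longrightarrow> Re y \<ge> 1 + e"
      using cball_half_plane[of 1 x] by auto
    have "norm (of_nat (Suc n) powr (-y)) \<le> real (Suc n) powr (-(1+e))" if "y \<in> cball x d" for y n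
      unfolding norm_of_nat_powr using *(4)[OF that] by (intro powr_mono) auto
    moreover have "summable (\<lambda>n. real (Suc n) powr (-(1+e)))"
      by (rule summable_Suc_powr) (use * in auto)
    ultimately show "\<exists>d M. d > 0 \<and> cball x d \<subseteq> {s. Re s > 1} \<and> summable M \<and>
        (\<forall>n. \<forall>y\<in>cball x d. norm (of_nat (Suc n) powr (-y)) \<le> M n)"
      using * by blast
  qed
  thus ?thesis by (simp add: zeta_series_def[abs_def])
qed

definition falling :: "nat \<Rightarrow> complex \<Rightarrow> complex" where
  "falling k s = (\<Prod>j<k. 1 - s - of_nat j)"

lemma falling_simps [simp]: "falling 0 s = 1" "falling (Suc k) s = falling k s * (1 - s - of_nat k)"
  by (simp_all add: falling_def)

lemma falling_holomorphic: "falling k holomorphic_on A"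
  unfolding falling_def[abs_def] by (intro holomorphic_intros)

definition zeta_rem :: "nat \<Rightarrow> nat \<Rightarrow> complex \<Rightarrow> complex" where
  "zeta_rem K n s = of_nat (Suc (Suc n)) powr (1 - s) -
      (\<Sum>k\<le>K. falling k s * of_nat (Suc n) powr (1 - s - of_nat k) / fact k)"

lemma norm_zeta_rem:
  assumes "Re s > - real K"
  shows "norm (zeta_rem K n s) \<le> norm (falling (Suc K) s) / fact K * real (Suc n) powr (- Re s - real K)"
proof -
  let ?w = "of_nat (Suc n) :: complex"
  let ?S = "closed_segment ?w (?w + 1)"
  let ?f = "\<lambda>i x. falling i s * x powr (1 - s - of_nat i)"
  have S: "x \<in> \<real>" "Re x \<ge> real (Suc n)" if "x \<in> ?S" for x
  proof -
    from that obtain u where u: "0 \<le> u" "x = (1 - of_real u) * ?w + of_real u * (?w + 1)"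
      by (auto simp: closed_segment_def scaleR_conv_of_real)
    have "x = of_real (real (Suc n) + u)" by (simp add: u(2) algebra_simps)
    thus "x \<in> \<real>" "Re x \<ge> real (Suc n)" using u(1) by simp_all
  qed
  have "norm (?f 0 (?w + 1) - (\<Sum>i\<le>K. ?f i ?w * ((?w + 1) - ?w) ^ i / fact i))
      \<le> (norm (falling (Suc K) s) * real (Suc n) powr (- Re s - real K)) * norm ((?w + 1) - ?w) ^ Suc K / fact K"
  proof (rule complex_Taylor)
    show "convex ?S" by simp
    show "?w \<in> ?S" "?w + 1 \<in> ?S" by auto
    fix i x assume x: "x \<in> ?S"
    have nz: "x \<notin> \<real>\<^sub>\<le>\<^sub>0" using S[OF x] by (auto elim!: nonpos_Reals_cases)
    show "((\<lambda>x. ?f i x) has_field_derivative ?f (Suc i) x) (at x within ?S)"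
      by (rule derivative_eq_intros refl nz)+ (simp add: algebra_simps)
  next
    fix x assume x: "x \<in> ?S"
    have pos: "Re x > 0" using S(2)[OF x] by linarith
    have "norm (x powr (1 - s - of_nat (Suc K))) = Re x powr (- Re s - real K)"
      using norm_powr_real_powr[of x "1 - s - of_nat (Suc K)"] S(1)[OF x] pos by simp
    also have "\<dots> \<le> real (Suc n) powr (- Re s - real K)"
      using S(2)[OF x] assms by (intro powr_mono2') auto
    finally show "norm (?f (Suc K) x) \<le> norm (falling (Suc K) s) * real (Suc n) powr (- Re s - real K)"
      unfolding norm_mult by (rule mult_left_mono) simp
  qed
  thus ?thesis by (simp add: zeta_rem_def algebra_simps)
qed

lemma zeta_rem_holomorphic: "(\<lambda>s. \<Sum>n. zeta_rem K n s) holomorphic_on {s. Re s > 1 - real K}"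
proof (rule holomorphic_suminf)
  show "open {s. Re s > 1 - real K}" by (rule open_halfspace_Re_gt)
  show "zeta_rem K n holomorphic_on {s. Re s > 1 - real K}" for n
    unfolding zeta_rem_def[abs_def]
    by (intro holomorphic_intros falling_holomorphic[THEN holomorphic_on_subset]) (auto simp del: of_nat_Suc)
  fix x assume "x \<in> {s. Re s > 1 - real K}"
  then obtain d e where *: "d > 0" "e > 0" "cball x d \<subseteq> {s. Re s > 1 - real K}"
      "\<And>y. y \<in> cball x d \<Longrightarrow> Re y \<ge> 1 - real K + e"
    using cball_half_plane[of "1 - real K" x] by auto
  have "compact (falling (Suc K) ` cball x d)"
    by (intro compact_continuous_image holomorphic_on_imp_continuous_on falling_holomorphic) auto
  then obtain B where B: "\<And>y. y \<in> cball x d \<Longrightarrow> norm (falling (Suc K) y) \<le> B"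
    using compact_imp_bounded bounded_iff by (metis imageI)
  have "norm (zeta_rem K n y) \<le> B / fact K * real (Suc n) powr (-(1 + e))" if y: "y \<in> cball x d" for y n
  proof -
    have "norm (zeta_rem K n y) \<le> norm (falling (Suc K) y) / fact K * real (Suc n) powr (- Re y - real K)"
      using *(2) *(4)[OF y] by (intro norm_zeta_rem) linarith
    also have "\<dots> \<le> B / fact K * real (Suc n) powr (-(1 + e))"
      using *(2) *(4)[OF y] B[OF y] order_trans[OF norm_ge_zero B[OF y]]
      by (intro mult_mono divide_right_mono powr_mono) auto
    finally show ?thesis .
  qed
  moreover have "summable (\<lambda>n. B / fact K * real (Suc n) powr (-(1 + e)))"
    by (intro summable_mult summable_Suc_powr) (use * in auto)
  ultimately show "\<exists>d M. d > 0 \<and> cball x d \<subseteq> {s. Re s > 1 - real K} \<and> summable M \<and>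
        (\<forall>n. \<forall>y\<in>cball x d. norm (zeta_rem K n y) \<le> M n)"
    using * by blast
qed

lemma zeta_rem_sums:
  assumes s: "Re s > 1"
  shows "(\<lambda>n. zeta_rem (Suc K) n s) sums
           (-1 - (\<Sum>k\<le>K. falling (Suc k) s * zeta_series (s + of_nat k) / fact (Suc k)))"
proof -
  have lim: "(\<lambda>n. of_nat (Suc n) powr (1 - s)) \<longlonglongrightarrow> 0"
  proof (rule Lim_null_comparison[OF always_eventually])
    show "\<forall>n. norm (of_nat (Suc n) powr (1 - s)) \<le> real (Suc n) powr (1 - Re s)"
      unfolding norm_of_nat_powr by simp
    have "((\<lambda>n. real n powr (1 - Re s)) \<longlongrightarrow> 0) sequentially"
      using s by (intro tendsto_neg_powr filterlim_real_sequentially) auto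
    thus "(\<lambda>n. real (Suc n) powr (1 - Re s)) \<longlonglongrightarrow> 0"
      by (rule LIMSEQ_Suc)
  qed
  have tel: "(\<lambda>n. of_nat (Suc (Suc n)) powr (1 - s) - of_nat (Suc n) powr (1 - s)) sums (0 - of_nat (Suc 0) powr (1 - s))"
    using telescope_sums[OF lim] by simp
  have "(\<lambda>n. \<Sum>k\<le>K. falling (Suc k) s * of_nat (Suc n) powr (-(s + of_nat k)) / fact (Suc k)) sums
          (\<Sum>k\<le>K. falling (Suc k) s * zeta_series (s + of_nat k) / fact (Suc k))"
    by (intro sums_sum sums_divide sums_mult zeta_series_sums) (use s in auto)
  from sums_diff[OF tel this]
  have "(\<lambda>n. of_nat (Suc (Suc n)) powr (1 - s) - of_nat (Suc n) powr (1 - s) -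
      (\<Sum>k\<le>K. falling (Suc k) s * of_nat (Suc n) powr (-(s + of_nat k)) / fact (Suc k))) sums
      (-1 - (\<Sum>k\<le>K. falling (Suc k) s * zeta_series (s + of_nat k) / fact (Suc k)))"
    by simp
  moreover have "zeta_rem (Suc K) n s = of_nat (Suc (Suc n)) powr (1 - s) - of_nat (Suc n) powr (1 - s) -
      (\<Sum>k\<le>K. falling (Suc k) s * of_nat (Suc n) powr (-(s + of_nat k)) / fact (Suc k))" for n
  proof -
    have "1 - s - of_nat (Suc k) = -(s + of_nat k)" for k
      by simp
    thus ?thesis
      unfolding zeta_rem_def sum.atMost_Suc_shift by (simp only: falling_simps(1)) simp
  qed
  ultimately show ?thesis by (simp only:)
qed

lemma falling_Suc_mult:
  "falling (Suc k) s * z = - (falling k s * ((s + of_nat k - 1) * z))"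
  by (simp add: algebra_simps)

lemma zeta_recurrence:
  assumes s: "Re s > 1"
  shows "(s - 1) * zeta_series s = 1 + (\<Sum>n. zeta_rem (Suc K) n s) -
           (\<Sum>k<K. falling (Suc k) s * ((s + of_nat (Suc k) - 1) * zeta_series (s + of_nat (Suc k))) / fact (Suc (Suc k)))"
proof -
  have "(\<Sum>n. zeta_rem (Suc K) n s) =
      -1 - (\<Sum>k\<le>K. falling (Suc k) s * zeta_series (s + of_nat k) / fact (Suc k))"
    using zeta_rem_sums[OF s] by (rule sums_unique[symmetric])
  also have "\<dots> = -1 + (\<Sum>k\<le>K. falling k s * ((s + of_nat k - 1) * zeta_series (s + of_nat k)) / fact (Suc k))"
    unfolding falling_Suc_mult by (simp only: minus_divide_left[symmetric] sum_negf) simp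
  also have "{..K} = {..<Suc K}" by auto
  finally show ?thesis unfolding sum.lessThan_Suc_shift by simp
qed

lemma zeta_continuation_half_plane:
  "\<exists>Z. Z holomorphic_on {s. Re s > 1 - real m} \<and> (\<forall>s. Re s > 1 \<longrightarrow> Z s = (s - 1) * zeta_series s)"
proof (induction m)
  case 0
  show ?case
    by (rule exI[of _ "\<lambda>s. (s - 1) * zeta_series s"]) (auto intro!: holomorphic_intros zeta_series_holomorphic)
next
  case (Suc m)
  then obtain Z where Z: "Z holomorphic_on {s. Re s > 1 - real m}"
      "\<And>s. Re s > 1 \<Longrightarrow> Z s = (s - 1) * zeta_series s" by blast
  define Z' where "Z' = (\<lambda>s. 1 + (\<Sum>n. zeta_rem (Suc m) n s) -
           (\<Sum>k<m. falling (Suc k) s * Z (s + of_nat (Suc k)) / fact (Suc (Suc k))))"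
  have "(\<lambda>s. Z (s + of_nat (Suc k))) holomorphic_on {s. Re s > 1 - real (Suc m)}" for k
    using holomorphic_on_compose_gen[of "\<lambda>s. s + of_nat (Suc k)" "{s. Re s > 1 - real (Suc m)}" Z "{s. Re s > 1 - real m}"] Z(1)
    by (force simp: o_def intro!: holomorphic_intros)
  hence "Z' holomorphic_on {s. Re s > 1 - real (Suc m)}"
    unfolding Z'_def by (intro holomorphic_intros zeta_rem_holomorphic falling_holomorphic) auto
  moreover have "Z' s = (s - 1) * zeta_series s" if "Re s > 1" for s
  proof -
    have "Z (s + of_nat (Suc k)) = (s + of_nat (Suc k) - 1) * zeta_series (s + of_nat (Suc k))" for k
      using that by (intro Z(2)) simp
    thus ?thesis unfolding Z'_def zeta_recurrence[OF that, of m] by (simp only:)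
  qed
  ultimately show ?case by blast
qed

lemma zeta_continuation_entire:
  "\<exists>Z. Z holomorphic_on UNIV \<and> (\<forall>s. Re s > 1 \<longrightarrow> Z s = (s - 1) * zeta_series s)"
proof -
  obtain F where F: "\<And>m. F m holomorphic_on {s. Re s > 1 - real m}"
      "\<And>m s. Re s > 1 \<Longrightarrow> F m s = (s - 1) * zeta_series s"
    using zeta_continuation_half_plane by metis
  have agree: "F m s = F n s" if "Re s > 1 - real m" "m \<le> n" for m n s
  proof (rule analytic_continuation_open[where s = "{s. Re s > 1}" and s' = "{s. Re s > 1 - real m}" and f = "F m" and g = "F n"])
    show "{s. Re s > 1} \<noteq> {}" by (auto intro: exI[of _ 2])
    show "connected {s. Re s > 1 - real m}" by (intro convex_connected convex_halfspace_Re_gt)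
    show "F n holomorphic_on {s. Re s > 1 - real m}"
      by (rule holomorphic_on_subset[OF F(1)]) (use that in auto)
  qed (use that F in \<open>auto intro: open_halfspace_Re_gt\<close>)
  define Z where "Z = (\<lambda>s. F (nat \<lceil>2 - Re s\<rceil>) s)"
  have Z: "Z s = F m s" if "Re s > 1 - real m" for m s
  proof -
    have "Re s > 1 - real (nat \<lceil>2 - Re s\<rceil>)" by linarith
    thus ?thesis unfolding Z_def using agree that by (metis nle_le)
  qed
  have "Z holomorphic_on (\<Union>m. {s. Re s > 1 - real m})"
  proof (rule holomorphic_on_UN_open)
    show "Z holomorphic_on {s. Re s > 1 - real m}" for m
      using F(1) by (rule holomorphic_transform) (use Z in auto)
  qed (auto intro: open_halfspace_Re_gt)
  also have "(\<Union>m. {s. Re s > 1 - real m}) = UNIV"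
  proof -
    have "\<exists>m. Re s > 1 - real m" for s
      using reals_Archimedean2[of "1 - Re s"] by (auto simp: algebra_simps)
    thus ?thesis by auto
  qed
  finally show ?thesis using Z[of 0] F(2) by fastforce
qed

lemma is_zeta_zeta: "is_zeta zeta"
proof -
  obtain Z where Z: "Z holomorphic_on UNIV" "\<And>s. Re s > 1 \<Longrightarrow> Z s = (s - 1) * zeta_series s"
    using zeta_continuation_entire by blast
  have "is_zeta (\<lambda>s. if s = 1 then 0 else Z s / (s - 1))" (is "is_zeta ?f")
    unfolding is_zeta_def
  proof (intro conjI allI impI)
    have "(\<lambda>s. Z s / (s - 1)) holomorphic_on (- {1})"
      by (intro holomorphic_intros holomorphic_on_subset[OF Z(1)]) auto
    thus "?f holomorphic_on (- {1})" by (rule holomorphic_transform) auto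
    show "(\<lambda>n. 1 / of_nat (Suc n) powr s) sums ?f s" if "Re s > 1" for s
      using zeta_series_sums[OF that] Z(2)[OF that] that by (auto simp: powr_minus_divide)
  qed auto
  moreover have "g = f" if fg: "is_zeta f" "is_zeta g" for f g
  proof
    fix s show "g s = f s"
    proof (cases "s = 1")
      case False
      show ?thesis
      proof (rule analytic_continuation_open[where s = "{s. Re s > 1}" and s' = "- {1}" and f = g and g = f])
        show "{s. Re s > 1} \<noteq> {}" by (auto intro: exI[of _ 2])
        show "connected (- {1::complex})" by (intro connected_punctured_universe) simp
        show "g z = f z" if "z \<in> {s. Re s > 1}" for z
          using that fg sums_unique2 unfolding is_zeta_def by blast
      qed (use fg False in \<open>auto simp: is_zeta_def open_halfspace_Re_gt\<close>)
    qed (use fg in \<open>auto simp: is_zeta_def\<close>)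
  qed
  ultimately show ?thesis unfolding zeta_def by (metis theI)
qed

lemma zeta_not_constant: "\<not> zeta constant_on (- {1})"
proof
  assume "zeta constant_on (- {1})"
  hence eq: "zeta 2 = zeta 3" unfolding constant_on_def by force
  have "(\<lambda>n. Re (1 / of_nat (Suc n) powr 2 - 1 / of_nat (Suc n) powr 3)) sums Re (zeta 2 - zeta 3)"
  proof (intro sums_Re sums_diff)
    have *: "(\<lambda>n. 1 / of_nat (Suc n) powr s) sums zeta s" if "Re s > 1" for s
      using is_zeta_zeta that unfolding is_zeta_def by blast
    show "(\<lambda>n. 1 / of_nat (Suc n) powr 2) sums zeta 2"
      "(\<lambda>n. 1 / of_nat (Suc n) powr 3) sums zeta 3"
      by (rule *, simp)+
  qed
  moreover have "Re (1 / of_nat (Suc n) powr 2 - 1 / of_nat (Suc n) powr 3) =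
      1 / real (Suc n) ^ 2 - 1 / real (Suc n) ^ 3" for n
  proof -
    have "(1 / of_nat (Suc n) powr 2 - 1 / of_nat (Suc n) powr 3 :: complex) =
        of_real (1 / real (Suc n) ^ 2 - 1 / real (Suc n) ^ 3)"
      by (simp del: of_nat_Suc add: powr_numeral)
    thus ?thesis by (simp only: Re_complex_of_real)
  qed
  ultimately have sums: "(\<lambda>n. 1 / real (Suc n) ^ 2 - 1 / real (Suc n) ^ 3) sums 0"
    by (simp only: eq diff_self zero_complex.sel)
  have nonneg: "1 / real (Suc n) ^ 2 - 1 / real (Suc n) ^ 3 \<ge> 0" for n
    by (auto simp del: of_nat_Suc intro!: divide_left_mono power_increasing)
  have "0 < (\<Sum>n. 1 / real (Suc n) ^ 2 - 1 / real (Suc n) ^ 3)"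
    by (rule suminf_pos2[where i = 1, OF sums_summable[OF sums] nonneg]) simp
  thus False using sums_unique[OF sums] by simp
qed

text \<open>Sums over \<open>zeros_upto T\<close> are finite, so they do not collapse to the
  default value 0 that \<open>sum\<close> has on infinite sets.\<close>

lemma finite_zeros_upto:
  assumes "Riemann_Hypothesis"
  shows "finite (zeros_upto T)"
proof -
  let ?K = "cbox (Complex (1/2) 0) (Complex (1/2) T)"
  have "finite {z \<in> ?K. zeta z = 0}"
  proof (rule holomorphic_compact_finite_zeros)
    show "zeta holomorphic_on (- {1})" using is_zeta_zeta by (simp add: is_zeta_def)
    show "connected (- {1::complex})" by (intro connected_punctured_universe) simp
    show "?K \<subseteq> - {1}" by (auto simp: in_cbox_complex_iff)
  qed (use zeta_not_constant in auto)
  moreover have "zeros_upto T \<subseteq> {z \<in> ?K. zeta z = 0}"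
    using assms unfolding Riemann_Hypothesis_def zeros_upto_def
    by (auto simp: in_cbox_complex_iff nontrivial_zeros_def)
  ultimately show ?thesis by (rule rev_finite_subset)
qed

end

theory Submission
  imports Defs
begin

text \<open>
  Under the Riemann Hypothesis \<open>1 / n powr \<rho>\<close> and \<open>n powr \<rho> / n\<close> are conjugate, so
  expanding the square gives the diagonal \<open>\<Sum>n\<le>x. |a n|\<^sup>2 / n\<close> for every zero, and off the diagonal
  the sums of \<open>y powr \<rho>\<close> over the zeros, with \<open>y = m / n > 1\<close>. The zero count is never evaluated.

  The sums over zeros are evaluated by a Landau--Gonek formula uniform in \<open>y\<close>: integrate
  \<open>\<zeta>'/\<zeta>(s) y powr s\<close> over the rectangle \<open>1 - c \<le> Re s \<le> c\<close> with \<open>c = 1 + 1 / (10 + ln x)\<close>. On the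
  right edge the Dirichlet series is integrated term by term; the term \<open>k = y\<close> gives
  \<open>- T / (2 * pi) * \<Lambda> y\<close>. On the left edge the functional equation leads back to a Dirichlet series and
  a slowly varying Gamma factor. The horizontal edges run at heights within 1 of \<open>T\<close> with distance at
  least a constant over \<open>ln T\<close> from all zeros. Summed against \<open>cnj (a m) * a n / m\<close>, every error term
  stays below \<open>x (ln (x T))\<^sup>2 \<Sum>|a n|\<^sup>2 / n\<close>; the delicate one comes from the \<open>k\<close> close to \<open>m / n\<close>.
\<close>

section \<open>Growth of the zeta function\<close>

text \<open>Two logarithms are the whole budget. Division by \<open>m\<close> turns an error of size
  \<open>y\<close> at \<open>y = m / n\<close> into the kernel \<open>1 / n\<close>, and
  Cauchy-Schwarz sums this kernel at the price of \<open>sqrt (1 + ln x)\<close> only. This leaves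
  room for \<open>ln x\<close> from the vertical edges and for \<open>ln T * sqrt (ln T)\<close>
  from the horizontal ones, so a crude bound of the inverse hyperbolic sine is enough. The factor
  \<open>1 / ln y\<close> of the Gamma term becomes the kernel \<open>1 / (m - n)\<close>, which
  costs one logarithm beside \<open>ln T\<close>.

  The obstacle is that \<open>y\<close> need not be an integer: \<open>1 / |y - k|\<close> can be as
  large as \<open>n\<close>, and no bound that depends on the size of \<open>y\<close> alone is good
  enough. The sum over these \<open>k\<close> is therefore carried along and estimated only after
  the summation over \<open>m\<close> and \<open>n\<close>. For the same reason the heights of the
  rectangle must not depend on \<open>y\<close>.

  In \<open>c\<close>, the part \<open>ln x\<close> gives \<open>y powr c \<le> 3 * y\<close> for
  \<open>1 \<le> y \<le> x\<close>, while the 10 forces \<open>c \<le> 11 / 10\<close>, which keeps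
  all edges in the region of the local estimates. Zeros outside the rectangle are treated one by
  one, each at the cost of \<open>x\<close> times the diagonal sum.\<close>

lemma zeta_holomorphic: "zeta holomorphic_on (- {1})"
  using is_zeta_zeta by (simp add: is_zeta_def)

lemma zeta_eq_series:
  assumes "Re s > 1" shows "zeta s = zeta_series s"
proof -
  have "(\<lambda>n. 1 / of_nat (Suc n) powr s) sums zeta s"
    using is_zeta_zeta assms by (simp add: is_zeta_def)
  moreover have "(\<lambda>n. 1 / of_nat (Suc n) powr s) sums zeta_series s"
    using zeta_series_sums[OF assms] by (simp only: powr_minus_divide)
  ultimately show ?thesis by (rule sums_unique2)
qed

text \<open>Clears the pole: the function is entire, and its value 1 at 1 is the residue of
  \<open>zeta\<close>. The polynomial growth and the behaviour near 1 are studied on it.\<close>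

definition zeta_reg :: "complex \<Rightarrow> complex" where
  "zeta_reg s = (if s = 1 then 1 else (s - 1) * zeta s)"

text \<open>The remainder series is holomorphic for \<open>Re s > - real K\<close>, so the
  recurrence extends from \<open>Re s > 1\<close> by the identity theorem. It is stated for an
  arbitrary entire extension \<open>Z\<close> because the identification of \<open>Z\<close> with
  \<open>zeta_reg\<close> already evaluates it at 1.\<close>

lemma zeta_reg_recurrence_aux:
  assumes Z: "Z holomorphic_on UNIV" "\<And>s. Re s > 1 \<Longrightarrow> Z s = (s - 1) * zeta_series s"
    and s: "Re s > - real K"
  shows "Z s = 1 + (\<Sum>n. zeta_rem (Suc K) n s) -
           (\<Sum>k<K. falling (Suc k) s * Z (s + of_nat (Suc k)) / fact (Suc (Suc k)))" (is "_ = ?R s")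
proof (rule analytic_continuation_open[where s = "{s. Re s > 1}" and s' = "{s. Re s > - real K}" and f = Z and g = ?R])
  show "{s. Re s > 1} \<noteq> {}" by (auto intro: exI[of _ 2])
  show "connected {s. Re s > - real K}" by (intro convex_connected convex_halfspace_Re_gt)
  show "Z holomorphic_on {s. Re s > - real K}" using Z(1) holomorphic_on_subset by blast
  have 1: "(\<lambda>s. \<Sum>n. zeta_rem (Suc K) n s) holomorphic_on {s. Re s > - real K}"
    using zeta_rem_holomorphic[of "Suc K"] by simp
  have 2: "(\<lambda>s. Z (s + of_nat (Suc k))) holomorphic_on {s. Re s > - real K}" for k
    using holomorphic_on_compose_gen[of "\<lambda>s. s + of_nat (Suc k)" "{s. Re s > - real K}" Z UNIV] Z(1)
    by (force simp: o_def intro!: holomorphic_intros)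
  show "?R holomorphic_on {s. Re s > - real K}"
    by (intro holomorphic_intros 1 2 falling_holomorphic) auto
  fix z assume "z \<in> {s. 1 < Re s}"
  hence z: "Re z > 1" by simp
  have "Z (z + of_nat (Suc k)) = (z + of_nat (Suc k) - 1) * zeta_series (z + of_nat (Suc k))" for k
    using z by (intro Z(2)) simp
  thus "Z z = ?R z" using zeta_recurrence[OF z, of K] Z(2)[OF z] by (simp only:)
qed (use s in \<open>auto intro: open_halfspace_Re_gt\<close>)

lemma zeta_reg_holomorphic: "zeta_reg holomorphic_on A"
proof -
  obtain Z where Z: "Z holomorphic_on UNIV" "\<And>s. Re s > 1 \<Longrightarrow> Z s = (s - 1) * zeta_series s"
    using zeta_continuation_entire by blast
  have "Z s = zeta_reg s" for s
  proof (cases "s = 1")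
    case True
    \<comment> \<open>\<open>falling (Suc (Suc 0)) 1\<close> contains the factor 0, so the bound of
      the remainder vanishes at 1, and the recurrence with \<open>K = 0\<close> gives
      \<open>Z 1 = 1\<close>.\<close>
    have "zeta_rem (Suc 0) n 1 = 0" for n
      using norm_zeta_rem[of "Suc 0" 1 n] by (simp add: zero_complex.sel)
    thus ?thesis using zeta_reg_recurrence_aux[OF Z, of 0 1] True by (simp add: zeta_reg_def)
  next
    case False
    have "Z s = (s - 1) * zeta s"
    proof (rule analytic_continuation_open[where s = "{s. Re s > 1}" and s' = "- {1}" and f = Z and g = "\<lambda>s. (s - 1) * zeta s"])
      show "{s. Re s > 1} \<noteq> {}" by (auto intro: exI[of _ 2])
      show "connected (- {1::complex})" by (intro connected_punctured_universe) simp
      show "Z holomorphic_on - {1}" using Z(1) holomorphic_on_subset by blast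
      show "(\<lambda>s. (s - 1) * zeta s) holomorphic_on - {1}" by (intro holomorphic_intros zeta_holomorphic)
    qed (use False Z(2) zeta_eq_series in \<open>auto intro: open_halfspace_Re_gt\<close>)
    thus ?thesis using False by (simp add: zeta_reg_def)
  qed
  hence "Z = zeta_reg" by auto
  thus ?thesis using Z(1) holomorphic_on_subset by blast
qed

lemma zeta_reg_recurrence:
  assumes "Re s > - real K"
  shows "zeta_reg s = 1 + (\<Sum>n. zeta_rem (Suc K) n s) -
           (\<Sum>k<K. falling (Suc k) s * zeta_reg (s + of_nat (Suc k)) / fact (Suc (Suc k)))"
proof (rule zeta_reg_recurrence_aux[OF zeta_reg_holomorphic _ assms])
  fix s :: complex assume "Re s > 1"
  thus "zeta_reg s = (s - 1) * zeta_series s" using zeta_eq_series[of s] by (auto simp: zeta_reg_def)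
qed

lemma norm_falling_le: "norm (falling k s) \<le> (real k + 1) ^ k * (1 + norm s) ^ k"
proof -
  have "norm (falling k s) = (\<Prod>j<k. norm (1 - s - of_nat j))"
    by (simp add: falling_def prod_norm)
  also have "\<dots> \<le> (\<Prod>j<k. (real k + 1) * (1 + norm s))"
  proof (intro prod_mono conjI)
    fix j assume "j \<in> {..<k}"
    have "norm (1 - s - of_nat j) \<le> norm (1 - s) + norm (of_nat j :: complex)" by (rule norm_triangle_ineq4)
    also have "norm (1 - s) \<le> norm (1::complex) + norm s" by (rule norm_triangle_ineq4)
    finally have "norm (1 - s - of_nat j) \<le> 1 + norm s + real j" by simp
    also have "\<dots> \<le> 1 + norm s + real k" using \<open>j \<in> _\<close> by simp
    also have "\<dots> \<le> (real k + 1) * (1 + norm s)" by (simp add: algebra_simps)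
    finally show "norm (1 - s - of_nat j) \<le> (real k + 1) * (1 + norm s)" .
  qed simp
  also have "\<dots> = (real k + 1) ^ k * (1 + norm s) ^ k" by (simp add: power_mult_distrib)
  finally show ?thesis .
qed

text \<open>Each induction step moves the half-plane one unit to the left: the recurrence expresses
  \<open>zeta_reg s\<close> through its values at \<open>s + 1\<close>, \<open>s + 2\<close> and so
  on, which lie in the previous half-plane, times polynomials in \<open>s\<close>. The margin
  \<open>1 / 2\<close> makes the remainder terms at most a multiple of \<open>n powr (-3/2)\<close>.
  The exponent \<open>A\<close> is harmless, since after taking logarithms it only multiplies
  \<open>ln T\<close>.\<close>

lemma zeta_reg_growth:
  "\<exists>C\<ge>0. \<exists>A::nat. \<forall>s. Re s \<ge> 1 / 2 - real K \<longrightarrow> norm (zeta_reg s) \<le> C * (1 + norm s) ^ A"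
proof (induction K)
  have rem: "norm (\<Sum>n. zeta_rem (Suc K) n s) \<le>
      (real (K+2) + 1) ^ (K+2) * (\<Sum>n. real (Suc n) powr (-3/2)) * (1 + norm s) ^ (K + 2)" (is "_ \<le> ?c * _ * _")
    if s: "Re s \<ge> 1 / 2 - real K" for s K
  proof -
    let ?q = "norm (falling (Suc (Suc K)) s)"
    have sm: "summable (\<lambda>n. real (Suc n) powr (-3/2))" by (rule summable_Suc_powr) simp
    have bd: "norm (zeta_rem (Suc K) n s) \<le> ?q * real (Suc n) powr (-3/2)" for n
    proof -
      have "norm (zeta_rem (Suc K) n s) \<le> ?q / fact (Suc K) * real (Suc n) powr (- Re s - real (Suc K))"
        using s by (intro norm_zeta_rem) simp
      also have "\<dots> \<le> ?q / 1 * real (Suc n) powr (-3/2)"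
        using s by (intro mult_mono divide_left_mono powr_mono) (auto simp del: fact_Suc)
      finally show ?thesis by simp
    qed
    have "norm (\<Sum>n. zeta_rem (Suc K) n s) \<le> (\<Sum>n. ?q * real (Suc n) powr (-3/2))"
      by (rule norm_suminf_le[OF bd summable_mult[OF sm]])
    also have "\<dots> = ?q * (\<Sum>n. real (Suc n) powr (-3/2))" by (rule suminf_mult[OF sm])
    also have "\<dots> \<le> (?c * (1 + norm s) ^ (K + 2)) * (\<Sum>n. real (Suc n) powr (-3/2))"
      using norm_falling_le[of "Suc (Suc K)" s] suminf_nonneg[OF sm] by (intro mult_right_mono) auto
    finally show ?thesis by (simp only: mult_ac)
  qed
  let ?S = "\<Sum>n. real (Suc n) powr (-3/2)"
  have S0: "?S \<ge> 0" by (intro suminf_nonneg summable_Suc_powr) auto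
  have one: "1 \<le> (1 + norm s) ^ j" for s :: complex and j by (rule one_le_power) simp
  {
    case 0
    have "norm (zeta_reg s) \<le> (1 + 9 * ?S) * (1 + norm s) ^ 2" if "Re s \<ge> 1/2" for s
    proof -
      have "zeta_reg s = 1 + (\<Sum>n. zeta_rem (Suc 0) n s)"
        using zeta_reg_recurrence[of 0 s] that by simp
      hence "norm (zeta_reg s) \<le> 1 + norm (\<Sum>n. zeta_rem (Suc 0) n s)"
        by (metis norm_one norm_triangle_ineq)
      also have "\<dots> \<le> (1 + norm s) ^ 2 + 9 * ?S * (1 + norm s) ^ 2"
        using rem[of 0 s] that one[of s 2] by (intro add_mono) (auto simp: power2_eq_square)
      finally show ?thesis by (simp add: algebra_simps)
    qed
    thus ?case using S0 by (intro exI[of _ "1 + 9 * ?S"] conjI exI[of _ 2]) auto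
  next
    case (Suc K)
    then obtain C A where C: "C \<ge> 0" and *: "\<And>s. Re s \<ge> 1 / 2 - real K \<Longrightarrow> norm (zeta_reg s) \<le> C * (1 + norm s) ^ A"
      by blast
    let ?c = "(real (Suc K+2) + 1) ^ (Suc K+2) * ?S"
    let ?B = "K + A + 4"
    let ?d = "\<lambda>k. (real (Suc k) + 1) ^ (Suc k) * (C * (real k + 2) ^ A)"
    let ?D = "1 + ?c + (\<Sum>k<Suc K. ?d k)"
    have "norm (zeta_reg s) \<le> ?D * (1 + norm s) ^ ?B" if s: "Re s \<ge> 1/2 - real (Suc K)" for s
    proof -
      let ?t = "\<lambda>k. falling (Suc k) s * zeta_reg (s + of_nat (Suc k)) / fact (Suc (Suc k))"
      let ?N = "1 + norm s"
      have pm: "?N ^ j \<le> ?N ^ ?B" if "j \<le> ?B" for j using that by (intro power_increasing) auto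
      have t: "norm (?t k) \<le> ?d k * ?N ^ ?B" if k: "k < Suc K" for k
      proof -
        have "norm (?t k) = norm (falling (Suc k) s) * norm (zeta_reg (s + of_nat (Suc k))) / fact (Suc (Suc k))"
          by (simp add: norm_mult norm_divide del: fact_Suc of_nat_Suc)
        also have "\<dots> \<le> norm (falling (Suc k) s) * norm (zeta_reg (s + of_nat (Suc k))) / 1"
          by (intro divide_left_mono) (auto simp del: fact_Suc)
        also have "\<dots> \<le> ((real (Suc k) + 1) ^ Suc k * ?N ^ Suc k) * (C * ((real k + 2) * ?N) ^ A)"
          unfolding div_by_1
        proof (intro mult_mono norm_falling_le)
          have "norm (s + of_nat (Suc k)) \<le> norm s + (real k + 1)"
            using norm_triangle_ineq[of s "of_nat (Suc k)"] norm_of_nat[of "Suc k", where ?'a = complex] of_nat_Suc[of k, where ?'a = real] by linarith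
          moreover have "(real k + 2) * ?N = real k + 2 + real k * norm s + 2 * norm s"
            by (simp add: algebra_simps)
          ultimately have "1 + norm (s + of_nat (Suc k)) \<le> (real k + 2) * ?N"
            using mult_nonneg_nonneg[of "real k" "norm s"] by (smt (verit) norm_ge_zero of_nat_0_le_iff)
          hence "C * (1 + norm (s + of_nat (Suc k))) ^ A \<le> C * ((real k + 2) * ?N) ^ A"
            using C by (intro mult_left_mono power_mono) auto
          moreover have "norm (zeta_reg (s + of_nat (Suc k))) \<le> C * (1 + norm (s + of_nat (Suc k))) ^ A"
            using s by (intro *) auto
          ultimately show "norm (zeta_reg (s + of_nat (Suc k))) \<le> C * ((real k + 2) * ?N) ^ A" by linarith
        qed auto
        also have "\<dots> = ?d k * ?N ^ (Suc k + A)"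
          by (simp only: power_mult_distrib power_add mult_ac)
        also have "\<dots> \<le> ?d k * ?N ^ ?B" using k C by (intro mult_left_mono pm) auto
        finally show ?thesis .
      qed
      have "zeta_reg s = 1 + (\<Sum>n. zeta_rem (Suc (Suc K)) n s) - (\<Sum>k<Suc K. ?t k)"
        using s by (intro zeta_reg_recurrence) auto
      hence "norm (zeta_reg s) \<le> norm (1 + (\<Sum>n. zeta_rem (Suc (Suc K)) n s)) + norm (\<Sum>k<Suc K. ?t k)"
        using norm_triangle_ineq4 by metis
      also have "\<dots> \<le> (1 + norm (\<Sum>n. zeta_rem (Suc (Suc K)) n s)) + (\<Sum>k<Suc K. norm (?t k))"
        by (intro add_mono norm_sum order_trans[OF norm_triangle_ineq]) auto
      also have "\<dots> \<le> (?N ^ ?B + ?c * ?N ^ (Suc K + 2)) + (\<Sum>k<Suc K. ?d k * ?N ^ ?B)"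
        using rem[OF s] one by (intro add_mono sum_mono t) auto
      also have "\<dots> \<le> (?N ^ ?B + ?c * ?N ^ ?B) + (\<Sum>k<Suc K. ?d k * ?N ^ ?B)"
      proof -
        have "Suc K + 2 \<le> ?B" by simp
        from mult_left_mono[OF pm[OF this], of ?c] S0 show ?thesis by simp
      qed
      also have "\<dots> = ?D * ?N ^ ?B" by (simp only: sum_distrib_right distrib_right mult_1)
      finally show ?thesis .
    qed
    moreover have "?D \<ge> 0" using S0 C by (intro add_nonneg_nonneg sum_nonneg mult_nonneg_nonneg) auto
    ultimately show ?case by blast
  }
qed

section \<open>Zeros and the logarithmic derivative of a bounded function\<close>

text \<open>The map \<open>w / (2 * M - w)\<close> sends the half-plane \<open>Re w < M\<close> into
  the unit disc and fixes 0, so the Schwarz lemma applies to its composition with \<open>h\<close>,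
  rescaled to the unit disc. The resulting inequality
  \<open>R * norm (h z) \<le> r * (2 * M + norm (h z))\<close> is then solved for
  \<open>norm (h z)\<close>.\<close>

lemma Borel_Caratheodory:
  assumes h: "h holomorphic_on ball z0 R" "h z0 = 0" and M: "\<And>z. z \<in> ball z0 R \<Longrightarrow> Re (h z) < M"
    and r: "0 < r" "r < R" and z: "z \<in> cball z0 r"
  shows "norm (h z) \<le> 2 * M * r / (R - r)"
proof -
  have M0: "M > 0" using M[of z0] r h(2) by simp
  define F where "F = (\<lambda>w. z0 + of_real R * w)"
  define \<phi> where "\<phi> = (\<lambda>w. h (F w) / (2 * of_real M - h (F w)))"
  have F: "F w \<in> ball z0 R" if "norm w < 1" for w
    using that r by (auto simp: F_def dist_norm norm_mult)
  have nz: "2 * of_real M - h (F w) \<noteq> 0" if "norm w < 1" for w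
    using M[OF F[OF that]] M0 by (auto simp: complex_eq_iff)
  have lt: "norm (h (F w)) < norm (2 * of_real M - h (F w))" if "norm w < 1" for w
  proof -
    have "(2 * M - Re (h (F w)))\<^sup>2 - (Re (h (F w)))\<^sup>2 = 4 * M * (M - Re (h (F w)))"
      by (simp add: power2_eq_square algebra_simps)
    also have "\<dots> > 0" using M[OF F[OF that]] M0 by simp
    finally show ?thesis by (auto simp: cmod_def)
  qed
  have "\<phi> holomorphic_on ball 0 1"
  proof -
    have "F holomorphic_on ball 0 1" unfolding F_def by (intro holomorphic_intros)
    hence "(\<lambda>w. h (F w)) holomorphic_on ball 0 1"
      using holomorphic_on_compose_gen[OF _ h(1), of F "ball 0 1"] F by (force simp: o_def)
    thus ?thesis unfolding \<phi>_def using nz by (intro holomorphic_intros) auto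
  qed
  moreover have "norm (\<phi> w) < 1" if "norm w < 1" for w
    using lt[OF that] nz[OF that] by (auto simp: \<phi>_def norm_divide)
  moreover have "\<phi> 0 = 0" by (simp add: \<phi>_def F_def h)
  ultimately have sch: "norm (\<phi> w) \<le> norm w" if "norm w < 1" for w
    using Schwarz_Lemma(1)[of \<phi> w] that by simp
  define w where "w = (z - z0) / of_real R"
  have w: "norm w \<le> r / R" "r / R < 1"
    using z r by (auto simp: w_def norm_divide dist_norm norm_minus_commute divide_right_mono)
  hence w1: "norm w < 1" by simp
  have Fw: "F w = z" using r by (simp add: F_def w_def)
  have "norm (h z) / norm (2 * of_real M - h z) \<le> norm w"
    using sch[OF w1] by (simp add: \<phi>_def Fw norm_divide)
  hence "norm (h z) \<le> norm w * norm (2 * of_real M - h z)"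
    using nz[OF w1] by (simp add: Fw field_simps)
  also have "\<dots> \<le> (r / R) * (2 * M + norm (h z))"
    using w r M0 norm_triangle_ineq4[of "2 * of_real M" "h z"] by (intro mult_mono) (auto simp: norm_mult)
  finally have "R * norm (h z) \<le> r * (2 * M + norm (h z))"
    using r by (simp add: field_simps)
  thus ?thesis using r by (simp add: field_simps)
qed

lemma DERIV_prod_linear_power:
  fixes z :: complex and m :: "complex \<Rightarrow> nat"
  assumes "finite Z" "z \<notin> Z"
  shows "((\<lambda>w. \<Prod>\<rho>\<in>Z. (w - \<rho>) ^ m \<rho>) has_field_derivative
           (\<Prod>\<rho>\<in>Z. (z - \<rho>) ^ m \<rho>) * (\<Sum>\<rho>\<in>Z. of_nat (m \<rho>) / (z - \<rho>))) (at z)"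
  using assms
proof (induction Z)
  case (insert a Z)
  have "((\<lambda>w. (w - a) ^ m a) has_field_derivative (z - a) ^ m a * (of_nat (m a) / (z - a))) (at z)"
  proof (cases "m a")
    case (Suc n)
    have "((\<lambda>w. (w - a) ^ Suc n) has_field_derivative of_nat (Suc n) * (z - a) ^ n) (at z)"
      by (rule derivative_eq_intros refl)+ simp
    moreover have "of_nat (Suc n) * (z - a) ^ n = (z - a) ^ Suc n * (of_nat (Suc n) / (z - a))"
      using insert.prems by simp
    ultimately show ?thesis using Suc by (simp only:)
  qed auto
  from DERIV_mult[OF this insert.IH] insert.prems insert.hyps show ?case
    by (simp add: algebra_simps)
qed auto

text \<open>Dividing out the zeros on \<open>Z\<close>; at a point of \<open>Z\<close> the quotient is continued by the local
  cofactor \<open>zor_poly\<close>.\<close>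

lemma holomorphic_factor_finite_zeros:
  fixes f :: "complex \<Rightarrow> complex"
  defines "m \<equiv> \<lambda>\<rho>. nat (zorder f \<rho>)"
  assumes f: "f holomorphic_on A" "open A" "connected A" "\<exists>w\<in>A. f w \<noteq> 0"
    and Z: "finite Z" "Z \<subseteq> {z\<in>A. f z = 0}"
  obtains g where "g holomorphic_on A" "\<And>z. z \<in> A \<Longrightarrow> f z = g z * (\<Prod>\<rho>\<in>Z. (z - \<rho>) ^ m \<rho>)"
    "\<And>z. z \<in> Z \<Longrightarrow> g z \<noteq> 0"
proof -
  define P where "P = (\<lambda>z. \<Prod>\<rho>\<in>Z. (z - \<rho>) ^ m \<rho>)"
  define Q where "Q = (\<lambda>a z. \<Prod>\<rho>\<in>Z-{a}. (z - \<rho>) ^ m \<rho>)"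
  have PQ: "P z = (z - a) ^ m a * Q a z" if "a \<in> Z" for a z
    using that Z by (simp add: P_def Q_def prod.remove)
  have Pnz: "P z \<noteq> 0" if "z \<notin> Z" for z using that Z by (auto simp: P_def)
  have Qnz: "Q a z \<noteq> 0" if "z \<notin> Z - {a}" for a z using that Z by (auto simp: Q_def)
  define g where "g = (\<lambda>z. if z \<in> Z then zor_poly f z z / Q z z else f z / P z)"
  have loc: "\<exists>U. open U \<and> a \<in> U \<and> (\<lambda>z. zor_poly f a z / Q a z) holomorphic_on U \<and>
      zor_poly f a a \<noteq> 0 \<and> (\<forall>z\<in>U. g z = zor_poly f a z / Q a z)" if a: "a \<in> Z" for a
  proof -
    have "a \<in> A" and fa: "f a = 0" using a Z by auto
    from zorder_exist_zero[OF f(1-3) this(1) f(4)] fa obtain r where r: "r > 0" "cball a r \<subseteq> A"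
      "zor_poly f a holomorphic_on cball a r"
      "\<And>w. w \<in> cball a r \<Longrightarrow> f w = zor_poly f a w * (w - a) ^ m a" "\<And>w. w \<in> cball a r \<Longrightarrow> zor_poly f a w \<noteq> 0"
      "zorder f a > 0"
      unfolding m_def by (auto split: if_splits)
    define U where "U = ball a r - (Z - {a})"
    have "open U" unfolding U_def using Z by (intro open_Diff finite_imp_closed) auto
    moreover have "a \<in> U" using r by (auto simp: U_def)
    moreover have "(\<lambda>z. zor_poly f a z / Q a z) holomorphic_on U"
    proof (intro holomorphic_intros)
      show "zor_poly f a holomorphic_on U" by (rule holomorphic_on_subset[OF r(3)]) (auto simp: U_def)
      show "Q a holomorphic_on U" unfolding Q_def by (intro holomorphic_intros)
      show "Q a z \<noteq> 0" if "z \<in> U" for z using that by (intro Qnz) (auto simp: U_def)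
    qed
    moreover have "g z = zor_poly f a z / Q a z" if z: "z \<in> U" for z
    proof (cases "z = a")
      case False
      hence "z \<notin> Z" using z by (auto simp: U_def)
      hence "g z = f z / P z" by (simp add: g_def)
      also have "f z = zor_poly f a z * (z - a) ^ m a" using z by (intro r(4)) (auto simp: U_def)
      finally show ?thesis using PQ[OF a, of z] False by simp
    qed (use a in \<open>simp add: g_def\<close>)
    moreover have "zor_poly f a a \<noteq> 0" using r by auto
    ultimately show ?thesis by blast
  qed
  have "g holomorphic_on A"
  proof (subst holomorphic_on_open[OF f(2)], intro ballI)
    fix z assume z: "z \<in> A"
    show "\<exists>D. (g has_field_derivative D) (at z)"
    proof (cases "z \<in> Z")
      case True
      from loc[OF True] obtain U where U: "open U" "z \<in> U" "(\<lambda>w. zor_poly f z w / Q z w) holomorphic_on U"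
        "\<And>w. w \<in> U \<Longrightarrow> g w = zor_poly f z w / Q z w" by blast
      then obtain D where "((\<lambda>w. zor_poly f z w / Q z w) has_field_derivative D) (at z)"
        using holomorphic_on_open by blast
      hence "(g has_field_derivative D) (at z)"
        by (rule has_field_derivative_transform_within_open[OF _ U(1,2)]) (simp add: U(4))
      thus ?thesis by blast
    next
      case False
      have "(\<lambda>w. f w / P w) holomorphic_on (A - Z)"
        using Pnz holomorphic_on_subset[OF f(1)] unfolding P_def by (intro holomorphic_intros) auto
      moreover have o: "open (A - Z)" using Z f(2) by (intro open_Diff finite_imp_closed) auto
      ultimately obtain D where "((\<lambda>w. f w / P w) has_field_derivative D) (at z)"
        using holomorphic_on_open z False by blast
      hence "(g has_field_derivative D) (at z)"
        by (rule has_field_derivative_transform_within_open[OF _ o]) (use z False in \<open>auto simp: g_def\<close>)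
      thus ?thesis by blast
    qed
  qed
  moreover have "f z = g z * P z" if "z \<in> A" for z
  proof (cases "z \<in> Z")
    case True
    hence "P z = 0" using PQ[OF True, of z] zorder_exist_zero[OF f(1-3) _ f(4), of z] Z
      by (auto simp: m_def)
    thus ?thesis using True Z by auto
  qed (use Pnz in \<open>auto simp: g_def\<close>)
  moreover have "g z \<noteq> 0" if "z \<in> Z" for z
    using loc[OF that] Qnz[of z z] by auto
  ultimately show ?thesis using that unfolding P_def by blast
qed

text \<open>A Jensen-type count and Landau's local expansion from one factorization
  \<open>f = g * P\<close>, where \<open>P\<close> carries the zeros in the disc of radius
  \<open>rc\<close>. On the circle of radius \<open>Q\<close> each linear factor is at least
  \<open>Q - rc\<close>, at the centre at most \<open>rc\<close>; by the maximum principle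
  \<open>g\<close> is smaller than the trivial bound by \<open>q ^ N\<close>, where
  \<open>q = (Q - rc) / rc > 1\<close> because \<open>2 * rc < Q\<close>. At the centre this bounds
  the number of zeros. Since \<open>g\<close> has no zero in the disc of radius \<open>rc\<close>,
  it has a logarithm there; Borel-Caratheodory bounds it on radius \<open>rb\<close>, and Cauchy's
  inequality bounds its derivative on radius \<open>ra\<close>.\<close>

lemma zero_count_and_logderiv_bound:
  fixes f :: "complex \<Rightarrow> complex" and ra rb rc Q R M :: real and \<xi> :: complex
  defines "Z \<equiv> {z\<in>cball \<xi> rc. f z = 0}" and "m \<equiv> \<lambda>\<rho>. nat (zorder f \<rho>)"
  assumes f: "f holomorphic_on ball \<xi> R" "f \<xi> \<noteq> 0"
    and r: "0 < ra" "ra < rb" "rb < rc" "2 * rc < Q" "Q < R"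
    and M: "\<And>z. z \<in> ball \<xi> R \<Longrightarrow> norm (f z) \<le> exp M * norm (f \<xi>)"
  shows "finite Z" "real (\<Sum>\<rho>\<in>Z. m \<rho>) * ln ((Q - rc) / rc) \<le> M"
    "\<And>s. s \<in> cball \<xi> ra \<Longrightarrow> f s \<noteq> 0 \<Longrightarrow>
       norm (deriv f s / f s - (\<Sum>\<rho>\<in>Z. of_nat (m \<rho>) / (s - \<rho>))) \<le> 2 * rb / ((rc - rb) * (rb - ra)) * (M + 1)"
proof -
  let ?A = "ball \<xi> R"
  have \<xi>: "\<xi> \<in> ?A" using r by simp
  show fin: "finite Z"
  proof (cases "f constant_on ?A")
    case True
    hence "f z \<noteq> 0" if "z \<in> ?A" for z using f(2) \<xi> that by (metis constant_on_def)
    hence "Z = {}" using r by (auto simp: Z_def)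
    thus ?thesis by simp
  next
    case False
    thus ?thesis unfolding Z_def
      by (intro holomorphic_compact_finite_zeros[OF f(1)]) (use r in auto)
  qed
  have ZA: "Z \<subseteq> {z\<in>?A. f z = 0}" using r by (auto simp: Z_def)
  obtain g where g: "g holomorphic_on ?A" "\<And>z. z \<in> ?A \<Longrightarrow> f z = g z * (\<Prod>\<rho>\<in>Z. (z - \<rho>) ^ m \<rho>)"
    "\<And>z. z \<in> Z \<Longrightarrow> g z \<noteq> 0"
    unfolding m_def
    by (rule holomorphic_factor_finite_zeros[OF f(1) open_ball connected_ball _ fin ZA])
       (use f(2) \<xi> in blast)+
  define P where "P = (\<lambda>z. \<Prod>\<rho>\<in>Z. (z - \<rho>) ^ m \<rho>)"
  define N where "N = (\<Sum>\<rho>\<in>Z. m \<rho>)"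
  define q where "q = (Q - rc) / rc"
  have q: "q > 1" using r by (simp add: q_def)
  have Plow: "norm (P z) \<ge> (Q - rc) ^ N" if "norm (z - \<xi>) = Q" for z
  proof -
    have "(Q - rc) ^ N = (\<Prod>\<rho>\<in>Z. (Q - rc) ^ m \<rho>)" by (simp add: N_def power_sum)
    also have "\<dots> \<le> (\<Prod>\<rho>\<in>Z. norm (z - \<rho>) ^ m \<rho>)"
    proof (intro prod_mono conjI power_mono)
      fix \<rho> assume "\<rho> \<in> Z"
      hence "norm (\<rho> - \<xi>) \<le> rc" by (simp add: Z_def dist_norm norm_minus_commute)
      thus "Q - rc \<le> norm (z - \<rho>)" using norm_triangle_ineq[of "z - \<rho>" "\<rho> - \<xi>"] that by simp
    qed (use r in auto)
    also have "\<dots> = norm (P z)" by (simp add: P_def prod_norm[symmetric] norm_power)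
    finally show ?thesis .
  qed
  have Pup: "norm (P \<xi>) \<le> rc ^ N"
  proof -
    have "norm (P \<xi>) = (\<Prod>\<rho>\<in>Z. norm (\<xi> - \<rho>) ^ m \<rho>)" by (simp add: P_def prod_norm[symmetric] norm_power)
    also have "\<dots> \<le> (\<Prod>\<rho>\<in>Z. rc ^ m \<rho>)"
      by (intro prod_mono conjI power_mono) (auto simp: Z_def dist_norm)
    also have "\<dots> = rc ^ N" by (simp add: N_def power_sum)
    finally show ?thesis .
  qed
  have g0: "g \<xi> \<noteq> 0" using g(2)[OF \<xi>] f(2) by auto
  have gb: "norm (g z) \<le> exp M * norm (g \<xi>) / q ^ N" if z: "z \<in> cball \<xi> Q" for z
  proof (rule maximum_modulus_frontier[of g "cball \<xi> Q"])
    show "g holomorphic_on interior (cball \<xi> Q)"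
      using r by (intro holomorphic_on_subset[OF g(1)]) auto
    show "continuous_on (closure (cball \<xi> Q)) g"
      using r by (intro holomorphic_on_imp_continuous_on holomorphic_on_subset[OF g(1)]) auto
    fix w assume "w \<in> frontier (cball \<xi> Q)"
    hence w: "norm (w - \<xi>) = Q" using r by (simp add: dist_norm norm_minus_commute)
    hence wA: "w \<in> ?A" using r by (simp add: dist_norm norm_minus_commute)
    have pos: "(Q - rc) ^ N > 0" using r by simp
    have "norm (g w) * (Q - rc) ^ N \<le> norm (g w) * norm (P w)"
      using Plow[OF w] by (intro mult_left_mono) auto
    also have "\<dots> = norm (f w)" using g(2)[OF wA] by (simp add: P_def norm_mult)
    also have "\<dots> \<le> exp M * norm (f \<xi>)" by (rule M[OF wA])
    also have "\<dots> = exp M * (norm (g \<xi>) * norm (P \<xi>))" using g(2)[OF \<xi>] by (simp add: P_def norm_mult)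
    also have "\<dots> \<le> exp M * (norm (g \<xi>) * rc ^ N)" using Pup by (intro mult_left_mono) auto
    finally show "norm (g w) \<le> exp M * norm (g \<xi>) / q ^ N"
      using pos r by (simp add: q_def power_divide field_simps)
  qed (use z in auto)
  have qN: "1 \<le> q ^ N" using q by simp
  have "q ^ N \<le> exp M"
    using gb[of \<xi>] g0 r q by (simp add: field_simps)
  hence "ln (q ^ N) \<le> ln (exp M)" using q by (subst ln_le_cancel_iff) auto
  thus "real (\<Sum>\<rho>\<in>Z. m \<rho>) * ln ((Q - rc) / rc) \<le> M"
    using q by (simp add: ln_realpow N_def q_def)
  have gb': "norm (g z) \<le> exp M * norm (g \<xi>)" if "z \<in> cball \<xi> Q" for z
  proof -
    have "exp M * norm (g \<xi>) / q ^ N \<le> exp M * norm (g \<xi>) / 1"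
      using qN by (intro divide_left_mono) auto
    thus ?thesis using gb[OF that] by simp
  qed
  have gnz: "g z \<noteq> 0" if "z \<in> cball \<xi> rc" for z
    using g(2)[of z] g(3)[of z] that r by (cases "z \<in> Z") (auto simp: Z_def)
  have "g holomorphic_on ball \<xi> rc" using r by (intro holomorphic_on_subset[OF g(1)]) auto
  then obtain k where k: "k holomorphic_on ball \<xi> rc" "\<And>z. z \<in> ball \<xi> rc \<Longrightarrow> exp (k z) = g z"
    by (rule holomorphic_logarithm_exists[OF convex_ball open_ball, of g \<xi> rc \<xi>]) (use gnz r in auto)
  define h where "h = (\<lambda>z. k z - k \<xi>)"
  have h: "h holomorphic_on ball \<xi> rc" unfolding h_def by (intro holomorphic_intros k)
  \<comment> \<open>The bound of \<open>g\<close> yields only \<open>Re (h z) \<le> M\<close>; the 1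
    supplies the strict inequality that \<open>Borel_Caratheodory\<close> asks for.\<close>
  have reh: "Re (h z) < M + 1" if z: "z \<in> ball \<xi> rc" for z
  proof -
    have "exp (Re (h z)) = norm (exp (k z) / exp (k \<xi>))" by (simp add: h_def norm_exp_eq_Re exp_diff[symmetric])
    also have "\<dots> = norm (g z) / norm (g \<xi>)" using k(2)[of z] k(2)[of \<xi>] z r by (simp add: norm_divide)
    also have "\<dots> \<le> exp M" using gb'[of z] z r g0 by (simp add: field_simps)
    finally show ?thesis by simp
  qed
  have hb: "norm (h z) \<le> 2 * (M + 1) * rb / (rc - rb)" if "z \<in> cball \<xi> rb" for z
    by (rule Borel_Caratheodory[OF h _ reh]) (use r that in \<open>auto simp: h_def\<close>)
  fix s assume s: "s \<in> cball \<xi> ra" "f s \<noteq> 0"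
  have sZ: "s \<notin> Z" using s by (auto simp: Z_def)
  have sA: "s \<in> ?A" and sr2: "s \<in> ball \<xi> rc" using s r by auto
  have sub: "cball s (rb - ra) \<subseteq> cball \<xi> rb"
  proof
    fix x assume "x \<in> cball s (rb - ra)"
    thus "x \<in> cball \<xi> rb" using s(1) dist_triangle[of \<xi> x s] by (simp add: dist_commute)
  qed
  moreover have "cball \<xi> rb \<subseteq> ball \<xi> rc" using r by auto
  ultimately have sub2: "cball s (rb - ra) \<subseteq> ball \<xi> rc" by (rule subset_trans)
  have "norm ((deriv ^^ 1) h s) \<le> fact 1 * (2 * (M + 1) * rb / (rc - rb)) / (rb - ra) ^ 1"
  proof (rule Cauchy_inequality)
    show "h holomorphic_on ball s (rb - ra)"
      by (rule holomorphic_on_subset[OF h subset_trans[OF ball_subset_cball sub2]])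
    show "continuous_on (cball s (rb - ra)) h"
      by (intro holomorphic_on_imp_continuous_on holomorphic_on_subset[OF h sub2])
    show "norm (h x) \<le> 2 * (M + 1) * rb / (rc - rb)" if "norm (s - x) = rb - ra" for x
    proof (rule hb)
      have "x \<in> cball s (rb - ra)" using that by (simp add: dist_norm)
      thus "x \<in> cball \<xi> rb" using sub by blast
    qed
  qed (use r in auto)
  hence 1: "norm (deriv h s) \<le> 2 * rb / ((rc - rb) * (rb - ra)) * (M + 1)"
    using r by (simp add: field_simps)
  have "(h has_field_derivative deriv h s) (at s)"
    using h sr2 holomorphic_derivI by blast
  hence "((\<lambda>z. exp (h z) * g \<xi>) has_field_derivative exp (h s) * deriv h s * g \<xi>) (at s)"
    by (auto intro!: derivative_eq_intros)
  moreover have eg: "exp (h z) * g \<xi> = g z" if "z \<in> ball \<xi> rc" for z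
    using k(2)[of z] k(2)[of \<xi>] that r g0 by (simp add: h_def exp_diff)
  ultimately have "(g has_field_derivative exp (h s) * deriv h s * g \<xi>) (at s)"
    by (rule has_field_derivative_transform_within_open[OF _ open_ball sr2])
  also have "exp (h s) * deriv h s * g \<xi> = g s * deriv h s"
    using eg[OF sr2] by (simp add: mult_ac)
  finally have dg: "(g has_field_derivative g s * deriv h s) (at s)" .
  have "((\<lambda>z. g z * P z) has_field_derivative
      g s * deriv h s * P s + P s * (\<Sum>\<rho>\<in>Z. of_nat (m \<rho>) / (s - \<rho>)) * g s) (at s)"
    by (rule DERIV_mult[OF dg]) (unfold P_def, rule DERIV_prod_linear_power[OF fin sZ])
  hence "(f has_field_derivative
      g s * deriv h s * P s + P s * (\<Sum>\<rho>\<in>Z. of_nat (m \<rho>) / (s - \<rho>)) * g s) (at s)"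
    by (rule has_field_derivative_transform_within_open[OF _ open_ball sA]) (simp add: g(2) P_def)
  hence "deriv f s = g s * deriv h s * P s + P s * (\<Sum>\<rho>\<in>Z. of_nat (m \<rho>) / (s - \<rho>)) * g s"
    by (rule DERIV_imp_deriv)
  moreover have "f s = g s * P s" using g(2)[OF sA] by (simp add: P_def)
  ultimately have "deriv f s / f s - (\<Sum>\<rho>\<in>Z. of_nat (m \<rho>) / (s - \<rho>)) = deriv h s"
    using s(2) by (simp add: field_simps)
  thus "norm (deriv f s / f s - (\<Sum>\<rho>\<in>Z. of_nat (m \<rho>) / (s - \<rho>))) \<le> 2 * rb / ((rc - rb) * (rb - ra)) * (M + 1)"
    using 1 by simp
qed

section \<open>The zeta function right of the critical strip\<close>

lemma norm_nat_powr: "norm (of_nat n powr s :: complex) = real n powr Re s"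
  using norm_powr_real_powr[of "of_nat n" s] by (cases "n = 0") auto

lemma ln_times_powr_le:
  assumes "e > 0" "\<sigma> \<ge> 1 + e"
  shows "ln (real n) * real n powr (-\<sigma>) \<le> 2 / e * real n powr (-(1 + e / 2))"
proof (cases "n = 0")
  case False
  hence n: "real n \<ge> 1" by simp
  have "ln (real n) * real n powr (-\<sigma>) \<le> (real n powr (e / 2) / (e / 2)) * real n powr (-(1 + e))"
    using assms n by (intro mult_mono ln_powr_bound powr_mono) auto
  also have "\<dots> = 2 / e * (real n powr (e / 2) * real n powr (-(1 + e)))" by simp
  also have "real n powr (e / 2) * real n powr (-(1 + e)) = real n powr (e / 2 - (1 + e))"
    using n by (simp flip: powr_add)
  also have "e / 2 - (1 + e) = - (1 + e / 2)" by simp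
  finally show ?thesis .
qed simp

lemma summable_ln_powr:
  assumes "\<sigma> > 1"
  shows "summable (\<lambda>n. ln (real n) * real n powr (-\<sigma>))"
proof (rule summable_comparison_test)
  show "\<exists>N. \<forall>n\<ge>N. norm (ln (real n) * real n powr (-\<sigma>)) \<le> 2 / (\<sigma> - 1) * real n powr (-(1 + (\<sigma> - 1) / 2))"
    using ln_times_powr_le[of "\<sigma> - 1" \<sigma>] assms by (intro exI[of _ 1]) (auto simp: abs_mult)
  show "summable (\<lambda>n. 2 / (\<sigma> - 1) * real n powr (-(1 + (\<sigma> - 1) / 2)))"
    using assms by (intro summable_mult) (simp add: summable_real_powr_iff)
qed

lemma mangoldt_le_ln: "mangoldt n \<le> ln (real n)"
  using mangoldt_le[of n] by (cases "n = 0") auto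

lemma summable_mangoldt_powr:
  assumes "\<sigma> > 1"
  shows "summable (\<lambda>n. mangoldt n * real n powr (-\<sigma>))"
  by (rule summable_comparison_test[OF _ summable_ln_powr[OF assms]])
     (auto simp: abs_mult mangoldt_le_ln intro!: mult_right_mono exI[of _ 0])

definition mangoldt_series :: "complex \<Rightarrow> complex" where
  "mangoldt_series s = (\<Sum>n. mangoldt n * of_nat n powr (-s))"

lemma norm_mangoldt_term: "norm (mangoldt n * of_nat n powr (-s) :: complex) = mangoldt n * real n powr (- Re s)"
  by (simp add: norm_mult norm_nat_powr)

lemma mangoldt_series_sums:
  assumes "Re s > 1"
  shows "(\<lambda>n. mangoldt n * of_nat n powr (-s)) sums mangoldt_series s"
  unfolding mangoldt_series_def
  by (rule summable_sums, rule summable_norm_cancel)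
     (simp only: norm_mangoldt_term summable_mangoldt_powr[OF assms])

lemma mangoldt_series_holomorphic: "mangoldt_series holomorphic_on {s. Re s > 1}"
proof -
  have "(\<lambda>s. \<Sum>n. mangoldt n * of_nat n powr (-s)) holomorphic_on {s. Re s > 1}"
  proof (rule holomorphic_suminf)
    show "open {s. Re s > 1}" by (rule open_halfspace_Re_gt)
    show "(\<lambda>s. mangoldt n * of_nat n powr (-s)) holomorphic_on {s. Re s > 1}" for n
      by (cases "n = 0") (auto intro!: holomorphic_intros)
    fix x assume "x \<in> {s. Re s > 1}"
    then obtain d e where *: "d > 0" "e > 0" "cball x d \<subseteq> {s. Re s > 1}" "\<And>y. y \<in> cball x d \<Longrightarrow> Re y \<ge> 1 + e"
      using cball_half_plane[of 1 x] by auto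
    have "norm (mangoldt n * of_nat n powr (-y) :: complex) \<le> 2 / e * real n powr (-(1 + e / 2))"
      if "y \<in> cball x d" for y n
      unfolding norm_mangoldt_term
      using ln_times_powr_le[OF *(2) *(4)[OF that]] mult_right_mono[OF mangoldt_le_ln, of "real n powr - Re y" n]
      by (smt (verit) powr_ge_zero)
    moreover have "summable (\<lambda>n. 2 / e * real n powr (-(1 + e / 2)))"
      using * by (intro summable_mult) (simp add: summable_real_powr_iff)
    ultimately show "\<exists>d M. d > 0 \<and> cball x d \<subseteq> {s. Re s > 1} \<and> summable M \<and>
        (\<forall>n. \<forall>y\<in>cball x d. norm (mangoldt n * of_nat n powr (-y) :: complex) \<le> M n)"
      using * by blast
  qed
  thus ?thesis by (simp add: mangoldt_series_def[abs_def])
qed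

lemma zeta_sums:
  assumes "Re s > 1"
  shows "(\<lambda>n. of_nat n powr (-s)) sums zeta s"
proof -
  have "(\<lambda>n. of_nat (Suc n) powr (-s)) sums zeta s"
    using zeta_series_sums[OF assms] zeta_eq_series[OF assms] by simp
  from sums_Suc[OF this] show ?thesis by simp
qed

lemma deriv_zeta_sums:
  assumes s: "Re s > 1"
  shows "(\<lambda>n. - of_real (ln (real n)) * of_nat n powr (-s)) sums deriv zeta s"
proof -
  let ?S = "{s. Re s > 1}"
  have "\<exists>g g'. \<forall>x \<in> ?S. ((\<lambda>n. of_nat n powr (-x)) sums g x) \<and>
      ((\<lambda>n. - of_real (ln (real n)) * of_nat n powr (-x)) sums g' x) \<and> (g has_field_derivative g' x) (at x)"
  proof (rule series_and_derivative_comparison_complex)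
    show "open ?S" by (rule open_halfspace_Re_gt)
    show "((\<lambda>x. of_nat n powr (-x)) has_field_derivative - of_real (ln (real n)) * of_nat n powr (-x)) (at x)"
      for n :: nat and x :: complex
    proof (cases "n = 0")
      case False
      have "Ln (of_nat n) = complex_of_real (ln (real n))"
        using Ln_of_real[of "real n"] False by simp
      thus ?thesis using False by (auto simp: powr_def intro!: derivative_eq_intros)
    qed auto
    fix x assume "x \<in> ?S"
    then obtain d e where *: "d > 0" "e > 0" "cball x d \<subseteq> {s. Re s > 1}" "\<And>y. y \<in> cball x d \<Longrightarrow> Re y \<ge> 1 + e"
      using cball_half_plane[of 1 x] by auto
    let ?h = "\<lambda>n. complex_of_real (real n powr (-(1 + e)))"
    have "summable ?h" using * by (intro summable_of_real) (simp add: summable_real_powr_iff)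
    moreover have "range ?h \<subseteq> \<real>\<^sub>\<ge>\<^sub>0" by auto
    moreover have "norm (of_nat n powr (-y) :: complex) \<le> norm (?h n)" if "y \<in> ball x d" for n y
    proof (cases "n = 0")
      case False
      thus ?thesis using *(4)[of y] that by (auto simp: norm_nat_powr intro!: powr_mono)
    qed auto
    ultimately show "\<exists>d h. 0 < d \<and> summable h \<and> range h \<subseteq> \<real>\<^sub>\<ge>\<^sub>0 \<and>
       (\<forall>\<^sub>F n in sequentially. \<forall>y\<in>ball x d \<inter> ?S. cmod (of_nat n powr (-y)) \<le> cmod (h n))"
      using *(1) by (intro exI[of _ d] exI[of _ ?h]) auto
  qed
  then obtain g g' where g: "\<And>x. x \<in> ?S \<Longrightarrow> (\<lambda>n. of_nat n powr (-x)) sums g x"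
    "\<And>x. x \<in> ?S \<Longrightarrow> (\<lambda>n. - of_real (ln (real n)) * of_nat n powr (-x)) sums g' x"
    "\<And>x. x \<in> ?S \<Longrightarrow> (g has_field_derivative g' x) (at x)" by blast
  have eq: "g x = zeta x" if "x \<in> ?S" for x
    using sums_unique2[OF g(1)[OF that] zeta_sums[of x]] that by simp
  have "(zeta has_field_derivative g' s) (at s)"
    by (rule has_field_derivative_transform_within_open[OF g(3) open_halfspace_Re_gt[of 1]])
       (use s eq in auto)
  thus ?thesis using g(2)[of s] s by (simp add: DERIV_imp_deriv)
qed

text \<open>Dirichlet convolution of \<open>\<Lambda>\<close> with 1 is \<open>ln\<close>.\<close>

lemma deriv_zeta_eq:
  assumes s: "Re s > 1"
  shows "deriv zeta s = - mangoldt_series s * zeta s"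
proof -
  let ?a = "\<lambda>n. mangoldt n * of_nat n powr (-s) :: complex"
  let ?b = "\<lambda>n::nat. of_nat n powr (-s) :: complex"
  have sa: "summable (\<lambda>n. norm (?a n))"
    by (simp only: norm_mangoldt_term summable_mangoldt_powr[OF s])
  have sb: "summable (\<lambda>n. norm (?b n))"
    using s by (simp add: norm_nat_powr summable_real_powr_iff)
  have a: "(?a has_sum mangoldt_series s) UNIV"
    by (rule norm_summable_imp_has_sum[OF sa mangoldt_series_sums[OF s]])
  have b: "(?b has_sum zeta s) UNIV"
    by (rule norm_summable_imp_has_sum[OF sb zeta_sums[OF s]])
  have asum: "(\<lambda>x. norm (?a x)) summable_on UNIV" "(\<lambda>x. norm (?b x)) summable_on UNIV"
    using sa sb by (auto intro: norm_summable_imp_summable_on)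
  have "(\<lambda>x. norm (case x of (k, n) \<Rightarrow> ?a k * ?b n)) summable_on UNIV \<times> UNIV"
  proof (rule summable_on_SigmaI)
    show "((\<lambda>n. norm (case (k, n) of (k, n) \<Rightarrow> ?a k * ?b n)) has_sum
        norm (?a k) * (\<Sum>\<^sub>\<infinity>n. norm (?b n))) UNIV" for k
      using has_sum_cmult_right[OF has_sum_infsum[OF asum(2)], of "norm (?a k)"] by (simp add: norm_mult)
    show "(\<lambda>k. norm (?a k) * (\<Sum>\<^sub>\<infinity>n. norm (?b n))) summable_on UNIV"
      by (rule summable_on_cmult_left[OF asum(1)])
  qed auto
  hence sm: "(\<lambda>(k, n). ?a k * ?b n) summable_on UNIV \<times> UNIV"
    by (rule abs_summable_summable)
  have "((\<lambda>(k, n). ?a k * ?b n) has_sum mangoldt_series s * zeta s) (UNIV \<times> UNIV)"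
  proof (rule has_sum_SigmaI[OF _ _ sm])
    show "((\<lambda>y. case (x, y) of (k, n) \<Rightarrow> ?a k * ?b n) has_sum ?a x * zeta s) UNIV" for x
      using has_sum_cmult_right[OF b, of "?a x"] by simp
    show "((\<lambda>x. ?a x * zeta s) has_sum mangoldt_series s * zeta s) UNIV"
      by (rule has_sum_cmult_left[OF a])
  qed
  \<comment> \<open>Indices 0 contribute nothing, as \<open>0 powr z = 0\<close>. Removing them
    makes the map to \<open>(k * n, k)\<close> a bijection onto pairs of a positive integer and one
    of its divisors.\<close>
  also have "?this \<longleftrightarrow> ((\<lambda>(k, n). ?a k * ?b n) has_sum mangoldt_series s * zeta s) ({0<..} \<times> {0<..})"
    by (rule has_sum_cong_neutral) auto
  also have "\<dots> \<longleftrightarrow> ((\<lambda>(j, k). ?a k * ?b (j div k)) has_sum mangoldt_series s * zeta s) (Sigma {0<..} (\<lambda>j. {k. k dvd j}))"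
    by (rule has_sum_reindex_bij_witness[of _ "\<lambda>(j, k). (k, j div k)" "\<lambda>(k, n). (k * n, k)"])
       (auto elim!: dvdE)
  finally have "((\<lambda>j. \<Sum>k | k dvd j. ?a k * ?b (j div k)) has_sum mangoldt_series s * zeta s) {0<..}"
    by (rule has_sum_SigmaD) (auto intro!: has_sum_finiteI)
  also have "?this \<longleftrightarrow> ((\<lambda>j. of_real (ln (real j)) * of_nat j powr (-s)) has_sum mangoldt_series s * zeta s) {0<..}"
  proof (rule has_sum_cong)
    fix j :: nat assume j: "j \<in> {0<..}"
    have jk: "?a k * ?b (j div k) = mangoldt k * of_nat j powr (-s)" if "k dvd j" for k
    proof -
      from that obtain n where n: "j = k * n" by blast
      hence "k > 0" using j by auto
      have "(of_nat k * of_nat n :: complex) powr (-s) = of_nat k powr (-s) * of_nat n powr (-s)"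
        using powr_times_real[of "of_nat k" "of_nat n"] by simp
      thus ?thesis using n \<open>k > 0\<close> by simp
    qed
    have "(\<Sum>k | k dvd j. ?a k * ?b (j div k)) = (\<Sum>k | k dvd j. mangoldt k) * of_nat j powr (-s)"
      unfolding sum_distrib_right by (intro sum.cong refl jk) simp
    also have "(\<Sum>k | k dvd j. mangoldt k) = complex_of_real (ln (real j))"
      using j by (intro mangoldt_sum) auto
    finally show "(\<Sum>k | k dvd j. ?a k * ?b (j div k)) = of_real (ln (real j)) * of_nat j powr (-s)" .
  qed
  also have "\<dots> \<longleftrightarrow> ((\<lambda>j. of_real (ln (real j)) * of_nat j powr (-s)) has_sum mangoldt_series s * zeta s) UNIV"
    by (rule has_sum_cong_neutral) auto
  finally have "(\<lambda>j. of_real (ln (real j)) * of_nat j powr (-s)) sums (mangoldt_series s * zeta s)"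
    by (rule has_sum_imp_sums)
  from sums_minus[OF this]
  have "(\<lambda>j. - of_real (ln (real j)) * of_nat j powr (-s)) sums (- (mangoldt_series s * zeta s))"
    by simp
  from sums_unique2[OF deriv_zeta_sums[OF s] this] show ?thesis by simp
qed

text \<open>With a primitive \<open>P\<close> of \<open>mangoldt_series\<close>, the product
  \<open>zeta * exp P\<close> has derivative 0 in the half-plane and is a constant. If the constant
  were 0, \<open>zeta\<close> would vanish there and hence everywhere.\<close>

lemma zeta_nonzero:
  assumes s: "Re s > 1"
  shows "zeta s \<noteq> 0"
proof -
  let ?S = "{s. Re s > 1}"
  have cv: "convex ?S" by (rule convex_halfspace_Re_gt)
  obtain P where P: "\<And>x. x \<in> ?S \<Longrightarrow> (P has_field_derivative mangoldt_series x) (at x within ?S)"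
    using holomorphic_convex_primitive'[OF cv open_halfspace_Re_gt mangoldt_series_holomorphic] by blast
  have "((\<lambda>x. zeta x * exp (P x)) has_field_derivative 0) (at x within ?S)" if x: "x \<in> ?S" for x
  proof -
    have "(zeta has_field_derivative deriv zeta x) (at x within ?S)"
      using x by (intro DERIV_subset[OF holomorphic_derivI[OF zeta_holomorphic]]) auto
    hence "(zeta has_field_derivative - mangoldt_series x * zeta x) (at x within ?S)"
      using deriv_zeta_eq x by simp
    from DERIV_mult[OF this DERIV_chain'[OF P[OF x] DERIV_exp]] show ?thesis
      by (simp add: algebra_simps)
  qed
  hence "\<exists>c. \<forall>x\<in>?S. zeta x * exp (P x) = c"
    by (rule has_field_derivative_zero_constant[OF cv])
  then obtain c where c: "\<And>x. x \<in> ?S \<Longrightarrow> zeta x * exp (P x) = c" by blast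
  have "c \<noteq> 0"
  proof
    assume "c = 0"
    hence z0: "zeta x = 0" if "x \<in> ?S" for x using c[OF that] by simp
    have "zeta x = 0" if "x \<in> - {1}" for x
    proof (rule analytic_continuation_open[where s = ?S and s' = "- {1}" and f = zeta and g = "\<lambda>_. 0"])
      show "?S \<noteq> {}" by (auto intro: exI[of _ 2])
      show "connected (- {1::complex})" by (intro connected_punctured_universe) simp
    qed (use that z0 zeta_holomorphic in \<open>auto simp: open_halfspace_Re_gt\<close>)
    thus False using zeta_not_constant by (auto simp: constant_on_def)
  qed
  thus ?thesis using c[of s] s by auto
qed

lemma logderiv_zeta:
  assumes "Re s > 1"
  shows "deriv zeta s / zeta s = - mangoldt_series s"
  using deriv_zeta_eq[OF assms] zeta_nonzero[OF assms] by simp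

text \<open>The terms with \<open>n \<ge> 3\<close> are dominated by the telescoping sum of
  \<open>1 / (n * (n - 1))\<close>, which is \<open>1 / 2\<close>, and the second term has modulus
  \<open>1 / 4\<close>; this leaves \<open>1 - 1 / 4 - 1 / 2\<close>. It makes
  \<open>2 + i T\<close> a suitable centre for the local estimates.\<close>

lemma zeta_lower_bound:
  assumes "Re s = 2"
  shows "norm (zeta s) \<ge> 1 / 4"
proof -
  let ?f = "\<lambda>n. of_nat n powr (-s) :: complex"
  have f: "?f sums zeta s" using assms by (intro zeta_sums) simp
  have "(\<lambda>n. ?f (n + 3)) sums (zeta s - (\<Sum>n<3. ?f n))" by (rule sums_split_initial_segment[OF f])
  also have "(\<Sum>n<3. ?f n) = 1 + 2 powr (-s)" by (simp add: eval_nat_numeral)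
  finally have g: "(\<lambda>n. ?f (n + 3)) sums (zeta s - (1 + 2 powr (-s)))" .
  have "(\<lambda>n. 1 / real (n + 2)) \<longlonglongrightarrow> 0" using LIMSEQ_ignore_initial_segment[OF lim_1_over_n, of 2] by simp
  from telescope_sums'[OF this] have t: "(\<lambda>n. 1 / real (n + 2) - 1 / real (n + 3)) sums (1 / 2)"
    by (simp add: add.commute)
  have bd: "norm (?f (n + 3)) \<le> 1 / real (n + 2) - 1 / real (n + 3)" for n
  proof -
    have "norm (?f (n + 3)) = 1 / (real (n + 3))\<^sup>2"
      unfolding norm_nat_powr using assms by (simp add: powr_minus_divide del: of_nat_add)
    also have "\<dots> \<le> 1 / (real (n + 2) * real (n + 3))"
      by (intro divide_left_mono) (auto simp: power2_eq_square intro!: mult_right_mono)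
    also have "\<dots> = 1 / real (n + 2) - 1 / real (n + 3)" by (simp add: field_simps)
    finally show ?thesis .
  qed
  have "norm (zeta s - (1 + 2 powr (-s))) \<le> 1 / 2"
    using norm_suminf_le[OF bd sums_summable[OF t]] sums_unique[OF g] sums_unique[OF t] by simp
  moreover have "norm (2 powr (-s) :: complex) = 1 / 4"
    using norm_nat_powr[of 2 "-s"] assms by (simp add: powr_minus_divide)
  moreover have "norm (1 :: complex) \<le> norm (zeta s) + norm (2 powr (-s) :: complex) + norm (zeta s - (1 + 2 powr (-s)))"
    using norm_triangle_ineq4[of "zeta s - 2 powr (-s)" "zeta s - (1 + 2 powr (-s))"]
      norm_triangle_ineq4[of "zeta s" "2 powr (-s)"] by simp
  ultimately show ?thesis by simp
qed

text \<open>For real arguments the series is \<open>1 / (\<sigma> - 1)\<close> minus the logarithmic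
  derivative of \<open>zeta_reg\<close>. The latter is bounded on the compact segment from 1 to 2,
  where \<open>zeta_reg\<close> has no zero.\<close>

lemma mangoldt_sum_bound:
  "\<exists>C>0. \<forall>\<sigma>. 1 < \<sigma> \<longrightarrow> \<sigma> \<le> 2 \<longrightarrow> (\<Sum>n. mangoldt n * real n powr (-\<sigma>)) \<le> C / (\<sigma> - 1)"
proof -
  let ?S = "of_real ` {1..2::real} :: complex set"
  have nz: "zeta_reg z \<noteq> 0" if "z \<in> ?S" for z
    using that zeta_nonzero[of z] by (auto simp: zeta_reg_def)
  have "continuous_on ?S (\<lambda>z. deriv zeta_reg z / zeta_reg z)"
    using nz by (intro continuous_intros holomorphic_on_imp_continuous_on zeta_reg_holomorphic
      holomorphic_on_subset[OF holomorphic_deriv[OF zeta_reg_holomorphic[of UNIV] open_UNIV]]) auto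
  moreover have "compact ?S" by (intro compact_continuous_image continuous_intros) auto
  ultimately have "bounded ((\<lambda>z. deriv zeta_reg z / zeta_reg z) ` ?S)"
    by (rule compact_imp_bounded[OF compact_continuous_image])
  then obtain K where K: "K > 0" "\<And>z. z \<in> ?S \<Longrightarrow> norm (deriv zeta_reg z / zeta_reg z) \<le> K"
    unfolding bounded_pos by blast
  have "(\<Sum>n. mangoldt n * real n powr (-\<sigma>)) \<le> (1 + K) / (\<sigma> - 1)" if \<sigma>: "1 < \<sigma>" "\<sigma> \<le> 2" for \<sigma> :: real
  proof -
    let ?s = "of_real \<sigma> :: complex"
    have s1: "?s \<noteq> 1" using \<sigma> by (auto simp: complex_eq_iff)
    have "(zeta_reg has_field_derivative zeta ?s + deriv zeta ?s * (?s - 1)) (at ?s)"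
    proof (rule has_field_derivative_transform_within_open[where S = "- {1}"])
      show "((\<lambda>s. (s - 1) * zeta s) has_field_derivative zeta ?s + deriv zeta ?s * (?s - 1)) (at ?s)"
        using s1 by (auto intro!: derivative_eq_intros holomorphic_derivI[OF zeta_holomorphic])
    qed (use s1 in \<open>auto simp: zeta_reg_def\<close>)
    hence "deriv zeta_reg ?s = zeta ?s + deriv zeta ?s * (?s - 1)" by (rule DERIV_imp_deriv)
    hence eq: "deriv zeta_reg ?s / zeta_reg ?s = 1 / (?s - 1) - mangoldt_series ?s"
      using logderiv_zeta[of ?s] zeta_nonzero[of ?s] s1 \<sigma> by (simp add: zeta_reg_def divide_simps) (auto simp: algebra_simps)
    have "(\<lambda>n. complex_of_real (mangoldt n * real n powr (-\<sigma>))) sums mangoldt_series ?s"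
    proof -
      have tm: "complex_of_real (mangoldt n * real n powr (-\<sigma>)) = mangoldt n * of_nat n powr (- ?s)" for n
        using powr_of_real[of "real n" "-\<sigma>"] by simp
      show ?thesis unfolding tm using mangoldt_series_sums[of ?s] \<sigma> by simp
    qed
    hence "mangoldt_series ?s = of_real (\<Sum>n. mangoldt n * real n powr (-\<sigma>))"
      using sums_of_real[OF summable_sums[OF summable_mangoldt_powr[OF \<sigma>(1)]], where 'a = complex] sums_unique2 by blast
    hence "(\<Sum>n. mangoldt n * real n powr (-\<sigma>)) \<le> norm (mangoldt_series ?s)" by simp
    also have "mangoldt_series ?s = 1 / (?s - 1) - deriv zeta_reg ?s / zeta_reg ?s" using eq by simp
    also have "norm \<dots> \<le> norm (1 / (?s - 1)) + norm (deriv zeta_reg ?s / zeta_reg ?s)" by (rule norm_triangle_ineq4)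
    also have "norm (1 / (?s - 1)) = 1 / (\<sigma> - 1)"
    proof -
      have "1 / (?s - 1) = of_real (1 / (\<sigma> - 1))" by simp
      thus ?thesis using \<sigma> by (simp only: norm_of_real) simp
    qed
    also have "norm (deriv zeta_reg ?s / zeta_reg ?s) \<le> K" by (rule K(2)) (use \<sigma> in auto)
    also have "K \<le> K / (\<sigma> - 1)" using K(1) \<sigma> by (simp add: field_simps)
    finally show ?thesis by (simp add: add_divide_distrib)
  qed
  thus ?thesis using K(1) by (intro exI[of _ "1 + K"]) auto
qed

section \<open>The functional equation\<close>

text \<open>The reflection formula says that \<open>Gamma w * Gamma (1 - w) * sin (pi * w)\<close>
  is constant. Its vanishing derivative expresses the cotangent as a difference of two values of
  \<open>Digamma\<close>, whose series are known; a telescoping shift by one index then pairs the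
  poles at \<open>k\<close> and \<open>-k\<close>.\<close>

lemma cot_partial_fractions:
  fixes z :: complex
  assumes z: "z \<notin> \<int>"
  shows "(\<lambda>k. 2 * z / (z\<^sup>2 - of_nat (Suc k) ^ 2)) sums (of_real pi * cot (of_real pi * z) - 1 / z)"
proof -
  have z': "1 - z \<notin> \<int>" using z by (metis Ints_1 Ints_diff diff_diff_eq2 add_diff_cancel_left')
  have np: "z \<notin> \<int>\<^sub>\<le>\<^sub>0" "1 - z \<notin> \<int>\<^sub>\<le>\<^sub>0" using z z' nonpos_Ints_subset_Ints by auto
  have z0: "z \<noteq> 0" "1 - z \<noteq> 0" using z by auto
  let ?p = "of_real pi :: complex"
  have snz: "sin (?p * z) \<noteq> 0"
  proof
    assume "sin (?p * z) = 0"
    then obtain n :: int where "?p * z = of_int n * ?p" unfolding sin_eq_0 by (auto simp: of_real_mult)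
    hence "z = of_int n" by simp
    thus False using z by auto
  qed
  have "((\<lambda>w. Gamma w * Gamma (1 - w) * sin (?p * w)) has_field_derivative
      Gamma z * Gamma (1 - z) * (sin (?p * z) * (Digamma z - Digamma (1 - z)) + ?p * cos (?p * z))) (at z)"
    using np by (auto intro!: derivative_eq_intros simp: algebra_simps)
  moreover have "((\<lambda>w. Gamma w * Gamma (1 - w) * sin (?p * w)) has_field_derivative 0) (at z)"
  proof (rule has_field_derivative_transform_within_open[where S = "-\<int>" and f = "\<lambda>_. ?p"])
    show "?p = Gamma w * Gamma (1 - w) * sin (?p * w)" if "w \<in> -\<int>" for w :: complex
    proof -
      have "sin (?p * w) \<noteq> 0"
      proof
        assume "sin (?p * w) = 0"
        then obtain n :: int where "?p * w = of_int n * ?p" unfolding sin_eq_0 by (auto simp: of_real_mult)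
        hence "w = of_int n" by simp
        thus False using that by auto
      qed
      thus ?thesis by (simp add: Gamma_reflection_complex)
    qed
  qed (use z in auto)
  ultimately have "Gamma z * Gamma (1 - z) * (sin (?p * z) * (Digamma z - Digamma (1 - z)) + ?p * cos (?p * z)) = 0"
    by (rule DERIV_unique)
  hence "sin (?p * z) * (Digamma z - Digamma (1 - z)) + ?p * cos (?p * z) = 0"
    using np by (simp add: Gamma_eq_zero_iff)
  hence cot: "Digamma (1 - z) - Digamma z = ?p * cot (?p * z)"
    using snz by (simp add: cot_def field_simps)
  have "(\<lambda>k. (inverse (of_nat (Suc k)) - inverse (1 - z + of_nat k)) - (inverse (of_nat (Suc k)) - inverse (z + of_nat k)))
     sums ((\<Sum>k. inverse (of_nat (Suc k)) - inverse (1 - z + of_nat k)) - (\<Sum>k. inverse (of_nat (Suc k)) - inverse (z + of_nat k)))"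
    by (intro sums_diff summable_sums summable_Digamma z0)
  hence 1: "(\<lambda>k. inverse (z + of_nat k) - inverse (1 - z + of_nat k)) sums (?p * cot (?p * z))"
    unfolding cot[symmetric] by (simp add: Digamma_def)
  have "(\<lambda>k. inverse (z + of_nat k)) \<longlonglongrightarrow> 0"
    by (intro tendsto_inverse_0[THEN filterlim_compose] tendsto_add_filterlim_at_infinity[OF tendsto_const] tendsto_of_nat)
  from telescope_sums'[OF this] have 2: "(\<lambda>k. inverse (z + of_nat k) - inverse (z + of_nat (Suc k))) sums (1 / z)"
    by (simp add: inverse_eq_divide)
  have eq: "(inverse (z + of_nat k) - inverse (1 - z + of_nat k)) - (inverse (z + of_nat k) - inverse (z + of_nat (Suc k)))
      = 2 * z / (z\<^sup>2 - of_nat (Suc k) ^ 2)" for k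
  proof -
    have a: "z + of_nat (Suc k) \<noteq> 0"
    proof
      assume "z + of_nat (Suc k) = 0"
      hence "z = - of_nat (Suc k)" by (metis add_eq_0_iff2)
      thus False using z by (metis Ints_minus Ints_of_nat)
    qed
    have b: "z - of_nat (Suc k) \<noteq> 0" using z by auto
    have c: "1 - z + of_nat k = - (z - of_nat (Suc k))" by simp
    have "(inverse (z + of_nat k) - inverse (1 - z + of_nat k)) - (inverse (z + of_nat k) - inverse (z + of_nat (Suc k)))
       = inverse (z - of_nat (Suc k)) + inverse (z + of_nat (Suc k))"
      unfolding c inverse_minus_eq by simp
    also have "\<dots> = (1 * (z + of_nat (Suc k)) + 1 * (z - of_nat (Suc k))) / ((z - of_nat (Suc k)) * (z + of_nat (Suc k)))"
      using a b by (simp only: inverse_eq_divide add_frac_eq not_False_eq_True)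
    also have "1 * (z + of_nat (Suc k)) + 1 * (z - of_nat (Suc k)) = 2 * z" by simp
    also have "(z - of_nat (Suc k)) * (z + of_nat (Suc k)) = z\<^sup>2 - of_nat (Suc k) ^ 2"
      by (simp add: power2_eq_square algebra_simps)
    finally show ?thesis .
  qed
  show ?thesis using sums_diff[OF 1 2] unfolding eq .
qed

text \<open>The cotangent expansion at the imaginary point \<open>i * x / (2 * pi)\<close>. The
  terms \<open>1 / (exp x - 1) + 1 / 2\<close> on the right add up to half the hyperbolic cotangent
  of \<open>x / 2\<close>.\<close>

lemma coth_partial_fractions:
  fixes x :: real
  assumes x: "x > 0"
  shows "(\<lambda>k. 2 * x / (x\<^sup>2 + (2 * pi * real (Suc k))\<^sup>2)) sums (1 / (exp x - 1) - 1 / x + 1 / 2)"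
proof -
  define z where "z = \<i> * of_real (x / (2 * pi))"
  have "Im z \<noteq> 0" using x by (simp add: z_def)
  hence "z \<notin> \<int>" by (auto elim!: Ints_cases)
  from sums_mult[OF cot_partial_fractions[OF this], of "\<i> / of_real (2 * pi)"]
  have 1: "(\<lambda>k. \<i> / of_real (2 * pi) * (2 * z / (z\<^sup>2 - of_nat (Suc k) ^ 2))) sums
     (\<i> / of_real (2 * pi) * (of_real pi * cot (of_real pi * z) - 1 / z))" .
  have t: "\<i> / of_real (2 * pi) * (2 * z / (z\<^sup>2 - of_nat (Suc k) ^ 2)) = of_real (2 * x / (x\<^sup>2 + (2 * pi * real (Suc k))\<^sup>2))" for k
  proof -
    define D where "D = (x / (2 * pi))\<^sup>2 + (real (Suc k))\<^sup>2"
    have zD: "z\<^sup>2 - of_nat (Suc k) ^ 2 = - of_real D"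
      by (simp add: z_def D_def power_mult_distrib power_divide del: of_nat_Suc)
    have "\<i> / of_real (2 * pi) * (2 * z / (- of_real D)) = of_real ((1 / (2 * pi)) * (2 * (x / (2 * pi)) / D))"
      by (simp add: z_def)
    hence "\<i> / of_real (2 * pi) * (2 * z / (z\<^sup>2 - of_nat (Suc k) ^ 2)) =
        of_real ((1 / (2 * pi)) * (2 * (x / (2 * pi)) / ((x / (2 * pi))\<^sup>2 + (real (Suc k))\<^sup>2)))"
      unfolding zD D_def .
    also have "(1 / (2 * pi)) * (2 * (x / (2 * pi)) / ((x / (2 * pi))\<^sup>2 + (real (Suc k))\<^sup>2)) =
        2 * x / (x\<^sup>2 + (2 * pi * real (Suc k))\<^sup>2)"
    proof -
      have "x\<^sup>2 + (2 * pi * real (Suc k))\<^sup>2 = (2 * pi)\<^sup>2 * ((x / (2 * pi))\<^sup>2 + (real (Suc k))\<^sup>2)"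
        by (simp only: distrib_left power_mult_distrib[symmetric]) simp
      thus ?thesis by (simp add: power2_eq_square)
    qed
    finally show ?thesis .
  qed
  have r: "\<i> / of_real (2 * pi) * (of_real pi * cot (of_real pi * z) - 1 / z) = of_real (1 / (exp x - 1) - 1 / x + 1 / 2)"
  proof -
    define E where "E = exp (x / 2)"
    have E: "E > 0" "E * E = exp x" by (simp_all add: E_def flip: exp_add)
    have E1: "E * E > 1" using E(2) x by simp
    have pz: "of_real pi * z = \<i> * of_real (x / 2)" by (simp add: z_def)
    have ex: "exp (\<i> * (\<i> * of_real (x / 2))) = of_real (1 / E)"
    proof -
      have "\<i> * (\<i> * of_real (x / 2)) = complex_of_real (- (x / 2))" by simp
      thus ?thesis by (simp only: exp_of_real E_def exp_minus inverse_eq_divide)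
    qed
    have ex': "exp (- (\<i> * (\<i> * of_real (x / 2)))) = of_real E"
      using ex E by (simp add: exp_minus inverse_eq_divide)
    have "cos (of_real pi * z) = of_real ((E + 1 / E) / 2)" "sin (of_real pi * z) = - \<i> * of_real ((1 / E - E) / 2)"
      unfolding cos_exp_eq sin_exp_eq pz ex ex' by (simp_all add: field_simps)
    moreover have "1 / E - E \<noteq> 0" using E E1 by (auto simp: field_simps)
    ultimately have "\<i> * cot (of_real pi * z) = of_real ((E + 1 / E) / (E - 1 / E))"
      by (simp add: cot_def field_simps flip: of_real_mult of_real_add of_real_diff of_real_divide)
         (simp add: algebra_simps)?
    also have "(E + 1 / E) / (E - 1 / E) = (exp x + 1) / (exp x - 1)"
    proof -
      have "E + 1 / E = (exp x + 1) / E" "E - 1 / E = (exp x - 1) / E" using E by (simp_all add: field_simps)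
      thus ?thesis using E by simp
    qed
    finally have c: "\<i> * cot (of_real pi * z) = of_real ((exp x + 1) / (exp x - 1))" .
    have "\<i> / of_real (2 * pi) * (of_real pi * cot (of_real pi * z) - 1 / z) =
        (\<i> * cot (of_real pi * z)) / 2 - \<i> / (of_real (2 * pi) * z)"
      by (simp add: field_simps)
    also have "\<i> / (of_real (2 * pi) * z) = of_real (1 / x)" using x by (simp add: z_def)
    also have "(\<i> * cot (of_real pi * z)) / 2 - of_real (1 / x) = complex_of_real ((exp x + 1) / (exp x - 1) / 2 - 1 / x)"
      unfolding c by simp
    also have "(exp x + 1) / (exp x - 1) / 2 - 1 / x = 1 / (exp x - 1) - 1 / x + 1 / 2"
      using x by (simp add: field_simps)
    finally show ?thesis .
  qed
  show ?thesis using 1 unfolding t r sums_of_real_iff .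
qed

text \<open>The quotient is the integral of \<open>u powr (-\<alpha>)\<close> from \<open>n\<close>
  to \<open>Suc n\<close>, so the series measures by how much the integral exceeds the sum. Inside
  the strip this excess has the value \<open>- zeta \<alpha>\<close>, which follows from the
  recurrence with \<open>K = 0\<close>.\<close>

lemma zeta_real_sums:
  fixes \<alpha> :: real
  assumes \<alpha>: "0 < \<alpha>" "\<alpha> < 1"
  shows "(\<lambda>n. (real (Suc n) powr (1 - \<alpha>) - real n powr (1 - \<alpha>)) / (1 - \<alpha>) - real (Suc n) powr (-\<alpha>)) sums (- Re (zeta (of_real \<alpha>)))"
    "zeta (of_real \<alpha>) = of_real (Re (zeta (of_real \<alpha>)))"
proof -
  define q where "q = (\<lambda>n. real (Suc (Suc n)) powr (1 - \<alpha>) - real (Suc n) powr (1 - \<alpha>) - (1 - \<alpha>) * real (Suc n) powr (-\<alpha>))"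
  have a1: "complex_of_real \<alpha> \<noteq> 1" using \<alpha> by (auto simp: complex_eq_iff)
  have pr: "of_nat n powr (complex_of_real y) = of_real (real n powr y)" for n y
    using powr_of_real[of "real n" y] by simp
  have rem: "zeta_rem (Suc 0) n (of_real \<alpha>) = of_real (q n)" for n
  proof -
    have "zeta_rem (Suc 0) n (of_real \<alpha>) = of_nat (Suc (Suc n)) powr (1 - of_real \<alpha>) -
        (of_nat (Suc n) powr (1 - of_real \<alpha>) + (1 - of_real \<alpha>) * of_nat (Suc n) powr (1 - of_real \<alpha> - 1))"
      by (simp add: zeta_rem_def of_nat_1[unfolded One_nat_def] del: of_nat_Suc)
    also have "1 - complex_of_real \<alpha> = of_real (1 - \<alpha>)" by simp
    also have "complex_of_real (1 - \<alpha>) - 1 = of_real (- \<alpha>)" by simp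
    finally show ?thesis by (simp only: pr q_def flip: of_real_mult of_real_add of_real_diff) simp
  qed
  have "summable (\<lambda>n. zeta_rem (Suc 0) n (of_real \<alpha>))"
  proof (rule summable_comparison_test)
    let ?c = "norm (falling (Suc (Suc 0)) (of_real \<alpha>)) / fact (Suc 0)"
    show "summable (\<lambda>n. ?c * real (Suc n) powr (- \<alpha> - 1))"
      using \<alpha> by (intro summable_mult summable_Suc_powr) auto
    show "\<exists>N. \<forall>n\<ge>N. norm (zeta_rem (Suc 0) n (of_real \<alpha>)) \<le> ?c * real (Suc n) powr (- \<alpha> - 1)"
      using norm_zeta_rem[of "Suc 0" "of_real \<alpha>"] \<alpha> by auto
  qed
  hence "(\<lambda>n. complex_of_real (q n)) sums (\<Sum>n. zeta_rem (Suc 0) n (of_real \<alpha>))"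
    unfolding rem by (rule summable_sums)
  also have "(\<Sum>n. zeta_rem (Suc 0) n (of_real \<alpha>)) = (of_real \<alpha> - 1) * zeta (of_real \<alpha>) - 1"
    using zeta_reg_recurrence[of 0 "of_real \<alpha>"] \<alpha> a1 by (simp add: zeta_reg_def)
  finally have s1: "(\<lambda>n. complex_of_real (q n)) sums ((of_real \<alpha> - 1) * zeta (of_real \<alpha>) - 1)" .
  hence s2: "q sums ((\<alpha> - 1) * Re (zeta (of_real \<alpha>)) - 1)" and "(\<lambda>n. 0) sums ((\<alpha> - 1) * Im (zeta (of_real \<alpha>)))"
    using sums_Re[OF s1] sums_Im[OF s1] by simp_all
  hence "Im (zeta (of_real \<alpha>)) = 0" using sums_unique2[OF sums_zero] \<alpha> by fastforce
  thus "zeta (of_real \<alpha>) = of_real (Re (zeta (of_real \<alpha>)))" by (simp add: complex_eq_iff)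
  define e where "e = (\<lambda>n. (real (Suc n) powr (1 - \<alpha>) - real n powr (1 - \<alpha>)) / (1 - \<alpha>))"
  have eq: "q n / (1 - \<alpha>) = e (Suc n) - real (Suc n) powr (-\<alpha>)" for n
    using \<alpha> unfolding q_def e_def by (simp add: diff_divide_distrib)
  have d: "(\<lambda>n. e (Suc n) - real (Suc n) powr (-\<alpha>)) sums (((\<alpha> - 1) * Re (zeta (of_real \<alpha>)) - 1) / (1 - \<alpha>))"
    using sums_divide[OF s2, of "1 - \<alpha>"] unfolding eq .
  have p0: "(\<lambda>n. real (Suc n) powr (-\<alpha>)) \<longlonglongrightarrow> 0"
    by (rule LIMSEQ_Suc[OF tendsto_neg_powr[OF _ filterlim_real_sequentially]]) (use \<alpha> in auto)
  have "(\<lambda>n. e (Suc n)) \<longlonglongrightarrow> 0"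
    using tendsto_add[OF summable_LIMSEQ_zero[OF sums_summable[OF d]] p0] by simp
  hence "e \<longlonglongrightarrow> 0" by (rule LIMSEQ_imp_Suc)
  \<comment> \<open>The recurrence compares the term of \<open>Suc n\<close> with the integral over
    the unit interval to its right. Telescoping \<open>e\<close> moves to the interval on its left;
    the boundary term \<open>e 0 = 1 / (1 - \<alpha>)\<close> removes the pole term.\<close>
  from sums_add[OF d telescope_sums'[OF this]]
  have "(\<lambda>n. e n - real (Suc n) powr (-\<alpha>)) sums (((\<alpha> - 1) * Re (zeta (of_real \<alpha>)) - 1) / (1 - \<alpha>) + e 0)"
    by simp
  also have "((\<alpha> - 1) * Re (zeta (of_real \<alpha>)) - 1) / (1 - \<alpha>) + e 0 = - Re (zeta (of_real \<alpha>))"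
    using \<alpha> by (simp add: e_def field_simps)
  finally show "(\<lambda>n. (real (Suc n) powr (1 - \<alpha>) - real n powr (1 - \<alpha>)) / (1 - \<alpha>) - real (Suc n) powr (-\<alpha>)) sums (- Re (zeta (of_real \<alpha>)))"
    by (simp add: e_def)
qed

text \<open>For a kernel decreasing in \<open>u\<close> whose Mellin-type integral is a power of \<open>u\<close>, comparing sum and
  integral over \<open>u\<close> under the integral over \<open>x\<close> produces \<open>-\<zeta>(\<alpha>)\<close>; all terms are nonnegative.\<close>

lemma mellin_zeta_tonelli:
  fixes k :: "real \<Rightarrow> real \<Rightarrow> real" and \<kappa> \<alpha> :: real
  assumes \<alpha>: "0 < \<alpha>" "\<alpha> < 1" and \<kappa>: "\<kappa> \<ge> 0"
    and meas [measurable]: "(\<lambda>(u, x). k u x) \<in> borel_measurable (borel \<Otimes>\<^sub>M borel)"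
    and nonneg: "\<And>u x. k u x \<ge> 0"
    and anti: "\<And>u v x. 0 \<le> u \<Longrightarrow> u \<le> v \<Longrightarrow> k v x \<le> k u x"
    and mellin: "\<And>u. u > 0 \<Longrightarrow> (\<integral>\<^sup>+x. ennreal (k u x) \<partial>lborel) = ennreal (\<kappa> * u powr (-\<alpha>))"
    and I: "\<And>n x. ((\<lambda>u. k u x) has_integral I n x) {real n..real (Suc n)}"
    and W: "\<And>x. (\<lambda>n. I n x - k (real (Suc n)) x) sums W x"
  shows "(\<integral>\<^sup>+x. ennreal (W x) \<partial>lborel) = ennreal (\<kappa> * - Re (zeta (of_real \<alpha>)))"
    and "\<kappa> * - Re (zeta (of_real \<alpha>)) \<ge> 0"
proof -
  define d where "d = (\<lambda>n. (real (Suc n) powr (1 - \<alpha>) - real n powr (1 - \<alpha>)) / (1 - \<alpha>) - real (Suc n) powr (-\<alpha>))"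
  let ?J = "\<lambda>n. {real n<..<real (Suc n)}"
  have [measurable]: "(\<lambda>x. k u x) \<in> borel_measurable borel" for u
    using measurable_compose[OF _ meas, of "\<lambda>x. (u, x)" borel] by simp
  have inner: "ennreal (I n x - k (real (Suc n)) x) =
      (\<integral>\<^sup>+u. ennreal (k u x - k (real (Suc n)) x) * indicator (?J n) u \<partial>lborel)" for n x
  proof -
    have "((\<lambda>u. k u x - k (real (Suc n)) x) has_integral (I n x - k (real (Suc n)) x)) {real n..real (Suc n)}"
      using has_integral_diff[OF I has_integral_const_real[of "k (real (Suc n)) x" "real n" "real (Suc n)"]] by simp
    hence "((\<lambda>u. k u x - k (real (Suc n)) x) has_integral (I n x - k (real (Suc n)) x)) (?J n)"
      by (simp only: has_integral_Icc_iff_Ioo)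
    from nn_integral_has_integral_lebesgue'[OF _ this] show ?thesis
      using anti[of _ "real (Suc n)" x] by (simp del: of_nat_Suc)
  qed
  have Inn: "I n x - k (real (Suc n)) x \<ge> 0" for n x
  proof -
    have "((\<lambda>u. k u x - k (real (Suc n)) x) has_integral (I n x - k (real (Suc n)) x)) {real n..real (Suc n)}"
      using has_integral_diff[OF I has_integral_const_real[of "k (real (Suc n)) x" "real n" "real (Suc n)"]] by simp
    thus ?thesis by (rule has_integral_nonneg) (use anti in auto)
  qed
  have dint: "((\<lambda>u. \<kappa> * u powr (-\<alpha>) - \<kappa> * real (Suc n) powr (-\<alpha>)) has_integral \<kappa> * d n) (?J n)" for n
  proof -
    have "((\<lambda>u. u powr (-\<alpha>)) has_integral (real (Suc n) powr (1 - \<alpha>) / (1 - \<alpha>) - real n powr (1 - \<alpha>) / (1 - \<alpha>))) {real n..real (Suc n)}"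
    proof (rule fundamental_theorem_of_calculus_interior)
      show "continuous_on {real n..real (Suc n)} (\<lambda>u. u powr (1 - \<alpha>) / (1 - \<alpha>))"
        using \<alpha> by (intro continuous_on_divide continuous_on_powr' continuous_on_id continuous_on_const) auto
      show "((\<lambda>u. u powr (1 - \<alpha>) / (1 - \<alpha>)) has_vector_derivative x powr (-\<alpha>)) (at x)"
        if "x \<in> ?J n" for x
      proof -
        have "x > 0" using that of_nat_0_le_iff[of n, where ?'a = real] by (simp del: of_nat_0_le_iff)
        thus ?thesis using \<alpha> unfolding has_real_derivative_iff_has_vector_derivative[symmetric]
          by (auto intro!: derivative_eq_intros)
      qed
    qed auto
    from has_integral_mult_right[OF has_integral_diff[OF this has_integral_const_real[of "real (Suc n) powr (-\<alpha>)" "real n" "real (Suc n)"]], of \<kappa>]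
    have "((\<lambda>u. \<kappa> * u powr (-\<alpha>) - \<kappa> * real (Suc n) powr (-\<alpha>)) has_integral \<kappa> * d n) {real n..real (Suc n)}"
      by (simp add: d_def algebra_simps diff_divide_distrib)
    thus ?thesis by (simp only: has_integral_Icc_iff_Ioo)
  qed
  have pm: "\<kappa> * real (Suc n) powr (-\<alpha>) \<le> \<kappa> * u powr (-\<alpha>)" if "u \<in> ?J n" for u n
    using that \<alpha> \<kappa> by (intro mult_left_mono powr_mono2') auto
  have dnn: "\<kappa> * d n \<ge> 0" for n
    by (rule has_integral_nonneg[OF dint]) (use pm in auto)
  have ds: "(\<lambda>n. \<kappa> * d n) sums (\<kappa> * - Re (zeta (of_real \<alpha>)))"
    unfolding d_def by (intro sums_mult zeta_real_sums \<alpha>)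
  show "\<kappa> * - Re (zeta (of_real \<alpha>)) \<ge> 0" by (rule sums_le[OF dnn sums_zero ds])
  have "(\<integral>\<^sup>+x. ennreal (W x) \<partial>lborel) = (\<integral>\<^sup>+x. (\<Sum>n. ennreal (I n x - k (real (Suc n)) x)) \<partial>lborel)"
    using sums_unique[OF W] suminf_ennreal2[OF Inn sums_summable[OF W]] by (intro nn_integral_cong) simp
  also have "\<dots> = (\<Sum>n. \<integral>\<^sup>+x. \<integral>\<^sup>+u. ennreal (k u x - k (real (Suc n)) x) * indicator (?J n) u \<partial>lborel \<partial>lborel)"
    unfolding inner by (rule nn_integral_suminf) measurable
  also have "\<dots> = (\<Sum>n. \<integral>\<^sup>+u. \<integral>\<^sup>+x. ennreal (k u x - k (real (Suc n)) x) * indicator (?J n) u \<partial>lborel \<partial>lborel)"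
    by (intro suminf_cong lborel_pair.Fubini') measurable
  also have "\<dots> = (\<Sum>n. \<integral>\<^sup>+u. ennreal (\<kappa> * u powr (-\<alpha>) - \<kappa> * real (Suc n) powr (-\<alpha>)) * indicator (?J n) u \<partial>lborel)"
  proof (intro suminf_cong nn_integral_cong)
    fix n u
    show "(\<integral>\<^sup>+x. ennreal (k u x - k (real (Suc n)) x) * indicator (?J n) u \<partial>lborel) =
       ennreal (\<kappa> * u powr (-\<alpha>) - \<kappa> * real (Suc n) powr (-\<alpha>)) * indicator (?J n) u"
    proof (cases "u \<in> ?J n")
      case True
      hence u: "u > 0" by (auto intro: le_less_trans[OF of_nat_0_le_iff])
      have "(\<integral>\<^sup>+x. ennreal (k u x - k (real (Suc n)) x) \<partial>lborel) = (\<integral>\<^sup>+x. ennreal (k u x) - ennreal (k (real (Suc n)) x) \<partial>lborel)"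
        by (intro nn_integral_cong) (simp add: ennreal_minus nonneg)
      \<comment> \<open>Subtraction of the integrals is legitimate because \<open>mellin\<close>
        shows that the subtracted one is finite.\<close>
      also have "\<dots> = (\<integral>\<^sup>+x. ennreal (k u x) \<partial>lborel) - (\<integral>\<^sup>+x. ennreal (k (real (Suc n)) x) \<partial>lborel)"
        using True u mellin[of "real (Suc n)"]
        by (intro nn_integral_diff) (auto intro!: ennreal_leI anti simp del: of_nat_Suc)
      also have "\<dots> = ennreal (\<kappa> * u powr (-\<alpha>) - \<kappa> * real (Suc n) powr (-\<alpha>))"
        using u \<kappa> by (subst (1 2) mellin) (auto simp: ennreal_minus simp del: of_nat_Suc)
      finally show ?thesis using True by simp
    qed simp
  qed
  also have "\<dots> = (\<Sum>n. ennreal (\<kappa> * d n))"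
    by (intro suminf_cong nn_integral_has_integral_lebesgue'[OF _ dint]) (use pm in auto)
  also have "\<dots> = ennreal (\<kappa> * - Re (zeta (of_real \<alpha>)))"
    using suminf_ennreal2[OF dnn sums_summable[OF ds]] sums_unique[OF ds] by simp
  finally show "(\<integral>\<^sup>+x. ennreal (W x) \<partial>lborel) = ennreal (\<kappa> * - Re (zeta (of_real \<alpha>)))" .
qed

section \<open>Mellin transforms of the two kernels, and the functional equation on the real
  segment\<close>

lemma Gamma_mellin:
  fixes s u :: real
  assumes s: "s > 0" and u: "u > 0"
  shows "(\<integral>\<^sup>+x. ennreal (indicator {0<..} x * x powr (s - 1) * exp (- u * x)) \<partial>lborel) = ennreal (Gamma s * u powr (-s))"
proof -
  let ?g = "\<lambda>t. ennreal (indicator {0..} t * t powr (s - 1) / exp t)"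
  let ?h = "\<lambda>x. ennreal (indicator {0<..} x * x powr (s - 1) * exp (- u * x))"
  have "ennreal (Gamma s) = (\<integral>\<^sup>+t. ?g t \<partial>lborel)" by (rule Gamma_conv_nn_integral_real[OF s])
  also have "\<dots> = ennreal \<bar>u\<bar> * (\<integral>\<^sup>+x. ?g (0 + u * x) \<partial>lborel)"
    using u by (intro nn_integral_real_affine) auto
  also have "(\<integral>\<^sup>+x. ?g (0 + u * x) \<partial>lborel) = (\<integral>\<^sup>+x. ennreal (u powr (s - 1)) * ?h x \<partial>lborel)"
  proof (intro nn_integral_cong)
    fix x
    show "?g (0 + u * x) = ennreal (u powr (s - 1)) * ?h x"
      using u by (cases "x > 0") (auto simp: indicator_def powr_mult exp_minus field_simps zero_le_mult_iff simp flip: ennreal_mult')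
  qed
  also have "\<dots> = ennreal (u powr (s - 1)) * (\<integral>\<^sup>+x. ?h x \<partial>lborel)"
    by (rule nn_integral_cmult) measurable
  finally have "ennreal (Gamma s) = ennreal (u powr s) * (\<integral>\<^sup>+x. ?h x \<partial>lborel)"
    using u by (simp add: powr_diff mult.assoc[symmetric] flip: ennreal_mult)
  hence "ennreal (u powr (-s)) * ennreal (Gamma s) = ennreal (u powr (-s) * u powr s) * (\<integral>\<^sup>+x. ?h x \<partial>lborel)"
    by (simp add: ennreal_mult mult.assoc)
  also have "u powr (-s) * u powr s = 1" using u by (simp flip: powr_add)
  finally show ?thesis using Gamma_real_pos[OF s] by (simp add: mult.commute flip: ennreal_mult)
qed

text \<open>The substitution \<open>t = x^2 / (x^2 + A^2)\<close> maps the half-line onto the unit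
  interval and turns the Beta integral with parameters \<open>(1 + s) / 2\<close> and
  \<open>(1 - s) / 2\<close> into \<open>A powr (1 - s)\<close> times the rational integral.\<close>

lemma rational_mellin:
  fixes s A :: real
  assumes s: "0 < s" "s < 1" and A: "A > 0"
  shows "(\<integral>\<^sup>+x. ennreal (indicator {0<..} x * (2 * x powr s / (x\<^sup>2 + A\<^sup>2))) \<partial>lborel) =
    ennreal (Beta ((1 + s) / 2) ((1 - s) / 2) * A powr (s - 1))"
proof -
  define a b where "a = (1 + s) / 2" and "b = (1 - s) / 2"
  define f where "f = (\<lambda>t::real. t powr (a - 1) * (1 - t) powr (b - 1))"
  define g where "g = (\<lambda>x::real. x\<^sup>2 / (x\<^sup>2 + A\<^sup>2))"
  define g' where "g' = (\<lambda>x::real. 2 * x * A\<^sup>2 / (x\<^sup>2 + A\<^sup>2)\<^sup>2)"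
  have pos: "x\<^sup>2 + A\<^sup>2 > 0" for x using A by (simp add: add_nonneg_pos)
  have ab: "a > 0" "b > 0" using s by (auto simp: a_def b_def)
  have hb: "(f has_integral Beta a b) {0<..<1}"
    using has_integral_Beta_real[OF ab] unfolding f_def by (simp add: has_integral_Icc_iff_Ioo)
  hence ai: "f absolutely_integrable_on {0<..<1}"
    by (intro nonnegative_absolutely_integrable_1) (auto simp: f_def)
  have der: "(g has_field_derivative g' x) (at x within {0<..})" for x
  proof -
    have "x\<^sup>2 + A\<^sup>2 \<noteq> 0" using pos[of x] by (metis less_irrefl)
    thus ?thesis using A unfolding g_def g'_def
      by (auto intro!: derivative_eq_intros simp: field_simps power2_eq_square)
  qed
  have inj: "inj_on g {0<..}"
  proof (rule inj_onI)
    fix x y assume xy: "x \<in> {0<..}" "y \<in> {0<..}" "g x = g y"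
    hence "x\<^sup>2 * (y\<^sup>2 + A\<^sup>2) = y\<^sup>2 * (x\<^sup>2 + A\<^sup>2)"
      using pos[of x] pos[of y] by (simp add: g_def frac_eq_eq)
    hence "x\<^sup>2 * A\<^sup>2 = y\<^sup>2 * A\<^sup>2" by (simp add: algebra_simps)
    hence "x\<^sup>2 = y\<^sup>2" using A by simp
    thus "x = y" using xy by simp
  qed
  have img: "g ` {0<..} = {0<..<1}"
  proof (intro equalityI subsetI)
    fix t assume t: "t \<in> {0<..<1::real}"
    define x where "x = A * sqrt (t / (1 - t))"
    have x2: "x\<^sup>2 = A\<^sup>2 * (t / (1 - t))" using t by (simp add: x_def power_mult_distrib)
    have "x > 0" using t A by (simp add: x_def)
    moreover have "g x = t"
    proof -
      have "x\<^sup>2 + A\<^sup>2 = A\<^sup>2 / (1 - t)" using t unfolding x2 by (simp add: field_simps)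
      thus ?thesis using t A unfolding g_def by (simp add: x2)
    qed
    ultimately show "t \<in> g ` {0<..}" by force
  next
    fix t assume "t \<in> g ` {0<..}"
    then obtain x where "x > 0" "t = g x" by auto
    moreover have "g x > 0" using \<open>x > 0\<close> pos[of x] by (simp add: g_def)
    moreover have "g x < 1" using pos[of x] A by (simp add: g_def divide_less_eq_1)
    ultimately show "t \<in> {0<..<1}" by simp
  qed
  have "(\<lambda>x. \<bar>g' x\<bar> * f (g x)) absolutely_integrable_on {0<..} \<and>
      integral {0<..} (\<lambda>x. \<bar>g' x\<bar> * f (g x)) = Beta a b"
    by (subst has_absolute_integral_change_of_variables_1'[OF _ der inj])
       (use hb ai img in \<open>auto simp: integral_unique\<close>)
  hence "((\<lambda>x. \<bar>g' x\<bar> * f (g x)) has_integral Beta a b) {0<..}"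
    using set_lebesgue_integral_eq_integral(1) has_integral_integral by metis
  hence "((\<lambda>x. A powr (1 - s) * (2 * x powr s / (x\<^sup>2 + A\<^sup>2))) has_integral Beta a b) {0<..}"
  proof (rule has_integral_eq[rotated])
    fix x :: real assume "x \<in> {0<..}"
    hence x: "x > 0" by simp
    let ?D = "x\<^sup>2 + A\<^sup>2"
    have D: "?D > 0" by (rule pos)
    have Dne: "?D \<noteq> 0" using D by (metis less_irrefl)
    have "1 - g x = (?D - x\<^sup>2) / ?D" by (simp only: g_def diff_divide_distrib divide_self[OF Dne])
    hence g1: "1 - g x = A\<^sup>2 / ?D" by simp
    have "f (g x) = (x\<^sup>2) powr (a - 1) / ?D powr (a - 1) * ((A\<^sup>2) powr (b - 1) / ?D powr (b - 1))"
      unfolding f_def g1 unfolding g_def using D A by (simp add: powr_divide)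
    also have "(x\<^sup>2) powr (a - 1) = x powr (s - 1)"
    proof -
      have "(x\<^sup>2) powr (a - 1) = x powr (2 * (a - 1))" using x by (simp add: powr_powr flip: powr_numeral)
      also have "2 * (a - 1) = s - 1" by (simp add: a_def field_simps)
      finally show ?thesis .
    qed
    also have "(A\<^sup>2) powr (b - 1) = A powr (-1 - s)"
    proof -
      have "(A\<^sup>2) powr (b - 1) = A powr (2 * (b - 1))" using A by (simp add: powr_powr flip: powr_numeral)
      also have "2 * (b - 1) = -1 - s" by (simp add: b_def field_simps)
      finally show ?thesis .
    qed
    also have "x powr (s - 1) / ?D powr (a - 1) * (A powr (-1 - s) / ?D powr (b - 1)) =
        x powr (s - 1) * A powr (-1 - s) / (?D powr (a - 1) * ?D powr (b - 1))" by simp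
    also have "?D powr (a - 1) * ?D powr (b - 1) = ?D powr (-1)"
      by (simp add: a_def b_def field_simps flip: powr_add)
    also have "\<dots> = 1 / ?D" using D by (simp add: powr_minus_divide)
    finally have "f (g x) = x powr (s - 1) * A powr (-1 - s) * ?D" by simp
    moreover have "\<bar>g' x\<bar> = 2 * x * A\<^sup>2 / ?D\<^sup>2" using x unfolding g'_def by simp
    ultimately have "\<bar>g' x\<bar> * f (g x) = 2 * (x * x powr (s - 1)) * (A\<^sup>2 * A powr (-1 - s)) / ?D"
      using D by (simp add: power2_eq_square)
    also have "x * x powr (s - 1) = x powr s" using x by (simp add: powr_mult_base)
    also have "A\<^sup>2 * A powr (-1 - s) = A powr (1 - s)"
      using A by (simp flip: powr_add powr_numeral)
    finally show "\<bar>g' x\<bar> * f (g x) = A powr (1 - s) * (2 * x powr s / ?D)" by simp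
  qed
  from has_integral_mult_right[OF this, of "A powr (s - 1)"]
  have "((\<lambda>x. A powr (s - 1) * (A powr (1 - s) * (2 * x powr s / (x\<^sup>2 + A\<^sup>2)))) has_integral A powr (s - 1) * Beta a b) {0<..}" .
  moreover have "A powr (s - 1) * (A powr (1 - s) * y) = y" for y
  proof -
    have "A powr (s - 1) * A powr (1 - s) = 1" using A by (simp flip: powr_add)
    thus ?thesis by (simp flip: mult.assoc)
  qed
  ultimately have "((\<lambda>x. 2 * x powr s / (x\<^sup>2 + A\<^sup>2)) has_integral A powr (s - 1) * Beta a b) {0<..}" by simp
  from nn_integral_has_integral_lebesgue[OF _ this] show ?thesis
    by (simp add: a_def b_def mult.commute)
qed

text \<open>Two kernels yield the same \<open>W\<close>: an exponential one, through the geometric series, and a rational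
  one, through the partial fractions of the hyperbolic cotangent. Their Mellin exponents are \<open>s\<close> and
  \<open>1 - s\<close>.\<close>

lemma zeta_functional_equation_real:
  fixes s :: real
  assumes s: "0 < s" "s < 1"
  shows "Gamma s * Re (zeta (of_real s)) =
    (2 * pi) powr (s - 1) * Beta ((1 + s) / 2) ((1 - s) / 2) * Re (zeta (of_real (1 - s)))"
proof -
  define W where "W = (\<lambda>x::real. if x > 0 then x powr (s - 1) * (1 / x - 1 / (exp x - 1)) else 0)"
  define k1 where "k1 = (\<lambda>u x::real. indicator {0<..} x * x powr (s - 1) * exp (- u * x))"
  define k2 where "k2 = (\<lambda>u x::real. indicator {0<..} x * (2 * x powr s / (x\<^sup>2 + (2 * pi * u)\<^sup>2)))"
  define I1 where "I1 = (\<lambda>(n::nat) x::real. if x > 0 then x powr (s - 1) * ((exp (- real n * x) - exp (- real (Suc n) * x)) / x) else 0)"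
  define I2 where "I2 = (\<lambda>(n::nat) x::real. if x > 0 then x powr (s - 1) *
    ((arctan (2 * pi * real (Suc n) / x) - arctan (2 * pi * real n / x)) / pi) else 0)"
  \<comment> \<open>The constant of \<open>rational_mellin\<close> for
    \<open>A = 2 * pi * u\<close>, after the power of \<open>u\<close> has been split off.\<close>
  define \<kappa> where "\<kappa> = (2 * pi) powr (s - 1) * Beta ((1 + s) / 2) ((1 - s) / 2)"
  have "(1 + s) / 2 + (1 - s) / 2 = 1" by (simp add: field_simps)
  hence Bpos: "Beta ((1 + s) / 2) ((1 - s) / 2) > 0"
    using s unfolding Beta_def by (intro divide_pos_pos mult_pos_pos Gamma_real_pos) auto
  have m1: "(\<lambda>(u, x). k1 u x) \<in> borel_measurable (borel \<Otimes>\<^sub>M borel)"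
    unfolding k1_def by measurable
  have m2: "(\<lambda>(u, x). k2 u x) \<in> borel_measurable (borel \<Otimes>\<^sub>M borel)"
    unfolding k2_def by measurable
  have i1: "((\<lambda>u. k1 u x) has_integral I1 n x) {real n..real (Suc n)}" for n x
  proof (cases "x > 0")
    case x: True
    have "((\<lambda>u. k1 u x) has_integral (- (x powr (s - 1) * exp (- real (Suc n) * x) / x) - - (x powr (s - 1) * exp (- real n * x) / x)))
        {real n..real (Suc n)}"
    proof (rule fundamental_theorem_of_calculus)
      show "((\<lambda>u. - (x powr (s - 1) * exp (- u * x) / x)) has_vector_derivative k1 u x) (at u within {real n..real (Suc n)})" for u
        using x unfolding has_real_derivative_iff_has_vector_derivative[symmetric] k1_def
        by (auto intro!: derivative_eq_intros)
    qed simp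
    also have "- (x powr (s - 1) * exp (- real (Suc n) * x) / x) - - (x powr (s - 1) * exp (- real n * x) / x) = I1 n x"
      using x by (simp add: I1_def diff_divide_distrib right_diff_distrib del: of_nat_Suc)
    finally show ?thesis .
  qed (simp add: k1_def I1_def)
  have i2: "((\<lambda>u. k2 u x) has_integral I2 n x) {real n..real (Suc n)}" for n x
  proof (cases "x > 0")
    case x: True
    have "((\<lambda>u. k2 u x) has_integral (x powr (s - 1) * arctan (2 * pi * real (Suc n) / x) / pi - x powr (s - 1) * arctan (2 * pi * real n / x) / pi))
        {real n..real (Suc n)}"
    proof (rule fundamental_theorem_of_calculus)
      fix u :: real
      have D: "x\<^sup>2 + (2 * pi * u)\<^sup>2 > 0" using x by (simp add: add_pos_nonneg)
      have "((\<lambda>u. arctan (2 * pi * u / x)) has_real_derivative inverse (1 + (2 * pi * u / x)\<^sup>2) * (2 * pi / x)) (at u within {real n..real (Suc n)})"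
        using x by (auto intro!: derivative_eq_intros)
      from DERIV_cdivide[OF DERIV_cmult[OF this, of "x powr (s - 1)"], of pi]
      have "((\<lambda>u. x powr (s - 1) * arctan (2 * pi * u / x) / pi) has_real_derivative
        x powr (s - 1) * (inverse (1 + (2 * pi * u / x)\<^sup>2) * (2 * pi / x)) / pi) (at u within {real n..real (Suc n)})" .
      also have "1 + (2 * pi * u / x)\<^sup>2 = (x\<^sup>2 + (2 * pi * u)\<^sup>2) / x\<^sup>2"
        using x by (simp add: power_divide add_divide_distrib)
      also have "x powr (s - 1) * (inverse ((x\<^sup>2 + (2 * pi * u)\<^sup>2) / x\<^sup>2) * (2 * pi / x)) / pi = 2 * (x * x powr (s - 1)) / (x\<^sup>2 + (2 * pi * u)\<^sup>2)"
        using x D by (simp add: inverse_eq_divide power2_eq_square)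
      also have "\<dots> = k2 u x" using x by (simp add: k2_def powr_mult_base)
      finally show "((\<lambda>u. x powr (s - 1) * arctan (2 * pi * u / x) / pi) has_vector_derivative k2 u x) (at u within {real n..real (Suc n)})"
        unfolding has_real_derivative_iff_has_vector_derivative[symmetric] .
    qed simp
    also have "x powr (s - 1) * arctan (2 * pi * real (Suc n) / x) / pi - x powr (s - 1) * arctan (2 * pi * real n / x) / pi = I2 n x"
      using x by (simp add: I2_def diff_divide_distrib right_diff_distrib del: of_nat_Suc)
    finally show ?thesis .
  qed (simp add: k2_def I2_def)
  have w1: "(\<lambda>n. I1 n x - k1 (real (Suc n)) x) sums W x" for x
  proof (cases "x > 0")
    case x: True
    define r where "r = exp (- x)"
    have r: "0 < r" "r < 1" using x by (auto simp: r_def)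
    have er: "exp (- real n * x) = r ^ n" for n by (simp add: r_def flip: exp_of_nat_mult)
    have g: "(\<lambda>n. r ^ n) sums (1 / (1 - r))" using r by (intro geometric_sums) auto
    have "(\<lambda>n. x powr (s - 1) * ((1 - r) / x * r ^ n - r * r ^ n)) sums
        (x powr (s - 1) * ((1 - r) / x * (1 / (1 - r)) - r * (1 / (1 - r))))"
      by (intro sums_mult sums_diff g)
    also have "(1 - r) / x * (1 / (1 - r)) - r * (1 / (1 - r)) = 1 / x - 1 / (exp x - 1)"
    proof -
      have "r * (1 / (1 - r)) = 1 / (exp x - 1)" using x unfolding r_def by (simp add: exp_minus field_simps)
      thus ?thesis using r by simp
    qed
    also have "(\<lambda>n. x powr (s - 1) * ((1 - r) / x * r ^ n - r * r ^ n)) = (\<lambda>n. I1 n x - k1 (real (Suc n)) x)"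
      using x unfolding I1_def k1_def er by (auto simp: algebra_simps diff_divide_distrib)
    finally show ?thesis using x by (simp add: W_def)
  qed (simp add: I1_def k1_def W_def)
  \<comment> \<open>The primitives of the rational kernel are arctangents, whose differences
    telescope to \<open>pi / 2\<close>. Divided by \<open>pi\<close> this is \<open>1 / 2\<close>,
    which cancels the constant \<open>1 / 2\<close> of the hyperbolic cotangent and leaves the same
    \<open>W\<close> as the geometric series.\<close>
  have w2: "(\<lambda>n. I2 n x - k2 (real (Suc n)) x) sums W x" for x
  proof (cases "x > 0")
    case x: True
    have "filterlim (\<lambda>n. (2 * pi / x) * real n) at_top sequentially"
      using x by (intro filterlim_tendsto_pos_mult_at_top[OF tendsto_const _ filterlim_real_sequentially]) auto
    hence "(\<lambda>n. arctan ((2 * pi / x) * real n)) \<longlonglongrightarrow> pi / 2"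
      by (rule filterlim_compose[OF tendsto_arctan_at_top])
    hence "(\<lambda>n. arctan (2 * pi * real n / x)) \<longlonglongrightarrow> pi / 2" by simp
    from telescope_sums[OF this]
    have "(\<lambda>n. arctan (2 * pi * real (Suc n) / x) - arctan (2 * pi * real n / x)) sums (pi / 2)" by simp
    from sums_mult[OF sums_diff[OF sums_divide[OF this, of pi] coth_partial_fractions[OF x]], of "x powr (s - 1)"]
    have "(\<lambda>n. x powr (s - 1) * ((arctan (2 * pi * real (Suc n) / x) - arctan (2 * pi * real n / x)) / pi
        - 2 * x / (x\<^sup>2 + (2 * pi * real (Suc n))\<^sup>2))) sums (x powr (s - 1) * (pi / 2 / pi - (1 / (exp x - 1) - 1 / x + 1 / 2)))" .
    also have "x powr (s - 1) * (pi / 2 / pi - (1 / (exp x - 1) - 1 / x + 1 / 2)) = W x"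
      using x by (simp add: W_def)
    also have "(\<lambda>n. x powr (s - 1) * ((arctan (2 * pi * real (Suc n) / x) - arctan (2 * pi * real n / x)) / pi
        - 2 * x / (x\<^sup>2 + (2 * pi * real (Suc n))\<^sup>2))) = (\<lambda>n. I2 n x - k2 (real (Suc n)) x)"
    proof
      fix n
      have "2 * x powr s = x powr (s - 1) * (2 * x)" using x powr_mult_base[of x "s - 1"] by (simp add: mult_ac)
      thus "x powr (s - 1) * ((arctan (2 * pi * real (Suc n) / x) - arctan (2 * pi * real n / x)) / pi
        - 2 * x / (x\<^sup>2 + (2 * pi * real (Suc n))\<^sup>2)) = I2 n x - k2 (real (Suc n)) x"
        using x by (simp add: I2_def k2_def right_diff_distrib del: of_nat_Suc)
    qed
    finally show ?thesis .
  qed (simp add: I2_def k2_def W_def)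
  have M1: "(\<integral>\<^sup>+x. ennreal (k1 u x) \<partial>lborel) = ennreal (Gamma s * u powr (-s))" if "u > 0" for u
    unfolding k1_def by (rule Gamma_mellin) (use s that in auto)
  have M2: "(\<integral>\<^sup>+x. ennreal (k2 u x) \<partial>lborel) = ennreal (\<kappa> * u powr (-(1 - s)))" if "u > 0" for u
    unfolding k2_def using that s
    by (subst rational_mellin) (auto simp: \<kappa>_def powr_mult mult_ac)
  have nn: "k1 u x \<ge> 0" "k2 u x \<ge> 0" for u x by (auto simp: k1_def k2_def)
  have an1: "k1 v x \<le> k1 u x" if "0 \<le> u" "u \<le> v" for u v x
    using that by (auto simp: k1_def indicator_def intro!: mult_left_mono mult_right_mono)
  have an2: "k2 v x \<le> k2 u x" if "0 \<le> u" "u \<le> v" for u v x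
  proof (cases "x > 0")
    case True
    have "(2 * pi * u)\<^sup>2 \<le> (2 * pi * v)\<^sup>2" using that by (intro power_mono mult_left_mono) auto
    thus ?thesis using True unfolding k2_def
      by (auto intro!: divide_left_mono mult_pos_pos add_pos_nonneg)
  qed (simp add: k2_def)
  have T1: "(\<integral>\<^sup>+x. ennreal (W x) \<partial>lborel) = ennreal (Gamma s * - Re (zeta (of_real s)))" "Gamma s * - Re (zeta (of_real s)) \<ge> 0"
    using mellin_zeta_tonelli[OF s _ m1 nn(1) an1 M1 i1 w1] Gamma_real_pos[OF s(1)] by auto
  have T2: "(\<integral>\<^sup>+x. ennreal (W x) \<partial>lborel) = ennreal (\<kappa> * - Re (zeta (of_real (1 - s))))" "\<kappa> * - Re (zeta (of_real (1 - s))) \<ge> 0"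
    using mellin_zeta_tonelli[OF _ _ _ m2 nn(2) an2 M2 i2 w2] s Bpos by (auto simp: \<kappa>_def)
  \<comment> \<open>Both sides are nonnegative, and on nonnegative reals \<open>ennreal\<close> is
    injective.\<close>
  have "Gamma s * - Re (zeta (of_real s)) = \<kappa> * - Re (zeta (of_real (1 - s)))"
    using T1 T2 by simp
  thus ?thesis by (simp add: \<kappa>_def)
qed

text \<open>The real identity is continued analytically. The domain is the upper half-plane joined
  with the disc on the diameter from 0 to 1: it is connected, contains the real segment, and meets
  no integer, so \<open>Gamma s\<close>, \<open>zeta s\<close> and \<open>zeta (1 - s)\<close> are
  all holomorphic on it. The parameters of the Beta function add up to 1, so the reflection formula
  turns it into \<open>pi\<close> over a cosine.\<close>

lemma zeta_functional_equation:
  assumes s: "Im s > 0"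
  shows "2 * cos (of_real pi * s / 2) * Gamma s * zeta s = of_real (2 * pi) powr s * zeta (1 - s)"
proof -
  let ?H = "{s. Im s > 0}" and ?B = "ball (1 / 2) (1 / 2) :: complex set"
  let ?S = "?H \<union> ?B"
  let ?f = "\<lambda>s. 2 * cos (of_real pi * s / 2) * Gamma s * zeta s - of_real (2 * pi) powr s * zeta (1 - s)"
  have ReB: "0 < Re s \<and> Re s < 1" if "s \<in> ?B" for s
    using that abs_Re_le_cmod[of "1 / 2 - s"] by (auto simp: dist_norm)
  have notin: "s \<notin> \<int>" if "s \<in> ?S" for s
    using that ReB[of s] by (auto elim!: Ints_cases)
  have n01: "s \<noteq> 0" "s \<noteq> 1" if "s \<in> ?S" for s using notin[OF that] by auto
  have np: "s \<notin> \<int>\<^sub>\<le>\<^sub>0" if "s \<in> ?S" for s using notin[OF that] nonpos_Ints_subset_Ints by auto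
  have op: "open ?S" by (intro open_Un open_halfspace_Im_gt open_ball)
  have "1 / 2 + \<i> / 4 \<in> ?H \<inter> ?B" by (simp add: dist_norm norm_mult)
  hence ne: "?H \<inter> ?B \<noteq> {}" by blast
  have con: "connected ?S"
    by (intro connected_Un convex_connected convex_halfspace_Im_gt convex_ball ne)
  have "zeta \<circ> (\<lambda>s. 1 - s) holomorphic_on ?S"
  proof (rule holomorphic_on_compose_gen[OF _ zeta_holomorphic])
    show "(\<lambda>s. 1 - s) ` ?S \<subseteq> - {1}" using n01(1) by auto
  qed (intro holomorphic_intros)
  hence hZ1: "(\<lambda>s. zeta (1 - s)) holomorphic_on ?S" by (simp only: o_def)
  have "?S \<subseteq> - {1}" using n01(2) by blast
  hence hZ: "zeta holomorphic_on ?S" by (rule holomorphic_on_subset[OF zeta_holomorphic])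
  have "?f holomorphic_on S" if "zeta holomorphic_on S" "(\<lambda>s. zeta (1 - s)) holomorphic_on S"
    "open S" "S \<inter> \<int>\<^sub>\<le>\<^sub>0 = {}" for S
    using that by (intro holomorphic_intros) auto
  moreover have "?S \<inter> \<int>\<^sub>\<le>\<^sub>0 = {}" using np by blast
  ultimately have hol: "?f holomorphic_on ?S" using hZ hZ1 op by blast
  let ?U = "of_real ` {0<..<1::real} :: complex set"
  have zero: "?f z = 0" if z: "z \<in> ?U" for z
  proof -
    from z obtain r where r: "z = of_real r" "0 < r" "r < 1" by auto
    have fe: "Gamma r * Re (zeta z) = (2 * pi) powr (r - 1) * Beta ((1 + r) / 2) ((1 - r) / 2) * Re (zeta (1 - z))"
      using zeta_functional_equation_real[OF r(2,3)] r(1) by simp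
    have e1: "zeta z = of_real (Re (zeta z))" "zeta (1 - z) = of_real (Re (zeta (1 - z)))"
      using zeta_real_sums(2)[of r] zeta_real_sums(2)[of "1 - r"] r by simp_all
    have "Gamma z * zeta z = of_real (Gamma r * Re (zeta z))"
      using e1(1) r(1) by (simp add: Gamma_complex_of_real)
    also have "\<dots> = of_real ((2 * pi) powr (r - 1)) * of_real (Beta ((1 + r) / 2) ((1 - r) / 2)) * zeta (1 - z)"
      unfolding fe using e1(2) by simp
    also have "complex_of_real (Beta ((1 + r) / 2) ((1 - r) / 2)) = of_real pi / cos (of_real pi * z / 2)"
    proof -
      have "complex_of_real (Beta ((1 + r) / 2) ((1 - r) / 2)) = Gamma ((1 + z) / 2) * Gamma (1 - (1 + z) / 2) / Gamma 1"
      proof -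
        have "complex_of_real (Beta ((1 + r) / 2) ((1 - r) / 2)) =
            Gamma (of_real ((1 + r) / 2)) * Gamma (of_real ((1 - r) / 2)) / Gamma (of_real ((1 + r) / 2 + (1 - r) / 2))"
          unfolding Beta_def Gamma_complex_of_real by simp
        moreover have "(1 + r) / 2 + (1 - r) / 2 = 1" "complex_of_real ((1 + r) / 2) = (1 + z) / 2"
          "complex_of_real ((1 - r) / 2) = 1 - (1 + z) / 2" by (simp_all add: r(1) field_simps)
        ultimately show ?thesis by (simp only: of_real_1)
      qed
      also have "\<dots> = of_real pi / sin (of_real pi * ((1 + z) / 2))"
        by (simp add: Gamma_reflection_complex)
      also have "of_real pi * ((1 + z) / 2) = of_real pi / 2 + of_real pi * z / 2" by (simp add: field_simps)
      also have "sin (of_real pi / 2 + of_real pi * z / 2) = cos (of_real pi * z / 2)"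
        by (simp add: sin_cos_eq)
      finally show ?thesis .
    qed
    also have "complex_of_real ((2 * pi) powr (r - 1)) = of_real (2 * pi) powr z / of_real (2 * pi)"
    proof -
      have "complex_of_real ((2 * pi) powr (r - 1)) = of_real (2 * pi) powr (of_real (r - 1))"
        using powr_of_real[of "2 * pi" "r - 1"] by simp
      also have "\<dots> = of_real (2 * pi) powr z / of_real (2 * pi)"
        by (simp add: r(1) powr_diff)
      finally show ?thesis .
    qed
    finally have G: "Gamma z * zeta z = of_real (2 * pi) powr z / of_real (2 * pi) * (of_real pi / cos (of_real pi * z / 2)) * zeta (1 - z)" .
    have "cos (of_real pi * z / 2) \<noteq> 0"
    proof -
      have "0 < pi * r" "pi * r < pi" using r by auto
      hence "cos (pi * r / 2) > 0" using pi_gt_zero by (intro cos_gt_zero_pi) linarith+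
      moreover have "cos (of_real pi * z / 2) = complex_of_real (cos (pi * r / 2))" using cos_of_real[of "pi * r / 2", where ?'a = complex] by (simp add: r(1))
      ultimately show ?thesis by simp
    qed
    hence "2 * cos (of_real pi * z / 2) * (Gamma z * zeta z) = of_real (2 * pi) powr z * zeta (1 - z)"
      unfolding G by simp
    thus ?thesis by (simp add: mult.assoc)
  qed
  have lim: "(1 / 2 :: complex) islimpt ?U"
    unfolding islimpt_approachable
  proof (intro allI impI)
    fix e :: real assume e: "e > 0"
    define d where "d = min (e / 2) (1 / 4)"
    have d: "0 < d" "d \<le> 1 / 4" "d < e" using e by (auto simp: d_def)
    have "complex_of_real (1 / 2 + d) - 1 / 2 = of_real d" by simp
    hence "dist (complex_of_real (1 / 2 + d)) (1 / 2) = d" using d by (simp only: dist_norm norm_of_real)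
    hence "dist (complex_of_real (1 / 2 + d)) (1 / 2) < e" "complex_of_real (1 / 2 + d) \<noteq> 1 / 2" using d by auto
    moreover have "of_real (1 / 2 + d) \<in> ?U" using d by (intro imageI) auto
    ultimately show "\<exists>x'\<in>?U. x' \<noteq> 1 / 2 \<and> dist x' (1 / 2) < e" by blast
  qed
  have sub: "?U \<subseteq> ?S"
  proof
    fix z assume "z \<in> ?U"
    then obtain r where r: "z = of_real r" "0 < r" "r < 1" by auto
    have "1 / 2 - z = of_real (1 / 2 - r)" by (simp add: r(1))
    hence "norm (1 / 2 - z) = \<bar>1 / 2 - r\<bar>" by (simp only: norm_of_real)
    also have "\<dots> < 1 / 2" using r(2,3) by linarith
    finally show "z \<in> ?S" by (simp add: dist_norm)
  qed
  have "?f s = 0"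
    by (rule analytic_continuation[OF hol op con sub _ lim zero]) (use s in auto)
  thus ?thesis by simp
qed

section \<open>The logarithmic derivative left of the critical strip\<close>

text \<open>Logarithmic derivative of
  \<open>(2 * pi) powr s / (2 * cos (pi * s / 2) * Gamma s)\<close>, the quotient of
  \<open>zeta s\<close> and \<open>zeta (1 - s)\<close>.\<close>

definition fe_logderiv :: "complex \<Rightarrow> complex" where
  "fe_logderiv s = of_real (ln (2 * pi)) - Digamma s + of_real (pi / 2) * tan (of_real pi * s / 2)"

definition fe_logderiv' :: "complex \<Rightarrow> complex" where
  "fe_logderiv' s = - Polygamma 1 s + of_real (pi\<^sup>2 / 4) / (cos (of_real pi * s / 2))\<^sup>2"

text \<open>The squared modulus of the cosine contains the squared hyperbolic sine of the imaginary
  part. The quadratic bound kept here is far below the true exponential growth, but it makes the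
  secant term of \<open>fe_logderiv'\<close> decay like \<open>1 / (Im s)^2\<close>.\<close>

lemma norm_cos_lower:
  assumes "Im s \<ge> 0"
  shows "norm (cos (of_real pi * s / 2)) ^ 2 \<ge> (pi * Im s) ^ 2 / 16"
proof -
  define z where "z = of_real pi * s / 2"
  define x where "x = Im z"
  have xs: "x = pi * Im s / 2" by (simp add: x_def z_def)
  have x: "x \<ge> 0" using assms by (simp add: xs)
  have 1: "norm (cos z) ^ 2 = (cos (Re z))\<^sup>2 + (exp x - inverse (exp x))\<^sup>2 / 4"
    unfolding norm_cos_squared x_def by (rule refl)
  have "1 + x \<le> exp x" by (rule exp_ge_add_one_self)
  moreover have "inverse (exp x) \<le> 1" using x by (intro inverse_le_1_iff[THEN iffD2]) auto
  ultimately have "exp x - inverse (exp x) \<ge> x" by linarith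
  hence "(exp x - inverse (exp x))\<^sup>2 \<ge> x\<^sup>2" using x by (intro power_mono) auto
  hence "norm (cos z) ^ 2 \<ge> x\<^sup>2 / 4" unfolding 1 using zero_le_power2[of "cos (Re z)"] by linarith
  thus ?thesis unfolding xs z_def by (simp add: power_divide)
qed

lemma cos_nonzero_upper:
  assumes "Im s > 0"
  shows "cos (of_real pi * s / 2) \<noteq> 0"
proof
  assume "cos (of_real pi * s / 2) = 0"
  moreover have "(pi * Im s) ^ 2 / 16 > 0" using assms by simp
  ultimately show False using norm_cos_lower[of s] assms by simp
qed

lemma notin_Ints_upper: "Im s > 0 \<Longrightarrow> s \<notin> \<int>"
  by (auto elim!: Ints_cases)

lemma notin_nonpos_Ints_upper: "Im s > 0 \<Longrightarrow> s \<notin> \<int>\<^sub>\<le>\<^sub>0"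
  using notin_Ints_upper nonpos_Ints_subset_Ints by blast

lemma zeta_left_nonzero:
  assumes "Re s < 0" "Im s > 0"
  shows "zeta s \<noteq> 0"
proof
  assume "zeta s = 0"
  hence "of_real (2 * pi) powr s * zeta (1 - s) = 0"
    using zeta_functional_equation[OF assms(2)] by (simp only: mult_zero_right)
  moreover have "zeta (1 - s) \<noteq> 0" using assms by (intro zeta_nonzero) simp
  ultimately show False by simp
qed

text \<open>Logarithmic differentiation of the functional equation. The sign from differentiating
  \<open>1 - s\<close> cancels the sign in \<open>logderiv_zeta\<close>, so the reflected Dirichlet
  series enters with a plus.\<close>

lemma logderiv_zeta_left:
  assumes s: "Re s < 0" "Im s > 0"
  shows "deriv zeta s / zeta s = mangoldt_series (1 - s) + fe_logderiv s"
proof -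
  let ?c = "cos (of_real pi * s / 2)" and ?S = "sin (of_real pi * s / 2)" and ?w = "of_real (2 * pi) :: complex"
  have np: "s \<notin> \<int>\<^sub>\<le>\<^sub>0" using s by (intro notin_nonpos_Ints_upper)
  have ne: "s \<noteq> 1" "1 - s \<noteq> 1" using s by auto
  have cz: "?c \<noteq> 0" using s by (intro cos_nonzero_upper)
  have gz: "Gamma s \<noteq> 0" using np by (simp add: Gamma_eq_zero_iff)
  have zz: "zeta s \<noteq> 0" using zeta_left_nonzero[OF s] .
  have zz1: "zeta (1 - s) \<noteq> 0" using s by (intro zeta_nonzero) auto
  have dz: "(zeta has_field_derivative deriv zeta z) (at z)" if "z \<noteq> 1" for z
    by (rule holomorphic_derivI[OF zeta_holomorphic]) (use that in auto)
  have "((\<lambda>z. 1 - z) has_field_derivative -1) (at s)" by (auto intro!: derivative_eq_intros)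
  from DERIV_chain2[where f = zeta and g = "\<lambda>z. 1 - z", OF dz[OF ne(2)] this]
  have dz1: "((\<lambda>z. zeta (1 - z)) has_field_derivative - deriv zeta (1 - s)) (at s)" by simp
  have "((\<lambda>z. 2 * cos (of_real pi * z / 2) * Gamma z * zeta z) has_field_derivative
     2 * ?c * Gamma s * deriv zeta s + 2 * (- ?S * (of_real pi / 2) * Gamma s + Gamma s * Digamma s * ?c) * zeta s) (at s)"
    using np by (auto intro!: derivative_eq_intros dz ne simp: algebra_simps)
  moreover have "((\<lambda>z. 2 * cos (of_real pi * z / 2) * Gamma z * zeta z) has_field_derivative
     ?w powr s * (Ln ?w * zeta (1 - s) - deriv zeta (1 - s))) (at s)"
  proof (rule has_field_derivative_transform_within_open[where S = "{z. Im z > 0}"])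
    show "((\<lambda>z. ?w powr z * zeta (1 - z)) has_field_derivative
      ?w powr s * (Ln ?w * zeta (1 - s) - deriv zeta (1 - s))) (at s)"
      by (auto intro!: derivative_eq_intros dz1 simp: algebra_simps)
  qed (use s zeta_functional_equation in \<open>auto simp: open_halfspace_Im_gt\<close>)
  ultimately have eq: "2 * ?c * Gamma s * deriv zeta s + 2 * (- ?S * (of_real pi / 2) * Gamma s + Gamma s * Digamma s * ?c) * zeta s
     = ?w powr s * (Ln ?w * zeta (1 - s) - deriv zeta (1 - s))" by (rule DERIV_unique)
  have fe: "2 * ?c * Gamma s * zeta s = ?w powr s * zeta (1 - s)" by (rule zeta_functional_equation[OF s(2)])
  have "(2 * ?c * Gamma s * zeta s) * (deriv zeta s / zeta s - of_real (pi / 2) * tan (of_real pi * s / 2) + Digamma s) =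
     2 * ?c * Gamma s * deriv zeta s + 2 * (- ?S * (of_real pi / 2) * Gamma s + Gamma s * Digamma s * ?c) * zeta s"
    using cz zz by (simp add: tan_def field_simps)
  also have "\<dots> = (?w powr s * zeta (1 - s)) * (Ln ?w - deriv zeta (1 - s) / zeta (1 - s))"
    unfolding eq using zz1 by (simp add: field_simps)
  finally have "deriv zeta s / zeta s - of_real (pi / 2) * tan (of_real pi * s / 2) + Digamma s = Ln ?w - deriv zeta (1 - s) / zeta (1 - s)"
    using cz gz zz unfolding fe[symmetric] by simp
  moreover have "deriv zeta (1 - s) / zeta (1 - s) = - mangoldt_series (1 - s)" using s by (intro logderiv_zeta) auto
  moreover have "Ln ?w = of_real (ln (2 * pi))" by (rule Ln_of_real) simp
  ultimately show ?thesis unfolding fe_logderiv_def by (simp add: algebra_simps)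
qed

lemma fe_logderiv_DERIV:
  assumes "Im s > 0"
  shows "(fe_logderiv has_field_derivative fe_logderiv' s) (at s)"
proof -
  have "s \<notin> \<int>\<^sub>\<le>\<^sub>0" "cos (of_real pi * s / 2) \<noteq> 0"
    using notin_nonpos_Ints_upper[OF assms] cos_nonzero_upper[OF assms] by auto
  thus ?thesis unfolding fe_logderiv_def[abs_def] fe_logderiv'_def
    by (auto intro!: derivative_eq_intros simp: field_simps power2_eq_square)
qed

text \<open>With \<open>a = k + Im s\<close> the hypotheses give
  \<open>norm (s + k)^2 \<ge> a * (a + 1) / 16\<close>, and the reciprocals of
  \<open>a * (a + 1)\<close> telescope over \<open>k\<close> to \<open>1 / Im s\<close>.\<close>

lemma norm_Polygamma_1_le:
  fixes s :: complex
  assumes s: "- 1 / 2 \<le> Re s" "Re s \<le> 0" "Im s \<ge> 1"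
  shows "norm (Polygamma 1 s) \<le> 16 / Im s"
proof -
  define t where "t = Im s"
  have t: "t \<ge> 1" using s by (simp add: t_def)
  have "(\<lambda>k. 1 / (t + real k)) \<longlonglongrightarrow> 0"
    by (intro tendsto_divide_0[OF tendsto_const] filterlim_at_top_imp_at_infinity
        filterlim_tendsto_add_at_top[OF tendsto_const filterlim_real_sequentially])
  hence "(\<lambda>k. 1 / (real k + t)) \<longlonglongrightarrow> 0" by (simp add: add.commute)
  from telescope_sums'[OF this] have tel: "(\<lambda>k. 1 / (real k + t) - 1 / (real (Suc k) + t)) sums (1 / t)" by simp
  have bd: "norm (inverse ((s + of_nat k) ^ Suc 1)) \<le> 16 * (1 / (real k + t) - 1 / (real (Suc k) + t))" for k
  proof -
    let ?a = "real k + t"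
    have a: "?a \<ge> 1" using t by simp
    have "(norm (s + of_nat k))\<^sup>2 = (Re s + real k)\<^sup>2 + t\<^sup>2" by (simp add: cmod_power2 t_def)
    moreover have "2 * ((Re s + real k)\<^sup>2 + t\<^sup>2) \<ge> (Re s + real k + t)\<^sup>2"
      using zero_le_power2[of "Re s + real k - t"] by (simp add: power2_eq_square algebra_simps)
    moreover have "(Re s + real k + t)\<^sup>2 \<ge> (?a / 2)\<^sup>2" using s t by (intro power_mono) auto
    moreover have "?a * ?a \<ge> ?a * 1" using a by (intro mult_left_mono) auto
    ultimately have "(norm (s + of_nat k))\<^sup>2 \<ge> ?a * (?a + 1) / 16"
      by (simp add: power2_eq_square algebra_simps)
    moreover have "?a * (?a + 1) / 16 > 0" using a by simp
    ultimately have "inverse ((norm (s + of_nat k))\<^sup>2) \<le> inverse (?a * (?a + 1) / 16)" by (rule le_imp_inverse_le)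
    also have "\<dots> = 16 * (1 / ?a - 1 / (real (Suc k) + t))" using a by (simp add: field_simps)
    finally show ?thesis by (simp add: norm_inverse norm_power power2_eq_square norm_mult del: of_nat_Suc)
  qed
  have "norm (\<Sum>k. inverse ((s + of_nat k) ^ Suc 1)) \<le> (\<Sum>k. 16 * (1 / (real k + t) - 1 / (real (Suc k) + t)))"
    by (rule norm_suminf_le[OF bd summable_mult[OF sums_summable[OF tel]]])
  also have "\<dots> = 16 / t" using sums_unique[OF sums_mult[OF tel, of 16]] by simp
  finally show ?thesis by (simp add: Polygamma_def t_def)
qed

lemma norm_fe_logderiv'_le:
  assumes s: "- 1 / 2 \<le> Re s" "Re s \<le> 0" "Im s \<ge> 1"
  shows "norm (fe_logderiv' s) \<le> 20 / Im s"
proof -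
  let ?c = "norm (cos (of_real pi * s / 2)) ^ 2"
  have c: "?c \<ge> (pi * Im s) ^ 2 / 16" using s by (intro norm_cos_lower) auto
  have pos: "(pi * Im s) ^ 2 / 16 > 0" using s by simp
  have "norm (fe_logderiv' s) \<le> norm (Polygamma 1 s) + norm (of_real (pi\<^sup>2 / 4) / (cos (of_real pi * s / 2))\<^sup>2)"
    unfolding fe_logderiv'_def using norm_triangle_ineq[of "- Polygamma 1 s"] by simp
  also have "norm (of_real (pi\<^sup>2 / 4) / (cos (of_real pi * s / 2))\<^sup>2) = (pi\<^sup>2 / 4) / ?c"
    by (simp only: norm_divide norm_of_real norm_power) simp
  also have "\<dots> \<le> (pi\<^sup>2 / 4) / ((pi * Im s) ^ 2 / 16)"
  proof (rule divide_left_mono[OF c])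
    have "?c > 0" using c pos by linarith
    thus "0 < ?c * ((pi * Im s) ^ 2 / 16)" using pos by (rule mult_pos_pos)
  qed simp
  also have "\<dots> = 4 / (Im s * Im s)" by (simp add: power2_eq_square)
  also have "\<dots> \<le> 4 / (1 * Im s)" using s by (intro divide_left_mono mult_right_mono) auto
  finally show ?thesis using norm_Polygamma_1_le[OF s] by simp
qed

text \<open>The derivative bound \<open>20 / t\<close> is integrated upwards from height 1, where
  compactness of the segment provides \<open>K\<close>.\<close>

lemma fe_logderiv_bound:
  "\<exists>K>0. \<forall>\<sigma> t. - 1 / 2 \<le> \<sigma> \<longrightarrow> \<sigma> \<le> 0 \<longrightarrow> t \<ge> 1 \<longrightarrow> norm (fe_logderiv (Complex \<sigma> t)) \<le> K + 20 * ln t"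
proof -
  let ?S = "(\<lambda>\<sigma>. Complex \<sigma> 1) ` {-1/2..0}"
  have C: "Complex \<sigma> t = of_real \<sigma> + \<i> * of_real t" for \<sigma> t by (simp add: complex_eq_iff)
  have "continuous_on ?S fe_logderiv"
    by (rule continuous_at_imp_continuous_on) (auto intro!: DERIV_isCont[OF fe_logderiv_DERIV])
  moreover have "compact ?S" unfolding C by (intro compact_continuous_image continuous_intros) auto
  ultimately have "bounded (fe_logderiv ` ?S)" by (rule compact_imp_bounded[OF compact_continuous_image])
  then obtain K where K: "K > 0" "\<And>z. z \<in> ?S \<Longrightarrow> norm (fe_logderiv z) \<le> K"
    unfolding bounded_pos by blast
  have "norm (fe_logderiv (Complex \<sigma> t)) \<le> K + 20 * ln t" if \<sigma>: "- 1 / 2 \<le> \<sigma>" "\<sigma> \<le> 0" and t: "t \<ge> 1" for \<sigma> t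
  proof (cases "t = 1")
    case False
    hence t1: "1 < t" using t by simp
    have "norm (fe_logderiv (Complex \<sigma> t) - fe_logderiv (Complex \<sigma> 1)) \<le> 20 * ln t - 20 * ln 1"
    proof (rule differentiable_bound_general[OF t1, where f = "\<lambda>t. fe_logderiv (Complex \<sigma> t)" and
          f' = "\<lambda>t. \<i> * fe_logderiv' (Complex \<sigma> t)" and \<phi> = "\<lambda>t. 20 * ln t" and \<phi>' = "\<lambda>t. 20 / t"])
      have d: "((\<lambda>t. fe_logderiv (Complex \<sigma> t)) has_vector_derivative \<i> * fe_logderiv' (Complex \<sigma> x)) (at x)" if "x \<ge> 1" for x
      proof -
        have "((\<lambda>t. Complex \<sigma> t) has_vector_derivative \<i>) (at x)"
          unfolding C by (auto intro!: derivative_eq_intros)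
        from field_vector_diff_chain_at[OF this fe_logderiv_DERIV] that show ?thesis by (simp add: o_def)
      qed
      show "continuous_on {1..t} (\<lambda>t. fe_logderiv (Complex \<sigma> t))"
        by (rule continuous_at_imp_continuous_on) (auto intro!: has_vector_derivative_continuous[OF d])
      show "continuous_on {1..t} (\<lambda>t. 20 * ln t)" by (intro continuous_intros) auto
      fix x assume x: "1 < x" "x < t"
      show "((\<lambda>t. fe_logderiv (Complex \<sigma> t)) has_vector_derivative \<i> * fe_logderiv' (Complex \<sigma> x)) (at x)"
        using x by (intro d) auto
      show "((\<lambda>t. 20 * ln t) has_vector_derivative 20 / x) (at x)"
        using x unfolding has_real_derivative_iff_has_vector_derivative[symmetric]
        by (auto intro!: derivative_eq_intros)
      show "norm (\<i> * fe_logderiv' (Complex \<sigma> x)) \<le> 20 / x"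
        using norm_fe_logderiv'_le[of "Complex \<sigma> x"] \<sigma> x by (simp add: norm_mult)
    qed
    moreover have "norm (fe_logderiv (Complex \<sigma> 1)) \<le> K" using \<sigma> by (intro K) auto
    ultimately show ?thesis
      using norm_triangle_ineq2[of "fe_logderiv (Complex \<sigma> t)" "fe_logderiv (Complex \<sigma> 1)"] by simp
  qed (use K \<sigma> in auto)
  thus ?thesis using K(1) by blast
qed

text \<open>The majorant is supplied together with an antiderivative, so that bounds varying along
  the edge, such as \<open>20 / t\<close> or the inverse square root near a zero, are integrated
  exactly and not replaced by their maximum times the length.\<close>

lemma contour_integral_linepath_bound:
  fixes a b :: complex
  assumes h: "continuous_on (closed_segment a b) h"
    and bd: "\<And>u. u \<in> {0..1} \<Longrightarrow> norm (h (linepath a b u)) * norm (b - a) \<le> \<phi>' u"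
    and \<phi>: "\<And>u. u \<in> {0..1} \<Longrightarrow> (\<phi> has_real_derivative \<phi>' u) (at u within {0..1})"
  shows "norm (contour_integral (linepath a b) h) \<le> \<phi> 1 - \<phi> 0"
proof -
  have "h contour_integrable_on linepath a b" by (rule contour_integrable_continuous_linepath[OF h])
  hence "(h has_contour_integral contour_integral (linepath a b) h) (linepath a b)"
    by (rule has_contour_integral_integral)
  hence 1: "((\<lambda>u. h (linepath a b u) * (b - a)) has_integral contour_integral (linepath a b) h) {0..1}"
    by (simp only: has_contour_integral_linepath)
  have 2: "(\<phi>' has_integral (\<phi> 1 - \<phi> 0)) {0..1}"
    using \<phi> by (intro fundamental_theorem_of_calculus) (auto simp: has_real_derivative_iff_has_vector_derivative)
  have "norm (integral {0..1} (\<lambda>u. h (linepath a b u) * (b - a))) \<le> integral {0..1} \<phi>'"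
    by (rule integral_norm_bound_integral[OF has_integral_integrable[OF 1] has_integral_integrable[OF 2]])
       (use bd in \<open>simp add: norm_mult\<close>)
  thus ?thesis unfolding integral_unique[OF 1] integral_unique[OF 2] .
qed

lemma contour_integral_vertical_bound:
  fixes \<sigma> :: real
  assumes T: "T0 \<le> T1"
    and h: "continuous_on (closed_segment (Complex \<sigma> T0) (Complex \<sigma> T1)) h"
    and bd: "\<And>t. t \<in> {T0..T1} \<Longrightarrow> norm (h (Complex \<sigma> t)) \<le> \<phi>' t"
    and \<phi>: "\<And>t. t \<in> {T0..T1} \<Longrightarrow> (\<phi> has_real_derivative \<phi>' t) (at t)"
  shows "norm (contour_integral (linepath (Complex \<sigma> T0) (Complex \<sigma> T1)) h) \<le> \<phi> T1 - \<phi> T0"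
proof -
  let ?p = "\<lambda>u. T0 + u * (T1 - T0)"
  have p: "?p u \<in> {T0..T1}" if "u \<in> {0..1}" for u
    using that T mult_right_mono[of u 1 "T1 - T0"] by auto
  have "norm (contour_integral (linepath (Complex \<sigma> T0) (Complex \<sigma> T1)) h) \<le> \<phi> (?p 1) - \<phi> (?p 0)"
  proof (rule contour_integral_linepath_bound[OF h, where \<phi>' = "\<lambda>u. \<phi>' (?p u) * (T1 - T0)" and \<phi> = "\<lambda>u. \<phi> (?p u)"])
    fix u :: real assume u: "u \<in> {0..1}"
    have "linepath (Complex \<sigma> T0) (Complex \<sigma> T1) u = Complex \<sigma> (?p u)"
      by (simp add: linepath_def complex_eq_iff algebra_simps)
    moreover have "norm (Complex \<sigma> T1 - Complex \<sigma> T0) = T1 - T0" using T by (simp add: cmod_def)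
    ultimately show "norm (h (linepath (Complex \<sigma> T0) (Complex \<sigma> T1) u)) * norm (Complex \<sigma> T1 - Complex \<sigma> T0) \<le> \<phi>' (?p u) * (T1 - T0)"
      using bd[OF p[OF u]] T by (simp add: mult_right_mono)
    have "((\<lambda>u. T0 + u * (T1 - T0)) has_real_derivative (T1 - T0)) (at u within {0..1})"
      by (auto intro!: derivative_eq_intros)
    from DERIV_chain2[OF \<phi>[OF p[OF u]] this]
    show "((\<lambda>u. \<phi> (?p u)) has_real_derivative \<phi>' (?p u) * (T1 - T0)) (at u within {0..1})" .
  qed
  thus ?thesis by simp
qed

lemma contour_integral_horizontal_bound:
  fixes t :: real
  assumes \<sigma>: "s0 \<le> s1"
    and h: "continuous_on (closed_segment (Complex s0 t) (Complex s1 t)) h"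
    and bd: "\<And>\<sigma>. \<sigma> \<in> {s0..s1} \<Longrightarrow> norm (h (Complex \<sigma> t)) \<le> \<phi>' \<sigma>"
    and \<phi>: "\<And>\<sigma>. \<sigma> \<in> {s0..s1} \<Longrightarrow> (\<phi> has_real_derivative \<phi>' \<sigma>) (at \<sigma>)"
  shows "norm (contour_integral (linepath (Complex s0 t) (Complex s1 t)) h) \<le> \<phi> s1 - \<phi> s0"
proof -
  let ?p = "\<lambda>u. s0 + u * (s1 - s0)"
  have p: "?p u \<in> {s0..s1}" if "u \<in> {0..1}" for u
    using that \<sigma> mult_right_mono[of u 1 "s1 - s0"] by auto
  have "norm (contour_integral (linepath (Complex s0 t) (Complex s1 t)) h) \<le> \<phi> (?p 1) - \<phi> (?p 0)"
  proof (rule contour_integral_linepath_bound[OF h, where \<phi>' = "\<lambda>u. \<phi>' (?p u) * (s1 - s0)" and \<phi> = "\<lambda>u. \<phi> (?p u)"])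
    fix u :: real assume u: "u \<in> {0..1}"
    have "linepath (Complex s0 t) (Complex s1 t) u = Complex (?p u) t"
      by (simp add: linepath_def complex_eq_iff algebra_simps)
    moreover have "norm (Complex s1 t - Complex s0 t) = s1 - s0" using \<sigma> by (simp add: cmod_def)
    ultimately show "norm (h (linepath (Complex s0 t) (Complex s1 t) u)) * norm (Complex s1 t - Complex s0 t) \<le> \<phi>' (?p u) * (s1 - s0)"
      using bd[OF p[OF u]] \<sigma> by (simp add: mult_right_mono)
    have "((\<lambda>u. s0 + u * (s1 - s0)) has_real_derivative (s1 - s0)) (at u within {0..1})"
      by (auto intro!: derivative_eq_intros)
    from DERIV_chain2[OF \<phi>[OF p[OF u]] this]
    show "((\<lambda>u. \<phi> (?p u)) has_real_derivative \<phi>' (?p u) * (s1 - s0)) (at u within {0..1})" .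
  qed
  thus ?thesis by simp
qed

section \<open>Zeros near a given height\<close>

lemma upper_zero_nontrivial:
  assumes "zeta \<rho> = 0" "Im \<rho> > 0"
  shows "\<rho> \<in> nontrivial_zeros"
  using assms by (auto simp: nontrivial_zeros_def)

lemma upper_zero_Re:
  assumes "Riemann_Hypothesis" "zeta \<rho> = 0" "Im \<rho> > 0"
  shows "Re \<rho> = 1 / 2"
  using assms upper_zero_nontrivial by (auto simp: Riemann_Hypothesis_def)

lemma zero_mult_pos:
  assumes "zeta \<rho> = 0" "\<rho> \<noteq> 1"
  shows "zero_mult \<rho> \<ge> 1"
proof -
  have "\<exists>w\<in>- {1}. zeta w \<noteq> 0" using zeta_nonzero[of 2] by (intro bexI[of _ 2]) auto
  moreover have "connected (- {1::complex})" by (intro connected_punctured_universe) simp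
  ultimately have "zorder zeta \<rho> > 0"
    using zorder_exist_zero[OF zeta_holomorphic _ _ _ , of \<rho>] assms by auto
  thus ?thesis by (simp add: zero_mult_def)
qed

lemma ln_ge_1: "T \<ge> 10 \<Longrightarrow> ln T \<ge> (1::real)"
  using exp_le by (subst ln_ge_iff) auto

text \<open>The disc lemma at the centre \<open>2 + i T\<close> with radii
  \<open>5 / 2 < 3 < 7 / 2\<close>, \<open>Q = 8\<close> and \<open>R = 9\<close>. The inner disc
  contains the edges of all rectangles near this height, and the disc of radius \<open>7 / 2\<close>
  contains the zeros on the critical line near height \<open>T\<close>. \<open>T \<ge> 10\<close>
  keeps the disc of radius 9 above height 1 and hence away from the pole.\<close>

lemma zeta_local:
  "\<exists>C>0. \<forall>T\<ge>10. let s0 = Complex 2 T; Z = {z\<in>cball s0 (7 / 2). zeta z = 0} in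
     finite Z \<and> real (\<Sum>\<rho>\<in>Z. zero_mult \<rho>) \<le> C * ln T \<and>
     (\<forall>s\<in>cball s0 (5 / 2). zeta s \<noteq> 0 \<longrightarrow>
        norm (deriv zeta s / zeta s - (\<Sum>\<rho>\<in>Z. of_nat (zero_mult \<rho>) / (s - \<rho>))) \<le> C * ln T)"
proof -
  \<comment> \<open>The disc of radius 9 about a point with real part 2 reaches down to real part
    -7, which \<open>K = 8\<close> covers.\<close>
  obtain C0 A where C0: "C0 \<ge> 0" and gr: "\<And>s. Re s \<ge> 1 / 2 - real 8 \<Longrightarrow> norm (zeta_reg s) \<le> C0 * (1 + norm s) ^ A"
    using zeta_reg_growth[of 8] by blast
  \<comment> \<open>Chosen so that \<open>M + 1 \<le> D * ln T\<close>. In \<open>C\<close>, the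
    numbers \<open>9 / 7 = (8 - 7 / 2) / (7 / 2)\<close> and
    \<open>24 = 2 * 3 / (1 / 2 * (1 / 2))\<close> are the two constants of the disc lemma at these
    radii.\<close>
  define D where "D = ln (4 * (C0 + 1)) + 2 * real A + 1"
  have D: "D \<ge> 1" using C0 by (simp add: D_def ln_ge_zero)
  define C where "C = D * (1 / ln (9 / 7) + 24)"
  have l97: "ln (9 / 7 :: real) > 0" by simp
  have C: "C > 0" "D / ln (9 / 7) \<le> C" "24 * D \<le> C" using D l97 by (auto simp: C_def algebra_simps intro!: add_pos_nonneg)
  have "finite Z \<and> real (\<Sum>\<rho>\<in>Z. zero_mult \<rho>) \<le> C * ln T \<and>
     (\<forall>s\<in>cball s0 (5 / 2). zeta s \<noteq> 0 \<longrightarrow>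
        norm (deriv zeta s / zeta s - (\<Sum>\<rho>\<in>Z. of_nat (zero_mult \<rho>) / (s - \<rho>))) \<le> C * ln T)"
    if T: "T \<ge> 10" and s0: "s0 = Complex 2 T" and Z: "Z = {z\<in>cball s0 (7 / 2). zeta z = 0}" for T s0 Z
  proof -
    define M where "M = ln (4 * (C0 + 1)) + real A * ln (3 * T)"
    have l1: "ln T \<ge> 1" using T by (rule ln_ge_1)
    have "ln (3 * T) = ln 3 + ln T" using T by (simp add: ln_mult)
    also have "ln (3::real) \<le> ln T" using T by simp
    finally have "ln (3 * T) \<le> 2 * ln T" by simp
    hence "real A * ln (3 * T) \<le> real A * (2 * ln T)" by (intro mult_left_mono) auto
    moreover have "ln (4 * (C0 + 1)) + 1 \<le> (ln (4 * (C0 + 1)) + 1) * ln T"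
      using mult_left_mono[OF l1, of "ln (4 * (C0 + 1)) + 1"] C0 by simp
    ultimately have MD: "M + 1 \<le> D * ln T" by (simp add: M_def D_def algebra_simps)
    have eM: "exp M = 4 * (C0 + 1) * (3 * T) ^ A"
      using C0 T by (simp add: M_def exp_add exp_of_nat_mult)
    have in_ball: "Re s \<ge> -7" "Im s \<ge> 1" "norm s \<le> T + 11" if "s \<in> ball s0 9" for s
    proof -
      have d: "norm (s - s0) < 9" using that by (simp add: dist_norm norm_minus_commute)
      have "\<bar>Re s - 2\<bar> < 9" "\<bar>Im s - T\<bar> < 9"
        using d abs_Re_le_cmod[of "s - s0"] abs_Im_le_cmod[of "s - s0"] by (auto simp: s0)
      thus "Re s \<ge> -7" "Im s \<ge> 1" using T by auto
      have "norm s0 \<le> 2 + T" using cmod_le[of s0] T by (simp add: s0)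
      thus "norm s \<le> T + 11" using d norm_triangle_ineq[of "s - s0" s0] by simp
    qed
    have n1: "s \<noteq> 1" if "s \<in> ball s0 9" for s using in_ball(2)[OF that] by auto
    have holo: "zeta holomorphic_on ball s0 9"
      by (rule holomorphic_on_subset[OF zeta_holomorphic]) (use n1 in auto)
    have z0: "norm (zeta s0) \<ge> 1 / 4" by (rule zeta_lower_bound) (simp add: s0)
    have bd: "norm (zeta s) \<le> exp M * norm (zeta s0)" if s: "s \<in> ball s0 9" for s
    proof -
      have "1 \<le> \<bar>Im (s - 1)\<bar>" using in_ball(2)[OF s] by simp
      also have "\<dots> \<le> norm (s - 1)" by (rule abs_Im_le_cmod)
      finally have "norm (zeta s) * 1 \<le> norm (zeta s) * norm (s - 1)" by (intro mult_left_mono) auto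
      also have "\<dots> = norm (zeta_reg s)" using n1[OF s] by (simp add: zeta_reg_def norm_mult)
      also have "\<dots> \<le> C0 * (1 + norm s) ^ A" using in_ball(1)[OF s] by (intro gr) simp
      also have "\<dots> \<le> (C0 + 1) * (3 * T) ^ A"
        using in_ball(3)[OF s] T C0 by (intro mult_mono power_mono) auto
      also have "\<dots> = exp M * (1 / 4)" unfolding eM by simp
      also have "\<dots> \<le> exp M * norm (zeta s0)" using z0 by (intro mult_left_mono) auto
      finally show ?thesis by simp
    qed
    have z0': "zeta s0 \<noteq> 0" using z0 by auto
    note L = zero_count_and_logderiv_bound[where f = zeta and \<xi> = s0 and R = 9 and M = M and
        ra = "5 / 2" and rb = 3 and rc = "7 / 2" and Q = 8, OF holo z0' _ _ _ _ _ bd, folded zero_mult_def]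
    have fin: "finite Z" unfolding Z by (rule L(1)) auto
    have "real (\<Sum>\<rho>\<in>Z. zero_mult \<rho>) * ln (9 / 7) \<le> M" unfolding Z using L(2) by simp
    hence "real (\<Sum>\<rho>\<in>Z. zero_mult \<rho>) \<le> M / ln (9 / 7)" using l97 by (simp add: pos_le_divide_eq)
    also have "\<dots> \<le> (D * ln T) / ln (9 / 7)" using MD l97 by (intro divide_right_mono) auto
    also have "\<dots> = D / ln (9 / 7) * ln T" by simp
    also have "\<dots> \<le> C * ln T" using C(2) l1 by (intro mult_right_mono) auto
    finally have cnt: "real (\<Sum>\<rho>\<in>Z. zero_mult \<rho>) \<le> C * ln T" .
    have ld: "norm (deriv zeta s / zeta s - (\<Sum>\<rho>\<in>Z. of_nat (zero_mult \<rho>) / (s - \<rho>))) \<le> C * ln T"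
      if "s \<in> cball s0 (5 / 2)" "zeta s \<noteq> 0" for s
    proof -
      have "norm (deriv zeta s / zeta s - (\<Sum>\<rho>\<in>Z. of_nat (zero_mult \<rho>) / (s - \<rho>))) \<le> 2 * 3 / ((7 / 2 - 3) * (3 - 5 / 2)) * (M + 1)"
        unfolding Z by (rule L(3)) (use that in auto)
      also have "\<dots> = 24 * (M + 1)" by simp
      also have "\<dots> \<le> 24 * (D * ln T)" using MD by simp
      also have "\<dots> = 24 * D * ln T" by simp
      also have "\<dots> \<le> C * ln T" using C(3) l1 by (intro mult_right_mono) auto
      finally show ?thesis .
    qed
    show ?thesis using fin cnt ld by blast
  qed
  thus ?thesis using C(1) unfolding Let_def by blast
qed

text \<open>Pigeonhole: if \<open>N\<close> zeros lie in the disc, take \<open>N + 1\<close> equally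
  spaced heights in \<open>{T..T+1}\<close> and let \<open>\<delta>\<close> be half their spacing.
  If each had a zero closer than \<open>\<delta>\<close>, these zeros would be distinct, and by the
  Riemann Hypothesis all of them would lie in the disc. As \<open>N\<close> is at most a multiple of
  \<open>ln T\<close>, so is \<open>1 / \<delta>\<close>.\<close>

lemma good_height:
  assumes RH: "Riemann_Hypothesis"
  shows "\<exists>C>0. \<forall>T\<ge>10. \<exists>T'\<in>{T..T+1}. \<forall>\<rho>. zeta \<rho> = 0 \<longrightarrow> Im \<rho> > 0 \<longrightarrow> \<bar>Im \<rho> - T'\<bar> \<ge> 1 / (C * ln T)"
proof -
  obtain C where C: "C > 0" and loc: "\<And>T. T \<ge> 10 \<Longrightarrow> let s0 = Complex 2 T; Z = {z\<in>cball s0 (7 / 2). zeta z = 0} in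
     finite Z \<and> real (\<Sum>\<rho>\<in>Z. zero_mult \<rho>) \<le> C * ln T \<and>
     (\<forall>s\<in>cball s0 (5 / 2). zeta s \<noteq> 0 \<longrightarrow>
        norm (deriv zeta s / zeta s - (\<Sum>\<rho>\<in>Z. of_nat (zero_mult \<rho>) / (s - \<rho>))) \<le> C * ln T)"
    using zeta_local by blast
  have "\<exists>T'\<in>{T..T+1}. \<forall>\<rho>. zeta \<rho> = 0 \<longrightarrow> Im \<rho> > 0 \<longrightarrow> \<bar>Im \<rho> - T'\<bar> \<ge> 1 / ((4 * C + 2) * ln T)" if T: "T \<ge> 10" for T
  proof (rule ccontr)
    assume neg: "\<not> ?thesis"
    define Z where "Z = {z\<in>cball (Complex 2 (T + 1 / 2)) (7 / 2). zeta z = 0}"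
    have T2: "T + 1 / 2 \<ge> 10" using T by simp
    have Z: "finite Z" "real (\<Sum>\<rho>\<in>Z. zero_mult \<rho>) \<le> C * ln (T + 1 / 2)"
      using loc[OF T2] unfolding Let_def Z_def by blast+
    define N where "N = card Z"
    define \<delta> where "\<delta> = 1 / (2 * (real N + 1))"
    have l1: "ln T \<ge> 1" using T by (rule ln_ge_1)
    have "real N \<le> real (\<Sum>\<rho>\<in>Z. zero_mult \<rho>)"
    proof -
      have "(\<Sum>\<rho>\<in>Z. 1) \<le> (\<Sum>\<rho>\<in>Z. zero_mult \<rho>)"
      proof (intro sum_mono zero_mult_pos)
        fix \<rho> assume r: "\<rho> \<in> Z"
        thus "zeta \<rho> = 0" by (simp add: Z_def)
        have "norm (\<rho> - Complex 2 (T + 1 / 2)) \<le> 7 / 2" using r by (simp add: Z_def dist_norm norm_minus_commute)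
        hence "Im \<rho> \<noteq> 0" using abs_Im_le_cmod[of "\<rho> - Complex 2 (T + 1 / 2)"] T by auto
        thus "\<rho> \<noteq> 1" by auto
      qed
      thus ?thesis unfolding N_def by (simp flip: of_nat_sum)
    qed
    also have "\<dots> \<le> C * ln (T + 1 / 2)" by (rule Z(2))
    also have "ln (T + 1 / 2) \<le> ln (T * T)" using T mult_mono[of 10 T 10 T] by (subst ln_le_cancel_iff) (auto intro: order_trans[of _ "10 * T"])
    also have "ln (T * T) = 2 * ln T" using T by (simp add: ln_mult)
    finally have "real N \<le> 2 * C * ln T" using C by simp
    hence "2 * (real N + 1) \<le> (4 * C + 2) * ln T" using l1 by (simp add: algebra_simps)
    hence \<delta>: "1 / ((4 * C + 2) * ln T) \<le> \<delta>" "\<delta> > 0" unfolding \<delta>_def by (auto intro!: frac_le)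
    define p where "p = (\<lambda>j::nat. T + real j / (real N + 1))"
    have "\<exists>\<rho>. zeta \<rho> = 0 \<and> Im \<rho> > 0 \<and> \<bar>Im \<rho> - p j\<bar> < \<delta>" if j: "j \<le> N" for j
    proof -
      have "p j \<in> {T..T+1}" using j by (auto simp: p_def field_simps)
      thus ?thesis using neg \<delta> by force
    qed
    then obtain r where r: "\<And>j. j \<le> N \<Longrightarrow> zeta (r j) = 0 \<and> Im (r j) > 0 \<and> \<bar>Im (r j) - p j\<bar> < \<delta>" by metis
    have d1: "\<delta> \<le> 1 / 2" unfolding \<delta>_def by (simp add: field_simps)
    have rZ: "r j \<in> Z" if j: "j \<le> N" for j
    proof -
      have "p j \<in> {T..T+1}" using j by (auto simp: p_def field_simps)
      hence "\<bar>Im (r j) - (T + 1 / 2)\<bar> \<le> 1" using r[OF j] d1 by auto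
      moreover have "Re (r j) = 1 / 2" using upper_zero_Re[OF RH] r[OF j] by blast
      ultimately have "norm (r j - Complex 2 (T + 1 / 2)) \<le> 7 / 2"
        using cmod_le[of "r j - Complex 2 (T + 1 / 2)"] by simp
      thus ?thesis using r[OF j] by (simp add: Z_def dist_norm norm_minus_commute)
    qed
    have "inj_on r {..N}"
    proof (rule inj_onI)
      fix i j assume ij: "i \<in> {..N}" "j \<in> {..N}" "r i = r j"
      hence "\<bar>p i - p j\<bar> < 2 * \<delta>" using r[of i] r[of j] by auto
      moreover have "p i - p j = (real i - real j) / (real N + 1)" by (simp add: p_def diff_divide_distrib)
      moreover have "2 * \<delta> = 1 / (real N + 1)" by (simp add: \<delta>_def field_simps)
      ultimately have "\<bar>real i - real j\<bar> / (real N + 1) < 1 / (real N + 1)" by (simp add: abs_divide)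
      hence "\<bar>real i - real j\<bar> < 1" by (simp add: divide_less_cancel)
      thus "i = j" by linarith
    qed
    hence "card {..N} \<le> card Z" using rZ Z(1) by (intro card_inj_on_le[of r]) auto
    thus False by (simp add: N_def)
  qed
  moreover have "4 * C + 2 > 0" using C by simp
  ultimately show ?thesis by blast
qed

text \<open>The true size is logarithmic. A square root loses little enough: the horizontal edges
  may cost \<open>ln T * sqrt (ln T)\<close>.\<close>

lemma arsinh_le_sqrt:
  fixes v :: real
  assumes "v \<ge> 0"
  shows "arsinh v \<le> 2 * sqrt (1 + 2 * v)"
proof -
  have "sqrt (v\<^sup>2 + 1) \<le> v + 1" by (rule real_le_lsqrt) (use assms in \<open>auto simp: power2_eq_square algebra_simps\<close>)
  hence "arsinh v \<le> ln (1 + 2 * v)"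
    unfolding arsinh_real_def using assms by (subst ln_le_cancel_iff) (auto intro!: add_nonneg_pos)
  also have "\<dots> = 2 * ln (sqrt (1 + 2 * v))" using assms by (simp add: ln_sqrt)
  also have "\<dots> \<le> 2 * sqrt (1 + 2 * v)" using assms ln_bound[of "sqrt (1 + 2 * v)"] by simp
  finally show ?thesis .
qed

text \<open>On a horizontal line at distance \<open>\<delta>\<close> from all zeros, each zero costs
  \<open>\<integral> 1 / sqrt (x\<^sup>2 + \<delta>\<^sup>2) dx\<close>, hence an inverse hyperbolic sine.\<close>

lemma horizontal_bound:
  assumes RH: "Riemann_Hypothesis" and C1: "C1 > 0"
  shows "\<exists>C>0. \<forall>T T' c y. T \<ge> 10 \<longrightarrow> T' \<in> {T..T+1} \<longrightarrow>
     (\<forall>\<rho>. zeta \<rho> = 0 \<longrightarrow> Im \<rho> > 0 \<longrightarrow> \<bar>Im \<rho> - T'\<bar> \<ge> 1 / (C1 * ln T)) \<longrightarrow> 1 < c \<longrightarrow> c \<le> 11 / 10 \<longrightarrow> y \<ge> 1 \<longrightarrow>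
     norm (contour_integral (linepath (Complex (1 - c) T') (Complex c T'))
       (\<lambda>s. deriv zeta s * of_real y powr s / zeta s)) \<le> C * (y powr c * (ln T * sqrt (ln T)))"
proof -
  obtain C where C: "C > 0" and loc: "\<And>T. T \<ge> 10 \<Longrightarrow> let s0 = Complex 2 T; Z = {z\<in>cball s0 (7 / 2). zeta z = 0} in
     finite Z \<and> real (\<Sum>\<rho>\<in>Z. zero_mult \<rho>) \<le> C * ln T \<and>
     (\<forall>s\<in>cball s0 (5 / 2). zeta s \<noteq> 0 \<longrightarrow>
        norm (deriv zeta s / zeta s - (\<Sum>\<rho>\<in>Z. of_nat (zero_mult \<rho>) / (s - \<rho>))) \<le> C * ln T)"
    using zeta_local by blast
  define E where "E = 2 * C * (2 + 8 * sqrt (1 + 2 * C1))"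
  have E: "E > 0" using C C1 by (auto simp: E_def intro!: mult_pos_pos add_pos_nonneg)
  have "norm (contour_integral (linepath (Complex (1 - c) T') (Complex c T'))
       (\<lambda>s. deriv zeta s * of_real y powr s / zeta s)) \<le> E * (y powr c * (ln T * sqrt (ln T)))"
    if T: "T \<ge> 10" and T': "T' \<in> {T..T+1}" and gap: "\<And>\<rho>. zeta \<rho> = 0 \<Longrightarrow> Im \<rho> > 0 \<Longrightarrow> \<bar>Im \<rho> - T'\<bar> \<ge> 1 / (C1 * ln T)"
      and c: "1 < c" "c \<le> 11 / 10" and y: "y \<ge> 1" for T T' c y
  proof -
    define Z where "Z = {z\<in>cball (Complex 2 T') (7 / 2). zeta z = 0}"
    define N where "N = real (\<Sum>\<rho>\<in>Z. zero_mult \<rho>)"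
    have T'10: "T' \<ge> 10" using T T' by simp
    have l1: "ln T \<ge> 1" using T by (rule ln_ge_1)
    have "10 * T \<le> T * T" using T by (intro mult_right_mono) auto
    moreover have "T' \<le> T + 1" using T' by simp
    ultimately have "T' \<le> T * T" using T by linarith
    hence "ln T' \<le> ln (T * T)" using T'10 by (subst ln_le_cancel_iff) auto
    hence lT': "ln T' \<le> 2 * ln T" using T by (simp add: ln_mult)
    have Z: "finite Z" "N \<le> C * ln T'"
      "\<And>s. s \<in> cball (Complex 2 T') (5 / 2) \<Longrightarrow> zeta s \<noteq> 0 \<Longrightarrow>
        norm (deriv zeta s / zeta s - (\<Sum>\<rho>\<in>Z. of_nat (zero_mult \<rho>) / (s - \<rho>))) \<le> C * ln T'"
      using loc[OF T'10] unfolding Let_def Z_def N_def by blast+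
    have "C * ln T' \<le> C * (2 * ln T)" using lT' C by simp
    hence K: "C * ln T' \<le> 2 * C * ln T" "N \<le> 2 * C * ln T" using Z(2) by auto
    define \<delta> where "\<delta> = 1 / (C1 * ln T)"
    have \<delta>: "\<delta> > 0" using C1 l1 by (simp add: \<delta>_def)
    have Zr: "Re \<rho> = 1 / 2" "\<bar>T' - Im \<rho>\<bar> \<ge> \<delta>" if "\<rho> \<in> Z" for \<rho>
    proof -
      have "norm (\<rho> - Complex 2 T') \<le> 7 / 2" using that by (simp add: Z_def dist_norm norm_minus_commute)
      hence "Im \<rho> > 0" using abs_Im_le_cmod[of "\<rho> - Complex 2 T'"] T'10 by auto
      moreover have "zeta \<rho> = 0" using that by (simp add: Z_def)
      ultimately show "Re \<rho> = 1 / 2" "\<bar>T' - Im \<rho>\<bar> \<ge> \<delta>" using upper_zero_Re[OF RH] gap[of \<rho>] by (auto simp: \<delta>_def abs_minus_commute)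
    qed
    have nz: "zeta (Complex \<sigma> T') \<noteq> 0" for \<sigma> using gap[of "Complex \<sigma> T'"] \<delta> T'10 by (auto simp: \<delta>_def)
    have seg: "z = Complex (Re z) T'" if "z \<in> closed_segment (Complex (1 - c) T') (Complex c T')" for z
      using that by (simp add: closed_segment_same_Im complex_eq_iff)
    define \<phi> where "\<phi> = (\<lambda>\<sigma>. y powr c * (2 * C * ln T * \<sigma> + N * arsinh ((\<sigma> - 1 / 2) / \<delta>)))"
    define \<phi>' where "\<phi>' = (\<lambda>\<sigma>. y powr c * (2 * C * ln T + N * (1 / sqrt ((\<sigma> - 1 / 2)\<^sup>2 + \<delta>\<^sup>2))))"
    have "norm (contour_integral (linepath (Complex (1 - c) T') (Complex c T'))
       (\<lambda>s. deriv zeta s * of_real y powr s / zeta s)) \<le> \<phi> c - \<phi> (1 - c)"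
    proof (rule contour_integral_horizontal_bound[where \<phi>' = \<phi>'])
      let ?sg = "closed_segment (Complex (1 - c) T') (Complex c T')"
      have n1: "z \<noteq> 1" if "z \<in> ?sg" for z using seg[OF that] T'10 by (metis complex.sel(2) one_complex.sel(2) not_numeral_le_zero)
      have "zeta z \<noteq> 0" if "z \<in> ?sg" for z using seg[OF that] nz by metis
      moreover have "continuous_on ?sg zeta"
        by (intro holomorphic_on_imp_continuous_on holomorphic_on_subset[OF zeta_holomorphic]) (use n1 in auto)
      moreover have "deriv zeta holomorphic_on - {1}" by (intro holomorphic_deriv zeta_holomorphic) auto
      hence "continuous_on ?sg (deriv zeta)"
        by (intro holomorphic_on_imp_continuous_on) (erule holomorphic_on_subset, use n1 in auto)
      moreover have "continuous_on ?sg (\<lambda>s. of_real y powr s)"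
        using y by (intro holomorphic_on_imp_continuous_on holomorphic_intros) auto
      ultimately show "continuous_on ?sg (\<lambda>s. deriv zeta s * of_real y powr s / zeta s)"
        by (intro continuous_on_mult continuous_on_divide) auto
      show "1 - c \<le> c" using c by simp
      fix \<sigma> assume \<sigma>: "\<sigma> \<in> {1 - c..c}"
      let ?s = "Complex \<sigma> T'"
      have sq: "(\<sigma> - 1 / 2)\<^sup>2 + \<delta>\<^sup>2 > 0" using \<delta> by (simp add: add_nonneg_pos)
      \<comment> \<open>Since \<open>c \<le> 11 / 10\<close>, the edge starts at real part at least
        \<open>-1 / 10\<close>, inside the disc of radius \<open>5 / 2\<close> where the expansion
        over the zeros is valid.\<close>
      have "norm (?s - Complex 2 T') = \<bar>\<sigma> - 2\<bar>" by (simp add: cmod_def)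
      also have "\<dots> \<le> 5 / 2" using \<sigma> c by auto
      finally have "?s \<in> cball (Complex 2 T') (5 / 2)" by (simp add: dist_norm norm_minus_commute)
      from Z(3)[OF this nz]
      have 1: "norm (deriv zeta ?s / zeta ?s - (\<Sum>\<rho>\<in>Z. of_nat (zero_mult \<rho>) / (?s - \<rho>))) \<le> 2 * C * ln T" using K(1) by linarith
      \<comment> \<open>All zeros in \<open>Z\<close> have real part \<open>1 / 2\<close> and
        vertical distance at least \<open>\<delta>\<close>, so one majorant serves all of them and
        only their number \<open>N\<close> enters.\<close>
      have "norm (\<Sum>\<rho>\<in>Z. of_nat (zero_mult \<rho>) / (?s - \<rho>)) \<le> (\<Sum>\<rho>\<in>Z. real (zero_mult \<rho>) * (1 / sqrt ((\<sigma> - 1 / 2)\<^sup>2 + \<delta>\<^sup>2)))"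
      proof (rule sum_norm_le)
        fix \<rho> assume "\<rho> \<in> Z"
        note Zr = Zr[OF this]
        have "\<delta>\<^sup>2 \<le> \<bar>T' - Im \<rho>\<bar>\<^sup>2" using Zr(2) \<delta> by (intro power_mono) auto
        hence "sqrt ((\<sigma> - 1 / 2)\<^sup>2 + \<delta>\<^sup>2) \<le> norm (?s - \<rho>)" 
          unfolding cmod_def minus_complex.sel complex.sel Zr(1) by (intro real_sqrt_le_mono add_mono) auto
        hence "1 / norm (?s - \<rho>) \<le> 1 / sqrt ((\<sigma> - 1 / 2)\<^sup>2 + \<delta>\<^sup>2)"
          using sq by (intro divide_left_mono mult_pos_pos) (auto intro: less_le_trans[of _ "sqrt ((\<sigma> - 1 / 2)\<^sup>2 + \<delta>\<^sup>2)"])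
        hence "real (zero_mult \<rho>) * (1 / norm (?s - \<rho>)) \<le> real (zero_mult \<rho>) * (1 / sqrt ((\<sigma> - 1 / 2)\<^sup>2 + \<delta>\<^sup>2))"
          by (intro mult_left_mono) auto
        thus "norm (of_nat (zero_mult \<rho>) / (?s - \<rho>)) \<le> real (zero_mult \<rho>) * (1 / sqrt ((\<sigma> - 1 / 2)\<^sup>2 + \<delta>\<^sup>2))"
          by (simp add: norm_divide)
      qed
      also have "\<dots> = N * (1 / sqrt ((\<sigma> - 1 / 2)\<^sup>2 + \<delta>\<^sup>2))" unfolding N_def of_nat_sum sum_distrib_right ..
      finally have 2: "norm (deriv zeta ?s / zeta ?s) \<le> 2 * C * ln T + N * (1 / sqrt ((\<sigma> - 1 / 2)\<^sup>2 + \<delta>\<^sup>2))"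
        using 1 norm_triangle_ineq2[of "deriv zeta ?s / zeta ?s" "\<Sum>\<rho>\<in>Z. of_nat (zero_mult \<rho>) / (?s - \<rho>)"] by linarith
      have "norm (deriv zeta ?s * of_real y powr ?s / zeta ?s) = norm (of_real y powr ?s :: complex) * norm (deriv zeta ?s / zeta ?s)"
        by (simp add: norm_mult norm_divide)
      also have "norm (of_real y powr ?s :: complex) = y powr \<sigma>" using y by (subst norm_powr_real_powr) auto
      also have "y powr \<sigma> * norm (deriv zeta ?s / zeta ?s) \<le> \<phi>' \<sigma>"
        unfolding \<phi>'_def using \<sigma> y by (intro mult_mono 2 powr_mono) auto
      finally show "norm (deriv zeta ?s * of_real y powr ?s / zeta ?s) \<le> \<phi>' \<sigma>" .
      have "((\<lambda>\<sigma>. arsinh ((\<sigma> - 1 / 2) / \<delta>)) has_real_derivative (1 / sqrt (((\<sigma> - 1 / 2) / \<delta>)\<^sup>2 + 1)) * (1 / \<delta>)) (at \<sigma>)"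
        by (rule DERIV_chain2[OF arsinh_real_has_field_derivative]) (use \<delta> in \<open>auto intro!: derivative_eq_intros\<close>)
      also have "(1 / sqrt (((\<sigma> - 1 / 2) / \<delta>)\<^sup>2 + 1)) * (1 / \<delta>) = 1 / sqrt ((\<sigma> - 1 / 2)\<^sup>2 + \<delta>\<^sup>2)"
      proof -
        have "(\<sigma> - 1 / 2)\<^sup>2 + \<delta>\<^sup>2 = \<delta>\<^sup>2 * (((\<sigma> - 1 / 2) / \<delta>)\<^sup>2 + 1)" using \<delta> by (simp add: power_divide distrib_left)
        hence "sqrt ((\<sigma> - 1 / 2)\<^sup>2 + \<delta>\<^sup>2) = \<delta> * sqrt (((\<sigma> - 1 / 2) / \<delta>)\<^sup>2 + 1)" using \<delta> by (simp add: real_sqrt_mult)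
        thus ?thesis by simp
      qed
      finally show "(\<phi> has_real_derivative \<phi>' \<sigma>) (at \<sigma>)" unfolding \<phi>_def \<phi>'_def
        by (intro DERIV_cmult DERIV_add) (auto intro!: derivative_eq_intros)
    qed
    also have "\<phi> c - \<phi> (1 - c) = y powr c * (2 * C * ln T * (2 * c - 1) + N * (arsinh ((c - 1 / 2) / \<delta>) - arsinh (- ((c - 1 / 2) / \<delta>))))"
      by (simp add: \<phi>_def algebra_simps diff_divide_distrib)
    also have "arsinh ((c - 1 / 2) / \<delta>) - arsinh (- ((c - 1 / 2) / \<delta>)) = 2 * arsinh ((c - 1 / 2) / \<delta>)" by (simp only: arsinh_minus_real)
    \<comment> \<open>The argument of the inverse hyperbolic sine is at most
      \<open>C1 * ln T\<close>, so its value is at most a multiple of \<open>sqrt (ln T)\<close>;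
      the factor \<open>N\<close> contributes \<open>ln T\<close>.\<close>
    also have "y powr c * (2 * C * ln T * (2 * c - 1) + N * (2 * arsinh ((c - 1 / 2) / \<delta>))) \<le> E * (y powr c * (ln T * sqrt (ln T)))"
    proof -
      have s1: "sqrt (ln T) \<ge> 1" using l1 by simp
      have "(c - 1 / 2) / \<delta> = (c - 1 / 2) * (C1 * ln T)" by (simp add: \<delta>_def)
      also have "\<dots> \<le> 1 * (C1 * ln T)" using c C1 l1 by (intro mult_right_mono) auto
      finally have v: "(c - 1 / 2) / \<delta> \<le> C1 * ln T" by simp
      have "arsinh ((c - 1 / 2) / \<delta>) \<le> 2 * sqrt (1 + 2 * ((c - 1 / 2) / \<delta>))" using c \<delta> by (intro arsinh_le_sqrt) auto
      also have "1 + 2 * ((c - 1 / 2) / \<delta>) \<le> (1 + 2 * C1) * ln T"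
        unfolding distrib_right mult_1 mult.assoc using v l1 by linarith
      hence "2 * sqrt (1 + 2 * ((c - 1 / 2) / \<delta>)) \<le> 2 * sqrt ((1 + 2 * C1) * ln T)" by simp
      also have "\<dots> = 2 * (sqrt (1 + 2 * C1) * sqrt (ln T))" by (simp add: real_sqrt_mult)
      finally have a: "arsinh ((c - 1 / 2) / \<delta>) \<le> 2 * (sqrt (1 + 2 * C1) * sqrt (ln T))" .
      have "N * (2 * arsinh ((c - 1 / 2) / \<delta>)) \<le> (2 * C * ln T) * (2 * (2 * (sqrt (1 + 2 * C1) * sqrt (ln T))))"
      proof -
        have "(c - 1 / 2) / \<delta> > 0" using c \<delta> by simp
        hence "arsinh ((c - 1 / 2) / \<delta>) \<ge> 0" using arsinh_real_pos_iff less_imp_le by blast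
        thus ?thesis using K(2) a C l1 by (intro mult_mono) (auto simp: N_def)
      qed
      moreover have "2 * C * ln T * (2 * c - 1) \<le> 2 * C * ln T * (2 * sqrt (ln T))"
      proof (rule mult_left_mono)
        show "2 * c - 1 \<le> 2 * sqrt (ln T)" using c s1 by linarith
      qed (use C l1 in auto)
      ultimately have "2 * C * ln T * (2 * c - 1) + N * (2 * arsinh ((c - 1 / 2) / \<delta>)) \<le> 2 * C * ln T * (2 * sqrt (ln T)) + (2 * C * ln T) * (2 * (2 * (sqrt (1 + 2 * C1) * sqrt (ln T))))"
        by (rule add_mono[rotated])
      also have "\<dots> = 2 * C * (2 + 4 * sqrt (1 + 2 * C1)) * (ln T * sqrt (ln T))" by (simp add: algebra_simps)
      also have "\<dots> \<le> E * (ln T * sqrt (ln T))"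
        unfolding E_def using C C1 l1 by (intro mult_right_mono mult_left_mono) auto
      finally have "2 * C * ln T * (2 * c - 1) + N * (2 * arsinh ((c - 1 / 2) / \<delta>)) \<le> E * (ln T * sqrt (ln T))" .
      from mult_left_mono[OF this, of "y powr c"] show ?thesis by (simp add: mult_ac)
    qed
    finally show ?thesis .
  qed
  thus ?thesis using E by blast
qed

section \<open>The vertical edges\<close>

lemma contour_integral_linepath_suminf:
  fixes f :: "nat \<Rightarrow> complex \<Rightarrow> complex"
  assumes cont: "\<And>k. continuous_on (closed_segment a b) (f k)"
    and bd: "\<And>k z. z \<in> closed_segment a b \<Longrightarrow> norm (f k z) \<le> M k" and M: "summable M"
  shows "(\<lambda>k. contour_integral (linepath a b) (f k)) sums contour_integral (linepath a b) (\<lambda>z. \<Sum>k. f k z)"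
proof -
  have i: "f k contour_integrable_on linepath a b" for k
    by (rule contour_integrable_continuous_linepath[OF cont])
  have "((\<lambda>n. contour_integral (linepath a b) (\<lambda>z. \<Sum>k<n. f k z)) \<longlongrightarrow>
      contour_integral (linepath a b) (\<lambda>z. \<Sum>k. f k z)) sequentially"
  proof (rule contour_integral_uniform_limit(2))
    show "\<forall>\<^sub>F n in sequentially. (\<lambda>z. \<Sum>k<n. f k z) contour_integrable_on linepath a b"
      by (intro always_eventually allI contour_integrable_sum i) auto
    show "uniform_limit (path_image (linepath a b)) (\<lambda>n z. \<Sum>k<n. f k z) (\<lambda>z. \<Sum>k. f k z) sequentially"
      by (rule Weierstrass_m_test[OF _ M]) (use bd in auto)
    show "norm (vector_derivative (linepath a b) (at t)) \<le> norm (b - a)" for t by simp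
  qed auto
  moreover have "contour_integral (linepath a b) (\<lambda>z. \<Sum>k<n. f k z) = (\<Sum>k<n. contour_integral (linepath a b) (f k))" for n
    by (rule contour_integral_sum) (use i in auto)
  ultimately show ?thesis by (simp add: sums_def)
qed

text \<open>Only the end points of the primitive count, so the bound does not grow with the length
  of the edge. The price is \<open>1 / |l|\<close>, large when the frequency \<open>l\<close> is
  close to 0.\<close>

lemma contour_integral_vertical_exp:
  assumes "l \<noteq> 0"
  shows "norm (contour_integral (linepath (Complex \<sigma> T0) (Complex \<sigma> T1)) (\<lambda>z. w * exp (of_real l * z)))
           \<le> norm w * (2 * exp (l * \<sigma>) / \<bar>l\<bar>)"
proof -
  let ?F = "\<lambda>z. w * (exp (of_real l * z) / of_real l)"
  have "((\<lambda>z. w * exp (of_real l * z)) has_contour_integral (?F (pathfinish (linepath (Complex \<sigma> T0) (Complex \<sigma> T1))) - ?F (pathstart (linepath (Complex \<sigma> T0) (Complex \<sigma> T1)))))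
      (linepath (Complex \<sigma> T0) (Complex \<sigma> T1))"
    by (rule contour_integral_primitive[where S = UNIV]) (use assms in \<open>auto intro!: derivative_eq_intros\<close>)
  hence "contour_integral (linepath (Complex \<sigma> T0) (Complex \<sigma> T1)) (\<lambda>z. w * exp (of_real l * z)) = ?F (Complex \<sigma> T1) - ?F (Complex \<sigma> T0)"
    by (simp add: contour_integral_unique)
  also have "norm \<dots> \<le> norm (?F (Complex \<sigma> T1)) + norm (?F (Complex \<sigma> T0))" by (rule norm_triangle_ineq4)
  also have "\<dots> = norm w * (2 * exp (l * \<sigma>) / \<bar>l\<bar>)" by (simp add: norm_mult norm_divide)
  finally show ?thesis .
qed

lemma powr_exp_of_real: "y > 0 \<Longrightarrow> of_real y powr (z :: complex) = exp (of_real (ln y) * z)"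
  by (simp add: powr_def Ln_of_real mult.commute)

lemma closed_segment_vertical:
  "z \<in> closed_segment (Complex \<sigma> T0) (Complex \<sigma> T1) \<Longrightarrow> Re z = \<sigma>"
  "T0 \<le> T1 \<Longrightarrow> z \<in> closed_segment (Complex \<sigma> T0) (Complex \<sigma> T1) \<Longrightarrow> T0 \<le> Im z \<and> Im z \<le> T1"
  by (auto simp: closed_segment_same_Re closed_segment_eq_real_ivl)

lemma one_minus_inverse_le_ln:
  fixes x :: real
  assumes "x > 0"
  shows "1 - 1 / x \<le> ln x"
  using ln_le_minus_one[of "1 / x"] assms by (simp add: ln_div)

text \<open>The term of \<open>k\<close> oscillates with frequency \<open>ln (y / k)\<close>. For
  \<open>k = y\<close> the integrand is constant and gives the main term; writing this as a sum over
  \<open>{k. real k = y}\<close> makes it 0 when \<open>y\<close> is not an integer. For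
  \<open>k \<le> y / 2\<close> or \<open>k \<ge> 2 * y\<close> the frequency is at least
  \<open>ln 2\<close> in modulus, and the pole of \<open>zeta\<close> at 1 yields
  \<open>1 / (c - 1)\<close>. For the others it is at least \<open>|y - k| / (2 * y)\<close>, while
  \<open>(y / k) powr c \<le> 4\<close>, whence the factor \<open>16 * y\<close>.\<close>

lemma right_line_bound:
  "\<exists>C>0. \<forall>c y T0 T1. 1 < c \<longrightarrow> c \<le> 11 / 10 \<longrightarrow> 1 \<le> y \<longrightarrow>
     norm (contour_integral (linepath (Complex c T0) (Complex c T1)) (\<lambda>s. mangoldt_series s * of_real y powr s)
        - \<i> * of_real (T1 - T0) * of_real (\<Sum>k | real k = y. mangoldt k))
     \<le> C * (y powr c / (c - 1)) + 16 * y * (\<Sum>k | y / 2 < real k \<and> real k < 2 * y \<and> real k \<noteq> y. mangoldt k / \<bar>y - real k\<bar>)"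
proof -
  obtain C where C: "C > 0" and Cb: "\<And>\<sigma>. 1 < \<sigma> \<Longrightarrow> \<sigma> \<le> 2 \<Longrightarrow> (\<Sum>n. mangoldt n * real n powr (-\<sigma>)) \<le> C / (\<sigma> - 1)"
    using mangoldt_sum_bound by blast
  have l2: "ln (2::real) > 0" by simp
  have "norm (contour_integral (linepath (Complex c T0) (Complex c T1)) (\<lambda>s. mangoldt_series s * of_real y powr s)
        - \<i> * of_real (T1 - T0) * of_real (\<Sum>k | real k = y. mangoldt k))
     \<le> (2 / ln 2 * C) * (y powr c / (c - 1)) + 16 * y * (\<Sum>k | y / 2 < real k \<and> real k < 2 * y \<and> real k \<noteq> y. mangoldt k / \<bar>y - real k\<bar>)"
    if c: "1 < c" "c \<le> 11 / 10" and y: "1 \<le> y" for c y T0 T1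
  proof -
    let ?L = "linepath (Complex c T0) (Complex c T1)" and ?seg = "closed_segment (Complex c T0) (Complex c T1)"
    let ?E = "{k. real k = y}" and ?N = "{k. y / 2 < real k \<and> real k < 2 * y \<and> real k \<noteq> y}"
    define f where "f = (\<lambda>k z. mangoldt k * of_nat k powr (-z) * of_real y powr z :: complex)"
    define S where "S = (\<lambda>k. if k \<in> ?E then \<i> * of_real (T1 - T0) * mangoldt k else (0::complex))"
    define far where "far = (\<lambda>k. (2 / ln 2 * y powr c) * (mangoldt k * real k powr (-c)))"
    define near where "near = (\<lambda>k. if k \<in> ?N then 16 * y * (mangoldt k / \<bar>y - real k\<bar>) else (0::real))"
    have finE: "finite ?E" by (rule finite_subset[of _ "{nat \<lfloor>y\<rfloor>}"]) auto
    have finN: "finite ?N"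
      by (rule finite_subset[of _ "{..nat \<lceil>2 * y\<rceil>}"]) (auto, linarith)
    have fexp: "f k z = mangoldt k * exp (of_real (ln y - ln (real k)) * z)" for k z
    proof (cases "k = 0")
      case False
      have "of_nat k powr (-z) = exp (of_real (ln (real k)) * (-z))" using powr_exp_of_real[of "real k" "-z"] False by simp
      thus ?thesis using y unfolding f_def by (simp add: powr_exp_of_real left_diff_distrib exp_diff exp_minus field_simps)
    qed (simp add: f_def)
    have nf: "norm (f k z) = y powr c * (mangoldt k * real k powr (-c))" if "z \<in> ?seg" for k z
    proof -
      have "norm (of_real y powr z :: complex) = y powr c"
        using y closed_segment_vertical(1)[OF that] by (subst norm_powr_real_powr) auto
      thus ?thesis using norm_mangoldt_term[of k z] closed_segment_vertical(1)[OF that] y by (simp add: f_def norm_mult)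
    qed
    have sm: "summable (\<lambda>k. mangoldt k * real k powr (-c))" using c by (intro summable_mangoldt_powr)
    have "(\<lambda>k. contour_integral ?L (f k)) sums contour_integral ?L (\<lambda>z. \<Sum>k. f k z)"
    proof (rule contour_integral_linepath_suminf)
      show "continuous_on ?seg (f k)" for k unfolding fexp[abs_def] by (intro continuous_intros)
      show "norm (f k z) \<le> y powr c * (mangoldt k * real k powr (-c))" if "z \<in> ?seg" for k z using nf[OF that] by simp
      show "summable (\<lambda>k. y powr c * (mangoldt k * real k powr (-c)))" by (rule summable_mult[OF sm])
    qed
    also have "contour_integral ?L (\<lambda>z. \<Sum>k. f k z) = contour_integral ?L (\<lambda>s. mangoldt_series s * of_real y powr s)"
    proof (rule contour_integral_cong)
      fix z assume "z \<in> path_image ?L"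
      hence "Re z = c" using closed_segment_vertical(1) by simp
      hence "(\<lambda>k. f k z) sums (mangoldt_series z * of_real y powr z)"
        unfolding f_def using c by (intro sums_mult2 mangoldt_series_sums) auto
      thus "(\<Sum>k. f k z) = mangoldt_series z * of_real y powr z" by (rule sums_unique[symmetric])
    qed auto
    finally have 1: "(\<lambda>k. contour_integral ?L (f k)) sums contour_integral ?L (\<lambda>s. mangoldt_series s * of_real y powr s)" .
    have "S sums (\<Sum>k\<in>?E. \<i> * of_real (T1 - T0) * mangoldt k)"
      unfolding S_def by (rule sums_If_finite_set[OF finE])
    also have "(\<Sum>k\<in>?E. \<i> * of_real (T1 - T0) * mangoldt k) = \<i> * of_real (T1 - T0) * of_real (\<Sum>k\<in>?E. mangoldt k)"
      by (simp add: sum_distrib_left)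
    finally have 2: "S sums (\<i> * of_real (T1 - T0) * of_real (\<Sum>k\<in>?E. mangoldt k))" .
    have tm: "norm (contour_integral ?L (f k) - S k) \<le> far k + near k" for k
    proof -
      have fn: "far k \<ge> 0" "near k \<ge> 0" using y by (auto simp: far_def near_def mangoldt_nonneg)
      consider "k = 0" | "real k = y" | "k > 0" "real k \<noteq> y" by auto
      thus ?thesis
      proof cases
        case 1
        hence "f k = (\<lambda>_. 0)" by (auto simp: f_def)
        moreover have "S k = 0" using 1 y by (simp add: S_def)
        ultimately show ?thesis using fn by simp
      next
        case 2
        hence "f k = (\<lambda>_. mangoldt k)" unfolding fexp[abs_def] by simp
        moreover have "Complex c T1 - Complex c T0 = \<i> * of_real (T1 - T0)" by (simp add: complex_eq_iff)
        ultimately have "contour_integral ?L (f k) = S k"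
          using 2 by (simp add: S_def mult.commute)
        thus ?thesis using fn by simp
      next
        case 3
        define l where "l = ln y - ln (real k)"
        have l0: "l \<noteq> 0" using 3 y by (simp add: l_def)
        have el: "exp (l * c) = y powr c * real k powr (-c)"
          using 3 y by (simp add: l_def powr_def left_diff_distrib exp_diff exp_minus field_simps)
        have b: "norm (contour_integral ?L (f k) - S k) \<le> mangoldt k * (2 * exp (l * c) / \<bar>l\<bar>)"
          using contour_integral_vertical_exp[OF l0, of c T0 T1 "mangoldt k"] 3 unfolding fexp[abs_def] l_def[symmetric]
          by (simp add: S_def)
        show ?thesis
        proof (cases "k \<in> ?N")
          case False
          hence "2 * real k \<le> y \<or> 2 * y \<le> real k" using 3 by auto
          hence "\<bar>l\<bar> \<ge> ln 2"
          proof
            assume "2 * real k \<le> y"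
            hence "ln (2 * real k) \<le> ln y" using 3 y by (subst ln_le_cancel_iff) auto
            thus ?thesis using 3 by (simp add: ln_mult l_def)
          next
            assume "2 * y \<le> real k"
            hence "ln (2 * y) \<le> ln (real k)" using 3 y by (subst ln_le_cancel_iff) auto
            thus ?thesis using y by (simp add: ln_mult l_def)
          qed
          hence "mangoldt k * (2 * exp (l * c) / \<bar>l\<bar>) \<le> mangoldt k * (2 * exp (l * c) / ln 2)"
            using l0 by (intro mult_left_mono divide_left_mono mult_pos_pos) (auto simp: mangoldt_nonneg)
          also have "\<dots> = far k" unfolding el far_def by simp
          finally show ?thesis using b fn by linarith
        next
          case True
          hence k: "y / 2 < real k" "real k < 2 * y" "real k \<noteq> y" by auto
          \<comment> \<open>The inequality \<open>1 - 1 / u \<le> ln u\<close> is applied to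
            whichever of \<open>y / k\<close> and \<open>k / y\<close> exceeds 1; in the second case
            \<open>k < 2 * y\<close> bounds the denominator.\<close>
          have lb: "\<bar>y - real k\<bar> / (2 * y) \<le> \<bar>l\<bar>"
          proof (cases "real k < y")
            case True
            have "1 - 1 / (y / real k) \<le> ln (y / real k)" using y 3 by (intro one_minus_inverse_le_ln) auto
            hence "(y - real k) / y \<le> l" using y 3 by (simp add: l_def ln_div diff_divide_distrib)
            moreover have "(y - real k) / (2 * y) \<le> (y - real k) / y" using True y by (intro divide_left_mono) auto
            ultimately show ?thesis using True by simp
          next
            case False
            hence gt: "real k > y" using k by simp
            have "1 - 1 / (real k / y) \<le> ln (real k / y)" using y 3 by (intro one_minus_inverse_le_ln) auto
            hence "(real k - y) / real k \<le> - l" using y 3 by (simp add: l_def ln_div diff_divide_distrib)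
            moreover have "(real k - y) / (2 * y) \<le> (real k - y) / real k" using gt k y 3 by (intro divide_left_mono) auto
            ultimately show ?thesis using gt by simp
          qed
          have pos: "\<bar>y - real k\<bar> / (2 * y) > 0" using k y by simp
          have "y powr c * real k powr (-c) = (y / real k) powr c" using y 3 by (simp add: powr_divide powr_minus_divide)
          also have "\<dots> \<le> 2 powr c" using k y c 3 by (intro powr_mono2) (auto simp: field_simps)
          also have "\<dots> \<le> 2 powr 2" using c by (intro powr_mono) auto
          finally have e4: "exp (l * c) \<le> 4" unfolding el by simp
          have "mangoldt k * (2 * exp (l * c) / \<bar>l\<bar>) \<le> mangoldt k * (2 * 4 / (\<bar>y - real k\<bar> / (2 * y)))"
            using lb pos e4 by (intro mult_left_mono frac_le) (auto simp: mangoldt_nonneg)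
          also have "\<dots> = near k" using True by (simp add: near_def)
          finally show ?thesis using b fn by linarith
        qed
      qed
    qed
    have sfar: "far sums ((2 / ln 2 * y powr c) * (\<Sum>k. mangoldt k * real k powr (-c)))"
      unfolding far_def by (rule sums_mult[OF summable_sums[OF sm]])
    have snear: "near sums (\<Sum>k\<in>?N. 16 * y * (mangoldt k / \<bar>y - real k\<bar>))"
      unfolding near_def by (rule sums_If_finite_set[OF finN])
    note fs = sums_add[OF sfar snear]
    have "norm (contour_integral ?L (\<lambda>s. mangoldt_series s * of_real y powr s) - \<i> * of_real (T1 - T0) * of_real (\<Sum>k\<in>?E. mangoldt k))
       \<le> (\<Sum>k. far k + near k)"
      using norm_suminf_le[OF tm sums_summable[OF fs]] sums_unique[OF sums_diff[OF 1 2]] by simp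
    also have "\<dots> = (2 / ln 2 * y powr c) * (\<Sum>k. mangoldt k * real k powr (-c)) + (\<Sum>k\<in>?N. 16 * y * (mangoldt k / \<bar>y - real k\<bar>))"
      by (rule sums_unique[OF fs, symmetric])
    also have "(2 / ln 2 * y powr c) * (\<Sum>k. mangoldt k * real k powr (-c)) \<le> (2 / ln 2 * y powr c) * (C / (c - 1))"
      using c l2 by (intro mult_left_mono Cb) auto
    finally show ?thesis by (simp add: sum_distrib_left mult_ac)
  qed
  moreover have "2 / ln 2 * C > 0" using C l2 by simp
  ultimately show ?thesis by blast
qed

text \<open>After reflection the frequencies are \<open>ln y + ln k\<close>. They are at least
  \<open>ln 2\<close> for \<open>k \<ge> 2\<close>, and smaller \<open>k\<close> carry no weight, so
  nothing resonates. As \<open>y powr (1 - c) \<le> 1\<close>, the bound is free of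
  \<open>y\<close>.\<close>

lemma left_line_mangoldt_bound:
  "\<exists>C>0. \<forall>c y T0 T1. 1 < c \<longrightarrow> c \<le> 11 / 10 \<longrightarrow> 1 \<le> y \<longrightarrow>
     norm (contour_integral (linepath (Complex (1 - c) T0) (Complex (1 - c) T1)) (\<lambda>s. mangoldt_series (1 - s) * of_real y powr s))
     \<le> C / (c - 1)"
proof -
  obtain C where C: "C > 0" and Cb: "\<And>\<sigma>. 1 < \<sigma> \<Longrightarrow> \<sigma> \<le> 2 \<Longrightarrow> (\<Sum>n. mangoldt n * real n powr (-\<sigma>)) \<le> C / (\<sigma> - 1)"
    using mangoldt_sum_bound by blast
  have l2: "ln (2::real) > 0" by simp
  have "norm (contour_integral (linepath (Complex (1 - c) T0) (Complex (1 - c) T1)) (\<lambda>s. mangoldt_series (1 - s) * of_real y powr s))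
     \<le> (2 / ln 2 * C) / (c - 1)" if c: "1 < c" "c \<le> 11 / 10" and y: "1 \<le> y" for c y T0 T1
  proof -
    let ?L = "linepath (Complex (1 - c) T0) (Complex (1 - c) T1)" and ?seg = "closed_segment (Complex (1 - c) T0) (Complex (1 - c) T1)"
    define f where "f = (\<lambda>k z. mangoldt k * of_nat k powr (-(1 - z)) * of_real y powr z :: complex)"
    have fexp: "f k z = (mangoldt k / of_nat k) * exp (of_real (ln y + ln (real k)) * z)" for k z
    proof (cases "k = 0")
      case False
      have "of_nat k powr (-(1 - z)) = exp (of_real (ln (real k)) * (-(1 - z)))"
        using powr_exp_of_real[of "real k" "-(1 - z)"] False by simp
      also have "\<dots> = exp (of_real (ln (real k)) * z) / exp (of_real (ln (real k)))" by (simp add: algebra_simps exp_diff)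
      also have "exp (of_real (ln (real k))) = (of_nat k :: complex)" using False by (simp add: exp_of_real)
      finally show ?thesis using y unfolding f_def by (simp add: powr_exp_of_real distrib_right exp_add)
    qed (simp add: f_def)
    have nf: "norm (f k z) \<le> mangoldt k * real k powr (-c)" if "z \<in> ?seg" for k z
    proof -
      have "norm (of_real y powr z :: complex) = y powr (1 - c)"
        using y closed_segment_vertical(1)[OF that] by (subst norm_powr_real_powr) auto
      also have "\<dots> \<le> y powr 0" using y c by (intro powr_mono) auto
      finally have "norm (of_real y powr z :: complex) \<le> 1" using y by simp
      hence "norm (mangoldt k * of_nat k powr (-(1 - z)) :: complex) * norm (of_real y powr z :: complex) \<le>
          norm (mangoldt k * of_nat k powr (-(1 - z)) :: complex) * 1" by (intro mult_left_mono) auto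
      also have "norm (mangoldt k * of_nat k powr (-(1 - z)) :: complex) * 1 = mangoldt k * real k powr (-c)"
        unfolding norm_mangoldt_term using closed_segment_vertical(1)[OF that] by simp
      finally show ?thesis by (simp only: f_def norm_mult)
    qed
    have sm: "summable (\<lambda>k. mangoldt k * real k powr (-c))" using c by (intro summable_mangoldt_powr)
    have "(\<lambda>k. contour_integral ?L (f k)) sums contour_integral ?L (\<lambda>z. \<Sum>k. f k z)"
      by (rule contour_integral_linepath_suminf[OF _ nf sm], unfold fexp[abs_def])
         (intro continuous_on_mult continuous_on_const continuous_on_exp continuous_on_id)
    also have "contour_integral ?L (\<lambda>z. \<Sum>k. f k z) = contour_integral ?L (\<lambda>s. mangoldt_series (1 - s) * of_real y powr s)"
    proof (rule contour_integral_cong)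
      fix z assume "z \<in> path_image ?L"
      hence "Re z = 1 - c" using closed_segment_vertical(1) by simp
      hence "(\<lambda>k. f k z) sums (mangoldt_series (1 - z) * of_real y powr z)"
        unfolding f_def using c by (intro sums_mult2 mangoldt_series_sums) auto
      thus "(\<Sum>k. f k z) = mangoldt_series (1 - z) * of_real y powr z" by (rule sums_unique[symmetric])
    qed auto
    finally have 1: "(\<lambda>k. contour_integral ?L (f k)) sums contour_integral ?L (\<lambda>s. mangoldt_series (1 - s) * of_real y powr s)" .
    have tm: "norm (contour_integral ?L (f k)) \<le> 2 / ln 2 * (mangoldt k * real k powr (-c))" for k
    proof (cases "k \<ge> 2")
      case True
      define l where "l = ln y + ln (real k)"
      have "ln (real k) \<ge> ln 2" using True by (subst ln_le_cancel_iff) auto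
      moreover have "ln y \<ge> 0" using y by simp
      ultimately have l: "l \<ge> ln 2" "l > 0" using l2 unfolding l_def by linarith+
      have "norm (contour_integral ?L (f k)) \<le> norm (mangoldt k / of_nat k :: complex) * (2 * exp (l * (1 - c)) / \<bar>l\<bar>)"
        unfolding fexp[abs_def] l_def[symmetric] by (rule contour_integral_vertical_exp) (use l in auto)
      also have "\<dots> \<le> (mangoldt k / real k) * (2 * exp (ln (real k) * (1 - c)) / ln 2)"
        using l l2 c y True by (intro mult_mono frac_le) (auto simp: l_def norm_divide mangoldt_nonneg intro!: mult_right_mono_neg)
      also have "\<dots> = 2 / ln 2 * (mangoldt k * (exp (ln (real k) * (1 - c)) / real k))" by (simp add: mult_ac)
      also have "exp (ln (real k) * (1 - c)) / real k = real k powr (1 - c) / real k powr 1" using True by (simp add: powr_def mult.commute)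
      also have "\<dots> = real k powr (-c)" by (subst powr_diff[symmetric]) simp
      finally show ?thesis .
    next
      case False
      hence "k = 0 \<or> k = Suc 0" by linarith
      hence "f k = (\<lambda>_. 0)" by (auto simp: f_def)
      thus ?thesis using l2 by (simp add: mangoldt_nonneg)
    qed
    have "norm (contour_integral ?L (\<lambda>s. mangoldt_series (1 - s) * of_real y powr s)) \<le> (\<Sum>k. 2 / ln 2 * (mangoldt k * real k powr (-c)))"
      using norm_suminf_le[OF tm summable_mult[OF sm]] sums_unique[OF 1] by simp
    also have "\<dots> = 2 / ln 2 * (\<Sum>k. mangoldt k * real k powr (-c))" by (rule suminf_mult[OF sm])
    also have "\<dots> \<le> 2 / ln 2 * (C / (c - 1))" using c l2 by (intro mult_left_mono Cb) auto
    finally show ?thesis by simp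
  qed
  moreover have "2 / ln 2 * C > 0" using C l2 by simp
  ultimately show ?thesis by blast
qed

text \<open>Integration by parts against \<open>y\<^sup>s\<close>: the factor \<open>fe_logderiv\<close> varies slowly.\<close>

lemma left_line_gamma_bound:
  "\<exists>C>0. \<forall>c y T0 T1. 1 < c \<longrightarrow> c \<le> 11 / 10 \<longrightarrow> 1 < y \<longrightarrow> 1 \<le> T0 \<longrightarrow> T0 \<le> T1 \<longrightarrow> 10 \<le> T1 \<longrightarrow>
     norm (contour_integral (linepath (Complex (1 - c) T0) (Complex (1 - c) T1)) (\<lambda>s. fe_logderiv s * of_real y powr s))
     \<le> C * (ln T1 / ln y)"
proof -
  obtain K where K: "K > 0" and Kb: "\<And>\<sigma> t. - 1 / 2 \<le> \<sigma> \<Longrightarrow> \<sigma> \<le> 0 \<Longrightarrow> t \<ge> 1 \<Longrightarrow> norm (fe_logderiv (Complex \<sigma> t)) \<le> K + 20 * ln t"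
    using fe_logderiv_bound by blast
  have "norm (contour_integral (linepath (Complex (1 - c) T0) (Complex (1 - c) T1)) (\<lambda>s. fe_logderiv s * of_real y powr s))
     \<le> (2 * K + 60) * (ln T1 / ln y)" if c: "1 < c" "c \<le> 11 / 10" and y: "1 < y" and T: "1 \<le> T0" "T0 \<le> T1" "10 \<le> T1" for c y T0 T1
  proof -
    let ?L = "linepath (Complex (1 - c) T0) (Complex (1 - c) T1)" and ?seg = "closed_segment (Complex (1 - c) T0) (Complex (1 - c) T1)"
    let ?p = "\<lambda>s. of_real y powr s :: complex" and ?l = "of_real (ln y) :: complex"
    have ly: "ln y > 0" using y by simp
    have l1: "ln T1 \<ge> 1" using exp_le T by (subst ln_ge_iff) auto
    have np: "norm (?p (Complex (1 - c) t)) \<le> 1" for t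
    proof -
      have "norm (?p (Complex (1 - c) t)) = y powr (1 - c)" using y by (subst norm_powr_real_powr) auto
      also have "\<dots> \<le> y powr 0" using y c by (intro powr_mono) auto
      finally show ?thesis using y by simp
    qed
    have seg: "Im z \<ge> 1" "Re z = 1 - c" if "z \<in> ?seg" for z
      using closed_segment_vertical(1)[OF that] closed_segment_vertical(2)[OF T(2) that] T by auto
    have dp: "(?p has_field_derivative ?p z * ?l) (at z)" for z
      using y unfolding powr_exp_of_real[OF less_trans[OF zero_less_one y]] by (auto intro!: derivative_eq_intros)
    have cp: "continuous_on A ?p" for A by (intro continuous_at_imp_continuous_on ballI DERIV_isCont[OF dp])
    have c1: "continuous_on ?seg fe_logderiv"
      by (intro continuous_at_imp_continuous_on ballI DERIV_isCont[OF fe_logderiv_DERIV]) (use seg in force)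
    have hol: "fe_logderiv holomorphic_on {z. Im z > 0}"
      by (subst holomorphic_on_open[OF open_halfspace_Im_gt]) (use fe_logderiv_DERIV in auto)
    have dd: "deriv fe_logderiv z = fe_logderiv' z" if "Im z > 0" for z
      by (rule DERIV_imp_deriv[OF fe_logderiv_DERIV[OF that]])
    have "fe_logderiv' holomorphic_on {z. Im z > 0}"
      by (rule holomorphic_transform[OF holomorphic_deriv[OF hol open_halfspace_Im_gt]]) (simp add: dd)
    hence c2: "continuous_on ?seg fe_logderiv'"
      by (intro holomorphic_on_imp_continuous_on) (erule holomorphic_on_subset, use seg in force)
    have "((\<lambda>s. fe_logderiv s * ?p s + fe_logderiv' s * ?p s / ?l) has_contour_integral
        (fe_logderiv (pathfinish ?L) * ?p (pathfinish ?L) / ?l - fe_logderiv (pathstart ?L) * ?p (pathstart ?L) / ?l)) ?L"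
    proof (rule contour_integral_primitive[where S = "{z. Im z > 0}"])
      fix x :: complex assume "x \<in> {z. Im z > 0}"
      hence "(fe_logderiv has_field_derivative fe_logderiv' x) (at x)" by (intro fe_logderiv_DERIV) auto
      from DERIV_cdivide[OF DERIV_mult[OF this dp], of ?l]
      have "((\<lambda>s. fe_logderiv s * ?p s / ?l) has_field_derivative fe_logderiv s * ?p s + fe_logderiv' s * ?p s / ?l) (at s)" if "s = x" for s
        using ly that by (simp add: add_divide_distrib algebra_simps)
      thus "((\<lambda>s. fe_logderiv s * ?p s / ?l) has_field_derivative fe_logderiv x * ?p x + fe_logderiv' x * ?p x / ?l) (at x within {z. Im z > 0})"
        using DERIV_subset by blast
    qed (use seg in force)+
    hence "contour_integral ?L (\<lambda>s. fe_logderiv s * ?p s + fe_logderiv' s * ?p s / ?l) =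
        fe_logderiv (Complex (1 - c) T1) * ?p (Complex (1 - c) T1) / ?l - fe_logderiv (Complex (1 - c) T0) * ?p (Complex (1 - c) T0) / ?l"
      by (simp add: contour_integral_unique)
    moreover have "contour_integral ?L (\<lambda>s. fe_logderiv s * ?p s + fe_logderiv' s * ?p s / ?l) =
        contour_integral ?L (\<lambda>s. fe_logderiv s * ?p s) + contour_integral ?L (\<lambda>s. fe_logderiv' s * ?p s / ?l)"
      using ly by (intro contour_integral_add contour_integrable_continuous_linepath continuous_intros c1 c2 cp) auto
    ultimately have eq: "contour_integral ?L (\<lambda>s. fe_logderiv s * ?p s) =
       fe_logderiv (Complex (1 - c) T1) * ?p (Complex (1 - c) T1) / ?l - fe_logderiv (Complex (1 - c) T0) * ?p (Complex (1 - c) T0) / ?l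
       - contour_integral ?L (\<lambda>s. fe_logderiv' s * ?p s / ?l)" by (simp add: algebra_simps)
    have end_bd: "norm (fe_logderiv (Complex (1 - c) t) * ?p (Complex (1 - c) t) / ?l) \<le> (K + 20 * ln T1) / ln y" if t: "1 \<le> t" "t \<le> T1" for t
    proof -
      have "norm (fe_logderiv (Complex (1 - c) t)) * norm (?p (Complex (1 - c) t)) \<le> (K + 20 * ln t) * 1"
        using c t K np by (intro mult_mono Kb) auto
      also have "\<dots> \<le> K + 20 * ln T1" using t by simp
      finally show ?thesis using ly by (simp add: norm_mult norm_divide divide_right_mono)
    qed
    have "norm (contour_integral ?L (\<lambda>s. fe_logderiv' s * ?p s / ?l)) \<le> 20 * ln T1 / ln y - 20 * ln T0 / ln y"
    proof (rule contour_integral_vertical_bound[OF T(2), where \<phi> = "\<lambda>t. 20 * ln t / ln y" and \<phi>' = "\<lambda>t. 20 / t / ln y"])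
      show "continuous_on ?seg (\<lambda>s. fe_logderiv' s * ?p s / ?l)" using ly by (intro continuous_intros c2 cp) auto
      fix t assume t: "t \<in> {T0..T1}"
      have "norm (fe_logderiv' (Complex (1 - c) t)) * norm (?p (Complex (1 - c) t)) \<le> (20 / t) * 1"
        using norm_fe_logderiv'_le[of "Complex (1 - c) t"] c t T np by (intro mult_mono) auto
      from divide_right_mono[OF this, of "ln y"] ly
      show "norm (fe_logderiv' (Complex (1 - c) t) * ?p (Complex (1 - c) t) / ?l) \<le> 20 / t / ln y"
        by (simp add: norm_mult norm_divide)
      show "((\<lambda>t. 20 * ln t / ln y) has_real_derivative 20 / t / ln y) (at t)"
        using t T ly by (auto intro!: derivative_eq_intros)
    qed
    also have "\<dots> \<le> 20 * ln T1 / ln y" using T ly by simp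
    finally have "norm (contour_integral ?L (\<lambda>s. fe_logderiv s * ?p s)) \<le> (K + 20 * ln T1) / ln y + (K + 20 * ln T1) / ln y + 20 * ln T1 / ln y"
      unfolding eq using end_bd[of T1] end_bd[of T0] T
      by (intro order_trans[OF norm_triangle_ineq4] add_mono) auto
    also have "\<dots> = (2 * K + 60 * ln T1) / ln y" by (simp add: add_divide_distrib)
    also have "\<dots> \<le> ((2 * K + 60) * ln T1) / ln y"
      using ly K l1 by (intro divide_right_mono) (auto simp: distrib_right)
    finally show ?thesis by simp
  qed
  moreover have "2 * K + 60 > 0" using K by simp
  ultimately show ?thesis by blast
qed

section \<open>The Landau--Gonek formula\<close>

text \<open>Pays for the passage from the height of the contour, which is only known to lie in
  \<open>{T..T+1}\<close>, back to \<open>T\<close> itself.\<close>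

lemma window_zero_count:
  assumes RH: "Riemann_Hypothesis"
  shows "\<exists>C>0. \<forall>T\<ge>10. real (\<Sum>\<rho>\<in>zeros_upto (T + 1) - zeros_upto T. zero_mult \<rho>) \<le> C * ln T"
proof -
  obtain C where C: "C > 0" and loc: "\<And>T. T \<ge> 10 \<Longrightarrow> let s0 = Complex 2 T; Z = {z\<in>cball s0 (7 / 2). zeta z = 0} in
     finite Z \<and> real (\<Sum>\<rho>\<in>Z. zero_mult \<rho>) \<le> C * ln T \<and>
     (\<forall>s\<in>cball s0 (5 / 2). zeta s \<noteq> 0 \<longrightarrow>
        norm (deriv zeta s / zeta s - (\<Sum>\<rho>\<in>Z. of_nat (zero_mult \<rho>) / (s - \<rho>))) \<le> C * ln T)"
    using zeta_local by blast
  have "real (\<Sum>\<rho>\<in>zeros_upto (T + 1) - zeros_upto T. zero_mult \<rho>) \<le> C * ln T" if T: "T \<ge> 10" for T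
  proof -
    define Z where "Z = {z\<in>cball (Complex 2 T) (7 / 2). zeta z = 0}"
    have Z: "finite Z" "real (\<Sum>\<rho>\<in>Z. zero_mult \<rho>) \<le> C * ln T"
      using loc[OF T] unfolding Let_def Z_def by blast+
    have "zeros_upto (T + 1) - zeros_upto T \<subseteq> Z"
    proof
      fix \<rho> assume "\<rho> \<in> zeros_upto (T + 1) - zeros_upto T"
      hence r: "\<rho> \<in> nontrivial_zeros" "T < Im \<rho>" "Im \<rho> \<le> T + 1" by (auto simp: zeros_upto_def)
      hence "Re \<rho> = 1 / 2" using RH by (auto simp: Riemann_Hypothesis_def)
      hence "norm (\<rho> - Complex 2 T) \<le> 7 / 2"
        using cmod_le[of "\<rho> - Complex 2 T"] r by simp
      thus "\<rho> \<in> Z" using r by (simp add: Z_def dist_norm norm_minus_commute nontrivial_zeros_def)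
    qed
    hence "(\<Sum>\<rho>\<in>zeros_upto (T + 1) - zeros_upto T. zero_mult \<rho>) \<le> (\<Sum>\<rho>\<in>Z. zero_mult \<rho>)"
      by (intro sum_mono2 Z) auto
    hence "real (\<Sum>\<rho>\<in>zeros_upto (T + 1) - zeros_upto T. zero_mult \<rho>) \<le> real (\<Sum>\<rho>\<in>Z. zero_mult \<rho>)" by (rule of_nat_mono)
    thus ?thesis using Z(2) by linarith
  qed
  thus ?thesis using C by blast
qed

text \<open>The argument principle with weight \<open>y powr s\<close>. The right edge carries a
  minus because there the logarithmic derivative of \<open>zeta\<close> is
  \<open>- mangoldt_series\<close>; the top and left edges carry one because they are written
  against the orientation of the rectangle. Under the Riemann Hypothesis exactly the zeros between
  the two heights lie inside.\<close>

lemma zeros_contour_integral: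
  assumes T: "10 \<le> T0" "T0 < T1" and c: "1 < c" "c \<le> 11 / 10" and y: "1 < (y::real)"
    and free: "\<And>\<rho>. zeta \<rho> = 0 \<Longrightarrow> Im \<rho> > 0 \<Longrightarrow> Im \<rho> \<noteq> T0 \<and> Im \<rho> \<noteq> T1"
    and RH: "Riemann_Hypothesis"
  defines "F \<equiv> \<lambda>s. deriv zeta s * of_real y powr s / zeta s"
  shows "2 * pi * \<i> * (\<Sum>\<rho>\<in>zeros_upto T1 - zeros_upto T0. of_nat (zero_mult \<rho>) * of_real y powr \<rho>) =
     contour_integral (linepath (Complex (1 - c) T0) (Complex c T0)) F
     - contour_integral (linepath (Complex c T0) (Complex c T1)) (\<lambda>s. mangoldt_series s * of_real y powr s)
     - contour_integral (linepath (Complex (1 - c) T1) (Complex c T1)) F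
     - (contour_integral (linepath (Complex (1 - c) T0) (Complex (1 - c) T1)) (\<lambda>s. mangoldt_series (1 - s) * of_real y powr s)
        + contour_integral (linepath (Complex (1 - c) T0) (Complex (1 - c) T1)) (\<lambda>s. fe_logderiv s * of_real y powr s))"
proof -
  let ?a = "Complex (1 - c) T0" and ?b = "Complex c T1" and ?d = "Complex c T0" and ?e = "Complex (1 - c) T1"
  let ?R = "rectpath ?a ?b"
  \<comment> \<open>An open box around the closed rectangle; starting at height 5 it excludes the
    pole at 1.\<close>
  define S where "S = box (Complex (-1) 5) (Complex 3 (T1 + 1))"
  define pz where "pz = {w\<in>S. zeta w = 0}"
  have "Im w > 5" if "w \<in> S" for w using that by (simp add: S_def in_box_complex_iff)
  hence S1: "S \<subseteq> - {1}" by fastforce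
  have holo: "zeta holomorphic_on S" by (rule holomorphic_on_subset[OF zeta_holomorphic S1])
  have cboxS: "cbox ?a ?b \<subseteq> S" using T c by (auto simp: S_def in_box_complex_iff in_cbox_complex_iff)
  have img: "path_image ?R = cbox ?a ?b - box ?a ?b" using T c by (intro path_image_rectpath_cbox_minus_box) auto
  have fr: "zeta z \<noteq> 0" if "z \<in> path_image ?R" for z
  proof -
    have z: "Re z \<in> {1 - c, c} \<or> Im z \<in> {T0, T1}" "Im z \<ge> T0"
      using that T c by (subst (asm) path_image_rectpath; force)+
    consider "Re z = 1 - c" | "Re z = c" | "Im z = T0 \<or> Im z = T1" using z(1) by auto
    thus ?thesis
    proof cases
      case 1 thus ?thesis using z(2) T c by (intro zeta_left_nonzero) auto
    next
      case 2 thus ?thesis using c by (intro zeta_nonzero) auto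
    next
      case 3 thus ?thesis using free[of z] z(2) T by auto
    qed
  qed
  have finpz: "finite pz"
  proof (rule finite_subset)
    show "pz \<subseteq> {z\<in>cbox (Complex (-1) 5) (Complex 3 (T1 + 1)). zeta z = 0}"
      unfolding pz_def S_def using box_subset_cbox by blast
    show "finite {z\<in>cbox (Complex (-1) 5) (Complex 3 (T1 + 1)). zeta z = 0}"
    proof (rule holomorphic_compact_finite_zeros[OF zeta_holomorphic])
      show "connected (- {1::complex})" by (intro connected_punctured_universe) simp
      show "cbox (Complex (-1) 5) (Complex 3 (T1 + 1)) \<subseteq> - {1}" by (auto simp: in_cbox_complex_iff)
    qed (use zeta_not_constant in auto)
  qed
  have zorder: "zorder zeta p = int (zero_mult p)" if "p \<in> pz" for p
  proof -
    have "zero_mult p \<ge> 1" using that S1 by (intro zero_mult_pos) (auto simp: pz_def)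
    thus ?thesis by (simp add: zero_mult_def)
  qed
  \<comment> \<open>The clause \<open>w \<in> {}\<close> is the set of poles in the form that
    \<open>argument_principle\<close> expects: there are none in \<open>S\<close>.\<close>
  have "contour_integral ?R F = 2 * pi * \<i> * (\<Sum>p\<in>{w\<in>S. zeta w = 0 \<or> w \<in> {}}. winding_number ?R p * of_real y powr p * of_int (zorder zeta p))"
    unfolding F_def
  proof (rule argument_principle)
    show "open S" "connected S" unfolding S_def by (auto intro: convex_connected)
    show "(\<lambda>s. of_real y powr s) holomorphic_on S" using y by (intro holomorphic_intros) auto
    show "path_image ?R \<subseteq> S - {w \<in> S. zeta w = 0 \<or> w \<in> {}}" using img cboxS fr by auto
    show "\<forall>z. z \<notin> S \<longrightarrow> winding_number ?R z = 0"
      using cboxS T c by (auto intro!: winding_number_rectpath_outside)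
    show "finite {w \<in> S. zeta w = 0 \<or> w \<in> {}}" using finpz by (simp add: pz_def)
  qed (use holo in auto)
  also have "(\<Sum>p\<in>{w\<in>S. zeta w = 0 \<or> w \<in> {}}. winding_number ?R p * of_real y powr p * of_int (zorder zeta p)) =
     (\<Sum>p\<in>zeros_upto T1 - zeros_upto T0. of_nat (zero_mult p) * of_real y powr p)"
  proof (rule sum.mono_neutral_cong_right)
    show "finite {w \<in> S. zeta w = 0 \<or> w \<in> {}}" using finpz by (simp add: pz_def)
    have zs: "p \<in> box ?a ?b \<and> zeta p = 0" if "p \<in> zeros_upto T1 - zeros_upto T0" for p
    proof -
      from that have p: "p \<in> nontrivial_zeros" "T0 < Im p" "Im p \<le> T1" using T by (auto simp: zeros_upto_def)
      moreover from p have "Re p = 1 / 2" "zeta p = 0" using RH by (auto simp: Riemann_Hypothesis_def nontrivial_zeros_def)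
      moreover have "Im p \<noteq> T1" using free[of p] calculation T by auto
      ultimately show ?thesis using c by (auto simp: in_box_complex_iff)
    qed
    show "zeros_upto T1 - zeros_upto T0 \<subseteq> {w \<in> S. zeta w = 0 \<or> w \<in> {}}"
      using zs cboxS box_subset_cbox by blast
    show "\<forall>p\<in>{w \<in> S. zeta w = 0 \<or> w \<in> {}} - (zeros_upto T1 - zeros_upto T0).
       winding_number ?R p * of_real y powr p * of_int (zorder zeta p) = 0"
    proof
      fix p assume p: "p \<in> {w \<in> S. zeta w = 0 \<or> w \<in> {}} - (zeros_upto T1 - zeros_upto T0)"
      hence "p \<notin> path_image ?R" using fr by auto
      moreover have "p \<notin> box ?a ?b"
      proof
        assume "p \<in> box ?a ?b"
        hence "T0 < Im p" "Im p < T1" by (auto simp: in_box_complex_iff)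
        hence "p \<in> zeros_upto T1 - zeros_upto T0"
          using p T upper_zero_nontrivial[of p] by (auto simp: zeros_upto_def)
        thus False using p by blast
      qed
      ultimately have "p \<notin> cbox ?a ?b" using img by blast
      hence "winding_number ?R p = 0" using T c by (intro winding_number_rectpath_outside) auto
      thus "winding_number ?R p * of_real y powr p * of_int (zorder zeta p) = 0" by simp
    qed
    fix p assume p: "p \<in> zeros_upto T1 - zeros_upto T0"
    have "winding_number ?R p = 1" using zs[OF p] by (intro winding_number_rectpath) auto
    moreover have "p \<in> pz" using zs[OF p] cboxS box_subset_cbox by (auto simp: pz_def)
    ultimately show "winding_number ?R p * of_real y powr p * of_int (zorder zeta p) = of_nat (zero_mult p) * of_real y powr p"
      using zorder by simp
  qed
  finally have arg: "2 * pi * \<i> * (\<Sum>p\<in>zeros_upto T1 - zeros_upto T0. of_nat (zero_mult p) * of_real y powr p) = contour_integral ?R F" by simp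
  have Fh: "F holomorphic_on S - pz"
  proof -
    have "open (S - pz)" using finpz by (intro open_Diff finite_imp_closed) (auto simp: S_def)
    moreover have "zeta holomorphic_on S - pz" by (rule holomorphic_on_subset[OF holo]) auto
    ultimately show ?thesis unfolding F_def using y by (intro holomorphic_intros) (auto simp: pz_def)
  qed
  have pimg: "path_image ?R = closed_segment ?a ?d \<union> closed_segment ?d ?b \<union> closed_segment ?b ?e \<union> closed_segment ?e ?a"
    by (simp add: rectpath_def Let_def path_image_join Un_assoc)
  have "path_image ?R \<subseteq> S - pz" using img cboxS fr by (auto simp: pz_def)
  hence cont: "continuous_on A F" if "A \<subseteq> path_image ?R" for A
    using that by (intro holomorphic_on_imp_continuous_on holomorphic_on_subset[OF Fh]) auto
  have cs: "continuous_on (closed_segment ?a ?d) F" "continuous_on (closed_segment ?d ?b) F"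
    "continuous_on (closed_segment ?b ?e) F" "continuous_on (closed_segment ?e ?a) F"
    by (rule cont, use pimg in blast)+
  have ints: "F contour_integrable_on linepath ?a ?d" "F contour_integrable_on linepath ?d ?b"
    "F contour_integrable_on linepath ?b ?e" "F contour_integrable_on linepath ?e ?a"
    using cs by (auto intro: contour_integrable_continuous_linepath)
  have split: "contour_integral ?R F = contour_integral (linepath ?a ?d) F + (contour_integral (linepath ?d ?b) F
      + (contour_integral (linepath ?b ?e) F + contour_integral (linepath ?e ?a) F))"
    unfolding rectpath_def Let_def complex.sel using ints by (simp add: contour_integrable_joinI)
  have Fs: "F s = (deriv zeta s / zeta s) * of_real y powr s" for s by (simp add: F_def)
  have 1: "contour_integral (linepath ?d ?b) F = - contour_integral (linepath ?d ?b) (\<lambda>s. mangoldt_series s * of_real y powr s)"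
  proof -
    have "contour_integral (linepath ?d ?b) F = contour_integral (linepath ?d ?b) (\<lambda>s. - (mangoldt_series s * of_real y powr s))"
    proof (rule contour_integral_cong)
      fix s assume "s \<in> path_image (linepath ?d ?b)"
      hence "Re s > 1" using closed_segment_vertical(1) c by simp
      thus "F s = - (mangoldt_series s * of_real y powr s)" unfolding Fs by (simp only: logderiv_zeta) simp
    qed auto
    thus ?thesis by (simp add: contour_integral_neg)
  qed
  have 2: "contour_integral (linepath ?b ?e) F = - contour_integral (linepath ?e ?b) F"
    by (rule contour_integral_reverse_linepath[OF cs(3)])
  have 3: "contour_integral (linepath ?e ?a) F = - (contour_integral (linepath ?a ?e) (\<lambda>s. mangoldt_series (1 - s) * of_real y powr s)
      + contour_integral (linepath ?a ?e) (\<lambda>s. fe_logderiv s * of_real y powr s))"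
  proof -
    have seg: "Re s = 1 - c" "Im s > 0" if "s \<in> closed_segment ?a ?e" for s
      using closed_segment_vertical(1)[OF that] closed_segment_vertical(2)[OF _ that] T by auto
    have cp: "continuous_on (closed_segment ?a ?e) (\<lambda>s. of_real y powr s :: complex)"
      using y by (intro holomorphic_on_imp_continuous_on holomorphic_intros) auto
    have "(mangoldt_series \<circ> (\<lambda>s. 1 - s)) holomorphic_on {s. Re s < 0}"
      by (rule holomorphic_on_compose_gen[OF _ mangoldt_series_holomorphic]) (auto intro!: holomorphic_intros)
    hence "continuous_on {s. Re s < 0} (\<lambda>s. mangoldt_series (1 - s))"
      using holomorphic_on_imp_continuous_on by (force simp: o_def)
    hence c1: "continuous_on (closed_segment ?a ?e) (\<lambda>s. mangoldt_series (1 - s))"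
      by (rule continuous_on_subset) (use seg c in auto)
    have c2: "continuous_on (closed_segment ?a ?e) fe_logderiv"
      by (intro continuous_at_imp_continuous_on ballI DERIV_isCont[OF fe_logderiv_DERIV]) (use seg in auto)
    have "contour_integral (linepath ?e ?a) F = - contour_integral (linepath ?a ?e) F"
      by (rule contour_integral_reverse_linepath[OF cs(4)])
    also have "contour_integral (linepath ?a ?e) F = contour_integral (linepath ?a ?e)
        (\<lambda>s. mangoldt_series (1 - s) * of_real y powr s + fe_logderiv s * of_real y powr s)"
    proof (rule contour_integral_cong)
      fix s assume "s \<in> path_image (linepath ?a ?e)"
      hence "Re s < 0" "Im s > 0" using seg[of s] c by auto
      thus "F s = mangoldt_series (1 - s) * of_real y powr s + fe_logderiv s * of_real y powr s"
        unfolding Fs by (simp only: logderiv_zeta_left distrib_right)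
    qed auto
    also have "\<dots> = contour_integral (linepath ?a ?e) (\<lambda>s. mangoldt_series (1 - s) * of_real y powr s)
      + contour_integral (linepath ?a ?e) (\<lambda>s. fe_logderiv s * of_real y powr s)"
      by (intro contour_integral_add contour_integrable_continuous_linepath continuous_on_mult c1 c2 cp)
    finally show ?thesis .
  qed
  show ?thesis unfolding arg split 1 2 3 by simp
qed

text \<open>The order of the quantifiers is what matters: \<open>T0\<close> is fixed once and
  \<open>T1\<close> depends only on \<open>T\<close>, so the same set of zeros serves all
  \<open>c\<close> and \<open>y\<close>. Otherwise the estimates for the different ratios
  \<open>m / n\<close> could not be added. \<open>T \<ge> 12\<close> ensures
  \<open>T0 < T1\<close>.\<close>

lemma landau_gonek:
  assumes RH: "Riemann_Hypothesis"
  shows "\<exists>C>0. \<exists>T0\<in>{10..11}. \<forall>T\<ge>12. \<exists>T1\<in>{T..T+1}. \<forall>c y. 1 < c \<longrightarrow> c \<le> 11 / 10 \<longrightarrow> 1 < y \<longrightarrow>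
     norm (2 * pi * \<i> * (\<Sum>\<rho>\<in>zeros_upto T1 - zeros_upto T0. of_nat (zero_mult \<rho>) * of_real y powr \<rho>)
        + \<i> * of_real (T1 - T0) * of_real (\<Sum>k | real k = y. mangoldt k))
     \<le> C * (y powr c / (c - 1) + y powr c * (ln T * sqrt (ln T)) + ln T / ln y
          + y * (\<Sum>k | y / 2 < real k \<and> real k < 2 * y \<and> real k \<noteq> y. mangoldt k / \<bar>y - real k\<bar>))"
proof -
  obtain G where G: "G > 0" and gh: "\<And>T. T \<ge> 10 \<Longrightarrow> \<exists>T'\<in>{T..T+1}. \<forall>\<rho>. zeta \<rho> = 0 \<longrightarrow> Im \<rho> > 0 \<longrightarrow> \<bar>Im \<rho> - T'\<bar> \<ge> 1 / (G * ln T)"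
    using good_height[OF RH] by blast
  obtain H where H: "H > 0" and hb: "\<And>T T' c y. T \<ge> 10 \<Longrightarrow> T' \<in> {T..T+1} \<Longrightarrow>
     (\<forall>\<rho>. zeta \<rho> = 0 \<longrightarrow> Im \<rho> > 0 \<longrightarrow> \<bar>Im \<rho> - T'\<bar> \<ge> 1 / (G * ln T)) \<Longrightarrow> 1 < c \<Longrightarrow> c \<le> 11 / 10 \<Longrightarrow> y \<ge> 1 \<Longrightarrow>
     norm (contour_integral (linepath (Complex (1 - c) T') (Complex c T'))
       (\<lambda>s. deriv zeta s * of_real y powr s / zeta s)) \<le> H * (y powr c * (ln T * sqrt (ln T)))"
    using horizontal_bound[OF RH G] by blast
  obtain R where R: "R > 0" and rb: "\<And>c y T0 T1. 1 < c \<Longrightarrow> c \<le> 11 / 10 \<Longrightarrow> 1 \<le> y \<Longrightarrow>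
     norm (contour_integral (linepath (Complex c T0) (Complex c T1)) (\<lambda>s. mangoldt_series s * of_real y powr s)
        - \<i> * of_real (T1 - T0) * of_real (\<Sum>k | real k = y. mangoldt k))
     \<le> R * (y powr c / (c - 1)) + 16 * y * (\<Sum>k | y / 2 < real k \<and> real k < 2 * y \<and> real k \<noteq> y. mangoldt k / \<bar>y - real k\<bar>)"
    using right_line_bound by blast
  obtain L where L: "L > 0" and lb: "\<And>c y T0 T1. 1 < c \<Longrightarrow> c \<le> 11 / 10 \<Longrightarrow> 1 \<le> y \<Longrightarrow>
     norm (contour_integral (linepath (Complex (1 - c) T0) (Complex (1 - c) T1)) (\<lambda>s. mangoldt_series (1 - s) * of_real y powr s))
     \<le> L / (c - 1)"
    using left_line_mangoldt_bound by blast
  obtain D where D: "D > 0" and db: "\<And>c y T0 T1. 1 < c \<Longrightarrow> c \<le> 11 / 10 \<Longrightarrow> 1 < y \<Longrightarrow> 1 \<le> T0 \<Longrightarrow> T0 \<le> T1 \<Longrightarrow> 10 \<le> T1 \<Longrightarrow>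
     norm (contour_integral (linepath (Complex (1 - c) T0) (Complex (1 - c) T1)) (\<lambda>s. fe_logderiv s * of_real y powr s))
     \<le> D * (ln T1 / ln y)"
    using left_line_gamma_bound by blast
  obtain T0 where T0: "T0 \<in> {10..10+1}" and g0: "\<forall>\<rho>. zeta \<rho> = 0 \<longrightarrow> Im \<rho> > 0 \<longrightarrow> \<bar>Im \<rho> - T0\<bar> \<ge> 1 / (G * ln 10)"
    using gh[of 10] by auto
  have gap_pos: "1 / (G * ln T) > 0" if "T \<ge> 10" for T using G ln_ge_1[OF that] by simp
  define C where "C = R + L + 2 * H + 2 * D + 16"
  have main: "norm (2 * pi * \<i> * (\<Sum>\<rho>\<in>zeros_upto T1 - zeros_upto T0. of_nat (zero_mult \<rho>) * of_real y powr \<rho>)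
        + \<i> * of_real (T1 - T0) * of_real (\<Sum>k | real k = y. mangoldt k))
     \<le> C * (y powr c / (c - 1) + y powr c * (ln T * sqrt (ln T)) + ln T / ln y
          + y * (\<Sum>k | y / 2 < real k \<and> real k < 2 * y \<and> real k \<noteq> y. mangoldt k / \<bar>y - real k\<bar>))"
    if T: "T \<ge> 12" and T1: "T1 \<in> {T..T+1}" and g1: "\<forall>\<rho>. zeta \<rho> = 0 \<longrightarrow> Im \<rho> > 0 \<longrightarrow> \<bar>Im \<rho> - T1\<bar> \<ge> 1 / (G * ln T)"
      and c: "1 < c" "c \<le> 11 / 10" and y: "1 < y" for T T1 c y
  proof -
    let ?F = "\<lambda>s. deriv zeta s * of_real y powr s / zeta s"
    let ?near = "\<Sum>k | y / 2 < real k \<and> real k < 2 * y \<and> real k \<noteq> y. mangoldt k / \<bar>y - real k\<bar>"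
    define A where "A = y powr c / (c - 1)"
    define B where "B = y powr c * (ln T * sqrt (ln T))"
    define E where "E = ln T / ln y"
    define N where "N = y * ?near"
    have l1: "ln T \<ge> 1" using T by (intro ln_ge_1) simp
    have nn: "A \<ge> 0" "B \<ge> 0" "E \<ge> 0" "N \<ge> 0"
      using c y l1 by (auto simp: A_def B_def E_def N_def mangoldt_nonneg intro!: mult_nonneg_nonneg sum_nonneg)
    have free: "Im \<rho> \<noteq> T0 \<and> Im \<rho> \<noteq> T1" if "zeta \<rho> = 0" "Im \<rho> > 0" for \<rho>
      using g0 g1 that gap_pos[of 10] gap_pos[of T] T by force
    have T01: "10 \<le> T0" "T0 < T1" "1 \<le> T0" "T0 \<le> T1" "10 \<le> T1" using T0 T1 T by auto
    have eq: "2 * pi * \<i> * (\<Sum>\<rho>\<in>zeros_upto T1 - zeros_upto T0. of_nat (zero_mult \<rho>) * of_real y powr \<rho>)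
        + \<i> * of_real (T1 - T0) * of_real (\<Sum>k | real k = y. mangoldt k) =
     contour_integral (linepath (Complex (1 - c) T0) (Complex c T0)) ?F
     - (contour_integral (linepath (Complex c T0) (Complex c T1)) (\<lambda>s. mangoldt_series s * of_real y powr s)
         - \<i> * of_real (T1 - T0) * of_real (\<Sum>k | real k = y. mangoldt k))
     - contour_integral (linepath (Complex (1 - c) T1) (Complex c T1)) ?F
     - (contour_integral (linepath (Complex (1 - c) T0) (Complex (1 - c) T1)) (\<lambda>s. mangoldt_series (1 - s) * of_real y powr s)
        + contour_integral (linepath (Complex (1 - c) T0) (Complex (1 - c) T1)) (\<lambda>s. fe_logderiv s * of_real y powr s))"
      using zeros_contour_integral[OF T01(1,2) c y free RH] by (simp add: algebra_simps)
    have b1: "norm (contour_integral (linepath (Complex (1 - c) T0) (Complex c T0)) ?F) \<le> H * B"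
    proof -
      have "norm (contour_integral (linepath (Complex (1 - c) T0) (Complex c T0)) ?F) \<le> H * (y powr c * (ln 10 * sqrt (ln 10)))"
        using T0 g0 c y by (intro hb) auto
      also have "\<dots> \<le> H * B" unfolding B_def using T H by (intro mult_left_mono mult_mono) auto
      finally show ?thesis .
    qed
    have b2: "norm (contour_integral (linepath (Complex (1 - c) T1) (Complex c T1)) ?F) \<le> H * B"
      unfolding B_def using T T1 g1 c y by (intro hb) auto
    have b3: "norm (contour_integral (linepath (Complex c T0) (Complex c T1)) (\<lambda>s. mangoldt_series s * of_real y powr s)
         - \<i> * of_real (T1 - T0) * of_real (\<Sum>k | real k = y. mangoldt k)) \<le> R * A + 16 * N"
      using rb[OF c, of y T0 T1] y by (simp add: A_def N_def mult.assoc)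
    have b4: "norm (contour_integral (linepath (Complex (1 - c) T0) (Complex (1 - c) T1)) (\<lambda>s. mangoldt_series (1 - s) * of_real y powr s)) \<le> L * A"
    proof -
      have "1 \<le> y powr c" using y c by (intro ge_one_powr_ge_zero) auto
      hence "L / (c - 1) \<le> L * A" using L c by (simp add: A_def divide_right_mono)
      thus ?thesis using lb[OF c, of y T0 T1] y by linarith
    qed
    have b5: "norm (contour_integral (linepath (Complex (1 - c) T0) (Complex (1 - c) T1)) (\<lambda>s. fe_logderiv s * of_real y powr s)) \<le> 2 * D * E"
    proof -
      have "12 * T \<le> T * T" using T by (intro mult_right_mono) auto
      moreover have "T1 \<le> T + 1" using T1 by simp
      ultimately have "T1 \<le> T * T" using T by linarith
      hence "ln T1 \<le> ln (T * T)" using T01 by (subst ln_le_cancel_iff) auto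
      hence "ln T1 \<le> 2 * ln T" using T by (simp add: ln_mult)
      hence "D * (ln T1 / ln y) \<le> D * (2 * ln T / ln y)" using y D by (intro mult_left_mono divide_right_mono) auto
      thus ?thesis using db[OF c y T01(3-5)] by (simp add: E_def mult_ac)
    qed
    have "norm (2 * pi * \<i> * (\<Sum>\<rho>\<in>zeros_upto T1 - zeros_upto T0. of_nat (zero_mult \<rho>) * of_real y powr \<rho>)
        + \<i> * of_real (T1 - T0) * of_real (\<Sum>k | real k = y. mangoldt k)) \<le> H * B + (R * A + 16 * N) + H * B + (L * A + 2 * D * E)"
      unfolding eq by (intro order_trans[OF norm_triangle_ineq4] order_trans[OF norm_triangle_ineq] add_mono b1 b2 b3 b4 b5)
    also have "\<dots> = (R + L) * A + 2 * H * B + 2 * D * E + 16 * N" by (simp add: algebra_simps)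
    also have "\<dots> \<le> C * A + C * B + C * E + C * N"
    proof -
      have "R + L \<le> C" "2 * H \<le> C" "2 * D \<le> C" "16 \<le> C" using R L H D by (auto simp: C_def)
      hence "(R + L) * A \<le> C * A" "2 * H * B \<le> C * B" "2 * D * E \<le> C * E" "16 * N \<le> C * N"
        using nn by (auto intro!: mult_right_mono)
      thus ?thesis by linarith
    qed
    also have "\<dots> = C * (A + B + E + N)" by (simp add: algebra_simps)
    finally show ?thesis unfolding A_def B_def E_def N_def .
  qed
  have C: "C > 0" unfolding C_def using R L H D by simp
  show ?thesis
  proof (rule exI[of _ C], intro conjI C, rule bexI[of _ T0], intro allI impI)
    show "T0 \<in> {10..11}" using T0 by simp
  next
    fix T :: real assume T: "T \<ge> 12"
    then obtain T1 where "T1 \<in> {T..T+1}" "\<forall>\<rho>. zeta \<rho> = 0 \<longrightarrow> Im \<rho> > 0 \<longrightarrow> \<bar>Im \<rho> - T1\<bar> \<ge> 1 / (G * ln T)"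
      using gh[of T] by auto
    thus "\<exists>T1\<in>{T..T+1}. \<forall>c y. 1 < c \<longrightarrow> c \<le> 11 / 10 \<longrightarrow> 1 < y \<longrightarrow>
     norm (2 * pi * \<i> * (\<Sum>\<rho>\<in>zeros_upto T1 - zeros_upto T0. of_nat (zero_mult \<rho>) * of_real y powr \<rho>)
        + \<i> * of_real (T1 - T0) * of_real (\<Sum>k | real k = y. mangoldt k))
     \<le> C * (y powr c / (c - 1) + y powr c * (ln T * sqrt (ln T)) + ln T / ln y
          + y * (\<Sum>k | y / 2 < real k \<and> real k < 2 * y \<and> real k \<noteq> y. mangoldt k / \<bar>y - real k\<bar>))"
      using main[OF T] by blast
  qed
qed

section \<open>Bilinear sums over pairs of frequencies\<close>

lemma harmonic_le: "n \<ge> 1 \<Longrightarrow> (\<Sum>k=1..n. 1 / real k) \<le> 1 + ln (real n)"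
proof (induction n rule: dec_induct)
  case (step n)
  have "1 - 1 / (real (Suc n) / real n) \<le> ln (real (Suc n) / real n)"
    using step by (intro one_minus_inverse_le_ln) auto
  moreover have "1 - 1 / (real (Suc n) / real n) = 1 / real (Suc n)" using step by (simp add: field_simps)
  moreover have "ln (real (Suc n) / real n) = ln (real (Suc n)) - ln (real n)" using step by (simp add: ln_div del: of_nat_Suc)
  ultimately show ?case using step by simp
qed simp

text \<open>On each side of \<open>p\<close> every distance occurs at most once, so each side is
  bounded by a harmonic sum up to \<open>M\<close>.\<close>

lemma sum_inverse_dist_le:
  assumes J: "finite J" "\<And>j. j \<in> J \<Longrightarrow> j \<noteq> p \<and> \<bar>real p - real j\<bar> \<le> M" and M: "M \<ge> 1"
  shows "(\<Sum>j\<in>J. 1 / \<bar>real p - real j\<bar>) \<le> 2 * (1 + ln M)"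
proof -
  define K where "K = nat \<lfloor>M\<rfloor>"
  have K: "K \<ge> 1" "real K \<le> M" using M by (auto simp: K_def le_nat_floor)
  have half: "(\<Sum>j\<in>I. 1 / \<bar>real p - real j\<bar>) \<le> 1 + ln M"
    if I: "I \<subseteq> J" and g: "inj_on g I" "\<And>j. j \<in> I \<Longrightarrow> real (g j) = \<bar>real p - real j\<bar>" for I and g :: "nat \<Rightarrow> nat"
  proof -
    have "(\<Sum>j\<in>I. 1 / \<bar>real p - real j\<bar>) = (\<Sum>j\<in>I. 1 / real (g j))" by (intro sum.cong refl) (simp add: g(2))
    also have "\<dots> = (\<Sum>k\<in>g ` I. 1 / real k)" using g(1) by (simp add: sum.reindex o_def)
    also have "\<dots> \<le> (\<Sum>k=1..K. 1 / real k)"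
    proof (intro sum_mono2)
      show "g ` I \<subseteq> {1..K}"
      proof
        fix k assume "k \<in> g ` I"
        then obtain j where j: "j \<in> I" "k = g j" by auto
        hence "real k = \<bar>real p - real j\<bar>" "real k \<le> M" "j \<noteq> p" using g(2) J(2) I by auto
        hence "k \<noteq> 0" "k \<le> K" using le_nat_floor[of k M] by (auto simp: K_def)
        thus "k \<in> {1..K}" by simp
      qed
    qed auto
    also have "\<dots> \<le> 1 + ln (real K)" by (rule harmonic_le[OF K(1)])
    also have "\<dots> \<le> 1 + ln M" using K by simp
    finally show ?thesis .
  qed
  have "J = {j\<in>J. j < p} \<union> {j\<in>J. p < j}" using J(2) by force
  hence "(\<Sum>j\<in>J. 1 / \<bar>real p - real j\<bar>) = (\<Sum>j\<in>{j\<in>J. j < p} \<union> {j\<in>J. p < j}. 1 / \<bar>real p - real j\<bar>)" by simp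
  also have "\<dots> = (\<Sum>j\<in>{j\<in>J. j < p}. 1 / \<bar>real p - real j\<bar>) + (\<Sum>j\<in>{j\<in>J. p < j}. 1 / \<bar>real p - real j\<bar>)"
    using J(1) by (intro sum.union_disjoint) auto
  also have "\<dots> \<le> (1 + ln M) + (1 + ln M)"
    by (intro add_mono half[of _ "\<lambda>j. p - j"] half[of _ "\<lambda>j. j - p"]) (auto intro!: inj_onI)
  finally show ?thesis by simp
qed

lemma norm_sum_squared:
  fixes u :: "nat \<Rightarrow> complex"
  assumes X: "finite X"
  shows "(cmod (\<Sum>n\<in>X. u n))\<^sup>2 = (\<Sum>n\<in>X. (cmod (u n))\<^sup>2)
           + 2 * Re (\<Sum>(m, n)\<in>{(m, n). m \<in> X \<and> n \<in> X \<and> n < m}. u n * cnj (u m))"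
proof -
  let ?lt = "{(m, n). m \<in> X \<and> n \<in> X \<and> n < m}" and ?gt = "{(m, n). m \<in> X \<and> n \<in> X \<and> m < n}"
  let ?f = "\<lambda>(m, n). u n * cnj (u m)"
  have fin: "finite ?lt" "finite ?gt" "finite ((\<lambda>n. (n, n)) ` X)"
    by (rule finite_subset[of _ "X \<times> X"]; use X in auto)+
  have "complex_of_real ((cmod (\<Sum>n\<in>X. u n))\<^sup>2) = (\<Sum>n\<in>X. u n) * cnj (\<Sum>n\<in>X. u n)"
    by (rule complex_norm_square)
  also have "\<dots> = (\<Sum>n\<in>X. \<Sum>m\<in>X. u n * cnj (u m))" by (simp only: cnj_sum sum_product)
  also have "\<dots> = (\<Sum>m\<in>X. \<Sum>n\<in>X. u n * cnj (u m))" by (rule sum.swap)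
  also have "\<dots> = sum ?f (X \<times> X)" by (simp add: sum.cartesian_product)
  also have "X \<times> X = (?lt \<union> ?gt) \<union> (\<lambda>n. (n, n)) ` X" by auto
  also have "sum ?f \<dots> = sum ?f ?lt + sum ?f ?gt + sum ?f ((\<lambda>n. (n, n)) ` X)"
    using fin by (subst sum.union_disjoint; (subst sum.union_disjoint)?) auto
  also have "sum ?f ?gt = sum (\<lambda>(m, n). cnj (u n * cnj (u m))) ?lt"
    by (rule sum.reindex_bij_witness[of _ prod.swap prod.swap]) auto
  also have "\<dots> = cnj (sum ?f ?lt)" by (simp add: case_prod_beta)
  also have "sum ?f ((\<lambda>n. (n, n)) ` X) = (\<Sum>n\<in>X. u n * cnj (u n))"
    by (subst sum.reindex) (auto intro!: inj_onI)
  also have "\<dots> = complex_of_real (\<Sum>n\<in>X. (cmod (u n))\<^sup>2)" by (simp only: of_real_sum complex_norm_square)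
  also have "sum ?f ?lt + cnj (sum ?f ?lt) = complex_of_real (2 * Re (sum ?f ?lt))" by (rule complex_add_cnj)
  finally have "complex_of_real ((cmod (\<Sum>n\<in>X. u n))\<^sup>2) = complex_of_real (2 * Re (sum ?f ?lt) + (\<Sum>n\<in>X. (cmod (u n))\<^sup>2))"
    by simp
  thus ?thesis unfolding of_real_eq_iff by simp
qed

text \<open>On the critical line \<open>cnj \<rho> = 1 - \<rho>\<close>, so the conjugate of
  \<open>1 / m powr \<rho>\<close> is \<open>m powr \<rho> / m\<close>, and the pairs with
  \<open>m < n\<close> are conjugate to those with \<open>n < m\<close>. The second bound is plain
  Cauchy-Schwarz; it is meant for the zeros outside the rectangle.\<close>

lemma dirichlet_poly_squared:
  fixes a :: "nat \<Rightarrow> complex"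
  assumes X: "finite X" "0 \<notin> X" and \<rho>: "Re \<rho> = 1 / 2"
  shows "(cmod (\<Sum>n\<in>X. a n / of_nat n powr \<rho>))\<^sup>2 = (\<Sum>n\<in>X. (cmod (a n))\<^sup>2 / real n)
     + 2 * Re (\<Sum>(m, n)\<in>{(m, n). m \<in> X \<and> n \<in> X \<and> n < m}.
          cnj (a m) * a n / of_nat m * of_real (real m / real n) powr \<rho>)"
    and "(cmod (\<Sum>n\<in>X. a n / of_nat n powr \<rho>))\<^sup>2 \<le> real (card X) * (\<Sum>n\<in>X. (cmod (a n))\<^sup>2 / real n)"
proof -
  define u where "u = (\<lambda>n. a n / of_nat n powr \<rho>)"
  have pos: "n > 0" if "n \<in> X" for n using that X by (cases n) auto
  have nu: "(cmod (u n))\<^sup>2 = (cmod (a n))\<^sup>2 / real n" if "n \<in> X" for n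
    unfolding u_def norm_divide norm_nat_powr \<rho> power_divide using pos[OF that] by (simp add: powr_half_sqrt)
  have cu: "u n * cnj (u m) = cnj (a m) * a n / of_nat m * of_real (real m / real n) powr \<rho>" if "n \<in> X" "m \<in> X" for m n
  proof -
    have mn: "m > 0" "n > 0" using that pos by auto
    have "cnj (of_nat m powr \<rho>) = of_nat m powr (cnj \<rho>)"
      using mn by (simp add: powr_def exp_cnj cnj_Ln)
    also have "cnj \<rho> = 1 - \<rho>" using \<rho> by (simp add: complex_eq_iff)
    also have "of_nat m powr (1 - \<rho>) = of_nat m / of_nat m powr \<rho>" using mn by (simp add: powr_diff)
    finally have "cnj (u m) = cnj (a m) / (of_nat m / of_nat m powr \<rho>)" by (simp add: u_def)
    hence 1: "u n * cnj (u m) = cnj (a m) * a n / of_nat m * (of_nat m powr \<rho> / of_nat n powr \<rho>)"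
      by (simp add: u_def mult_ac)
    have "of_real (real m) powr \<rho> / of_real (real n) powr \<rho> = of_real (real m / real n) powr \<rho>"
      using mn by (simp add: powr_exp_of_real ln_div left_diff_distrib exp_diff del: of_real_of_nat_eq of_real_divide)
    thus ?thesis unfolding 1 by simp
  qed
  have "(\<Sum>(m, n)\<in>{(m, n). m \<in> X \<and> n \<in> X \<and> n < m}. u n * cnj (u m)) =
      (\<Sum>(m, n)\<in>{(m, n). m \<in> X \<and> n \<in> X \<and> n < m}. cnj (a m) * a n / of_nat m * of_real (real m / real n) powr \<rho>)"
    by (intro sum.cong refl) (auto simp: cu)
  thus "(cmod (\<Sum>n\<in>X. a n / of_nat n powr \<rho>))\<^sup>2 = (\<Sum>n\<in>X. (cmod (a n))\<^sup>2 / real n)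
     + 2 * Re (\<Sum>(m, n)\<in>{(m, n). m \<in> X \<and> n \<in> X \<and> n < m}.
          cnj (a m) * a n / of_nat m * of_real (real m / real n) powr \<rho>)"
    using norm_sum_squared[OF X(1), of u] sum.cong[OF refl nu, of X] unfolding u_def[symmetric] by simp
  have "(cmod (\<Sum>n\<in>X. u n))\<^sup>2 \<le> (\<Sum>n\<in>X. 1 * cmod (u n))\<^sup>2"
    by (intro power_mono) (auto intro: norm_sum)
  also have "\<dots> \<le> (\<Sum>n\<in>X. 1\<^sup>2) * (\<Sum>n\<in>X. (cmod (u n))\<^sup>2)" by (rule Cauchy_Schwarz_ineq_sum)
  also have "\<dots> = real (card X) * (\<Sum>n\<in>X. (cmod (a n))\<^sup>2 / real n)"
    using sum.cong[OF refl nu, of X] by simp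
  finally show "(cmod (\<Sum>n\<in>X. a n / of_nat n powr \<rho>))\<^sup>2 \<le> real (card X) * (\<Sum>n\<in>X. (cmod (a n))\<^sup>2 / real n)"
    by (simp add: u_def)
qed

definition index_set :: "real \<Rightarrow> nat set" where "index_set x = {n. 0 < n \<and> real n \<le> x}"

lemma index_set_eq: "index_set x = {1..nat \<lfloor>x\<rfloor>}"
  by (auto simp: index_set_def le_nat_floor) (linarith)

lemma finite_index_set [simp, intro]: "finite (index_set x)"
  by (simp add: index_set_eq)

lemma card_index_set_le: "x \<ge> 0 \<Longrightarrow> real (card (index_set x)) \<le> x"
  by (simp add: index_set_eq)

lemma sum_inverse_index_set_le:
  assumes "x \<ge> 1" shows "(\<Sum>n\<in>index_set x. 1 / real n) \<le> 1 + ln x"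
proof -
  have "nat \<lfloor>x\<rfloor> \<ge> 1" using assms by (simp add: le_nat_floor)
  hence "(\<Sum>n\<in>index_set x. 1 / real n) \<le> 1 + ln (real (nat \<lfloor>x\<rfloor>))" unfolding index_set_eq by (rule harmonic_le)
  also have "\<dots> \<le> 1 + ln x" using assms by simp
  finally show ?thesis .
qed

text \<open>The double sum factors, and Cauchy-Schwarz is applied to each factor: the sum of
  \<open>b m\<close> is at most \<open>x * sqrt B\<close>, the sum of \<open>b n / n\<close> at most
  \<open>sqrt (B * (1 + ln x))\<close>. Only half a power of a logarithm is lost.\<close>

lemma l1_bilinear_bound:
  fixes b :: "nat \<Rightarrow> real"
  assumes x: "x \<ge> 1" and b: "\<And>n. b n \<ge> 0"
  defines "B \<equiv> \<Sum>n\<in>index_set x. (b n)\<^sup>2 / real n"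
  shows "(\<Sum>m\<in>index_set x. \<Sum>n\<in>index_set x. b m * b n / real n) \<le> x * sqrt (1 + ln x) * B"
proof -
  let ?X = "index_set x"
  have B: "B \<ge> 0" unfolding B_def by (intro sum_nonneg) auto
  have pos: "real n > 0" "real n \<le> x" if "n \<in> ?X" for n using that by (auto simp: index_set_def)
  have "(\<Sum>m\<in>?X. b m)\<^sup>2 = (\<Sum>m\<in>?X. (b m / sqrt (real m)) * sqrt (real m))\<^sup>2"
    by (intro arg_cong[where f = "\<lambda>x. x\<^sup>2"] sum.cong refl) (use pos in force)
  also have "\<dots> \<le> (\<Sum>m\<in>?X. (b m / sqrt (real m))\<^sup>2) * (\<Sum>m\<in>?X. (sqrt (real m))\<^sup>2)" by (rule Cauchy_Schwarz_ineq_sum)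
  also have "(\<Sum>m\<in>?X. (b m / sqrt (real m))\<^sup>2) = B" unfolding B_def by (intro sum.cong refl) (simp add: power_divide)
  also have "(\<Sum>m\<in>?X. (sqrt (real m))\<^sup>2) \<le> (\<Sum>m\<in>?X. x)" by (intro sum_mono) (use pos in auto)
  also have "(\<Sum>m\<in>?X. x) \<le> x * x" using card_index_set_le[of x] x by (simp add: mult_right_mono)
  finally have "(\<Sum>m\<in>?X. b m)\<^sup>2 \<le> B * (x * x)" using B by (simp add: mult_left_mono)
  hence 1: "(\<Sum>m\<in>?X. b m) \<le> sqrt (B * (x * x))" by (rule real_le_rsqrt)
  have "(\<Sum>n\<in>?X. b n / real n)\<^sup>2 = (\<Sum>n\<in>?X. (b n / sqrt (real n)) * (1 / sqrt (real n)))\<^sup>2"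
    by (intro arg_cong[where f = "\<lambda>x. x\<^sup>2"] sum.cong refl) (use pos in force)
  also have "\<dots> \<le> (\<Sum>n\<in>?X. (b n / sqrt (real n))\<^sup>2) * (\<Sum>n\<in>?X. (1 / sqrt (real n))\<^sup>2)" by (rule Cauchy_Schwarz_ineq_sum)
  also have "(\<Sum>n\<in>?X. (b n / sqrt (real n))\<^sup>2) = B" unfolding B_def by (intro sum.cong refl) (simp add: power_divide)
  also have "(\<Sum>n\<in>?X. (1 / sqrt (real n))\<^sup>2) = (\<Sum>n\<in>?X. 1 / real n)" by (intro sum.cong refl) (simp add: power_divide)
  also have "B * \<dots> \<le> B * (1 + ln x)" using B by (intro mult_left_mono sum_inverse_index_set_le x)
  finally have 2: "(\<Sum>n\<in>?X. b n / real n) \<le> sqrt (B * (1 + ln x))" by (rule real_le_rsqrt)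
  have "(\<Sum>m\<in>?X. \<Sum>n\<in>?X. b m * b n / real n) = (\<Sum>m\<in>?X. b m) * (\<Sum>n\<in>?X. b n / real n)"
    by (simp add: sum_product)
  also have "\<dots> \<le> sqrt (B * (x * x)) * sqrt (B * (1 + ln x))"
    using b B x by (intro mult_mono 1 2) (auto intro!: sum_nonneg)
  also have "\<dots> = x * sqrt (1 + ln x) * (sqrt B * sqrt B)" using x by (simp add: real_sqrt_mult)
  also have "sqrt B * sqrt B = B" using B by simp
  finally show ?thesis .
qed

lemma sum_pairs_less:
  fixes f :: "nat \<Rightarrow> nat \<Rightarrow> 'a :: comm_monoid_add"
  assumes X: "finite X"
  shows "(\<Sum>(m, n)\<in>{(m, n). m \<in> X \<and> n \<in> X \<and> n < m}. f m n) = (\<Sum>m\<in>X. \<Sum>n\<in>{n\<in>X. n < m}. f m n)"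
    and "(\<Sum>(m, n)\<in>{(m, n). m \<in> X \<and> n \<in> X \<and> n < m}. f m n) = (\<Sum>n\<in>X. \<Sum>m\<in>{m\<in>X. n < m}. f m n)"
proof -
  have "{(m, n). m \<in> X \<and> n \<in> X \<and> n < m} = Sigma X (\<lambda>m. {n\<in>X. n < m})" by auto
  thus "(\<Sum>(m, n)\<in>{(m, n). m \<in> X \<and> n \<in> X \<and> n < m}. f m n) = (\<Sum>m\<in>X. \<Sum>n\<in>{n\<in>X. n < m}. f m n)"
    using X by (simp add: sum.Sigma)
  have "(\<Sum>(m, n)\<in>{(m, n). m \<in> X \<and> n \<in> X \<and> n < m}. f m n) = (\<Sum>(n, m)\<in>Sigma X (\<lambda>n. {m\<in>X. n < m}). f m n)"
    by (rule sum.reindex_bij_witness[of _ prod.swap prod.swap]) auto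
  thus "(\<Sum>(m, n)\<in>{(m, n). m \<in> X \<and> n \<in> X \<and> n < m}. f m n) = (\<Sum>n\<in>X. \<Sum>m\<in>{m\<in>X. n < m}. f m n)"
    using X by (simp add: sum.Sigma)
qed

text \<open>Schur's test in its simplest form: \<open>b m * b n\<close> is at most the mean of the
  squares, which leaves the row sums and the column sums of \<open>w\<close>.\<close>

lemma sum_pairs_AM_GM:
  fixes b :: "nat \<Rightarrow> real"
  assumes X: "finite X" and w: "\<And>m n. m \<in> X \<Longrightarrow> n \<in> X \<Longrightarrow> n < m \<Longrightarrow> w m n \<ge> 0"
  shows "(\<Sum>(m, n)\<in>{(m, n). m \<in> X \<and> n \<in> X \<and> n < m}. b m * b n * w m n) \<le>
     ((\<Sum>m\<in>X. (b m)\<^sup>2 * (\<Sum>n\<in>{n\<in>X. n < m}. w m n)) + (\<Sum>n\<in>X. (b n)\<^sup>2 * (\<Sum>m\<in>{m\<in>X. n < m}. w m n))) / 2"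
proof -
  let ?P = "{(m, n). m \<in> X \<and> n \<in> X \<and> n < m}"
  have "(\<Sum>(m, n)\<in>?P. b m * b n * w m n) \<le> (\<Sum>(m, n)\<in>?P. ((b m)\<^sup>2 * w m n + (b n)\<^sup>2 * w m n) / 2)"
  proof (intro sum_mono, clarify)
    fix m n assume mn: "m \<in> X" "n \<in> X" "n < m"
    have "b m * b n \<le> ((b m)\<^sup>2 + (b n)\<^sup>2) / 2" using zero_le_power2[of "b m - b n"] by (simp add: power2_diff)
    hence "b m * b n * w m n \<le> ((b m)\<^sup>2 + (b n)\<^sup>2) / 2 * w m n" using w[OF mn] by (rule mult_right_mono)
    thus "b m * b n * w m n \<le> ((b m)\<^sup>2 * w m n + (b n)\<^sup>2 * w m n) / 2" by (simp add: algebra_simps)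
  qed
  also have "\<dots> = ((\<Sum>(m, n)\<in>?P. (b m)\<^sup>2 * w m n) + (\<Sum>(m, n)\<in>?P. (b n)\<^sup>2 * w m n)) / 2"
    by (simp add: case_prod_beta sum.distrib flip: sum_divide_distrib)
  also have "(\<Sum>(m, n)\<in>?P. (b m)\<^sup>2 * w m n) = (\<Sum>m\<in>X. (b m)\<^sup>2 * (\<Sum>n\<in>{n\<in>X. n < m}. w m n))"
    by (simp only: sum_pairs_less(1)[OF X] sum_distrib_left)
  also have "(\<Sum>(m, n)\<in>?P. (b n)\<^sup>2 * w m n) = (\<Sum>n\<in>X. (b n)\<^sup>2 * (\<Sum>m\<in>{m\<in>X. n < m}. w m n))"
    by (simp only: sum_pairs_less(2)[OF X] sum_distrib_left)
  finally show ?thesis .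
qed

lemma sum_squares_index_set_le:
  fixes b :: "nat \<Rightarrow> real"
  shows "(\<Sum>n\<in>index_set x. (b n)\<^sup>2) \<le> x * (\<Sum>n\<in>index_set x. (b n)\<^sup>2 / real n)"
  unfolding sum_distrib_left
proof (intro sum_mono)
  fix n assume "n \<in> index_set x"
  hence n: "real n > 0" "real n \<le> x" by (auto simp: index_set_def)
  hence "(b n)\<^sup>2 / real n * real n \<le> (b n)\<^sup>2 / real n * x" by (intro mult_left_mono) auto
  thus "(b n)\<^sup>2 \<le> x * ((b n)\<^sup>2 / real n)" using n by (simp add: mult_ac)
qed

text \<open>Row and column sums of the kernel are harmonic sums. Together with the factor
  \<open>ln T\<close> in front, the logarithm they cost stays within the two that are
  allowed.\<close>

lemma hilbert_type_bound:
  fixes b :: "nat \<Rightarrow> real"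
  assumes x: "x \<ge> 1"
  defines "X \<equiv> index_set x" and "B \<equiv> \<Sum>n\<in>index_set x. (b n)\<^sup>2 / real n"
  shows "(\<Sum>(m, n)\<in>{(m, n). m \<in> X \<and> n \<in> X \<and> n < m}. b m * b n * (1 / (real m - real n))) \<le> 2 * (1 + ln (2 * x)) * (x * B)"
proof -
  let ?h = "2 * (1 + ln (2 * x))"
  have h: "?h \<ge> 0" using x by simp
  have fX: "finite X" by (simp add: X_def)
  have Xx: "real n \<le> x" if "n \<in> X" for n using that by (auto simp: X_def index_set_def)
  have 1: "(\<Sum>n\<in>{n\<in>X. n < m}. 1 / (real m - real n)) \<le> ?h" if "m \<in> X" for m
  proof -
    have "(\<Sum>n\<in>{n\<in>X. n < m}. 1 / (real m - real n)) = (\<Sum>n\<in>{n\<in>X. n < m}. 1 / \<bar>real m - real n\<bar>)"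
      by (intro sum.cong) auto
    also have "\<dots> \<le> ?h" using fX Xx[OF that] x by (intro sum_inverse_dist_le) auto
    finally show ?thesis .
  qed
  have 2: "(\<Sum>m\<in>{m\<in>X. n < m}. 1 / (real m - real n)) \<le> ?h" if "n \<in> X" for n
  proof -
    have "(\<Sum>m\<in>{m\<in>X. n < m}. 1 / (real m - real n)) = (\<Sum>m\<in>{m\<in>X. n < m}. 1 / \<bar>real n - real m\<bar>)"
      by (intro sum.cong) auto
    also have "\<dots> \<le> ?h" using fX Xx x by (intro sum_inverse_dist_le) (auto dest: Xx)
    finally show ?thesis .
  qed
  have "(\<Sum>(m, n)\<in>{(m, n). m \<in> X \<and> n \<in> X \<and> n < m}. b m * b n * (1 / (real m - real n))) \<le>
     ((\<Sum>m\<in>X. (b m)\<^sup>2 * (\<Sum>n\<in>{n\<in>X. n < m}. 1 / (real m - real n))) + (\<Sum>n\<in>X. (b n)\<^sup>2 * (\<Sum>m\<in>{m\<in>X. n < m}. 1 / (real m - real n)))) / 2"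
    by (rule sum_pairs_AM_GM[OF fX]) auto
  also have "\<dots> \<le> ((\<Sum>m\<in>X. (b m)\<^sup>2 * ?h) + (\<Sum>n\<in>X. (b n)\<^sup>2 * ?h)) / 2"
    by (intro divide_right_mono add_mono sum_mono mult_left_mono 1 2) auto
  also have "\<dots> = ?h * (\<Sum>n\<in>X. (b n)\<^sup>2)" unfolding sum_distrib_right[symmetric] by simp
  also have "\<dots> \<le> ?h * (x * B)" unfolding X_def B_def using h by (intro mult_left_mono sum_squares_index_set_le)
  finally show ?thesis .
qed

text \<open>The frequencies \<open>k\<close> near \<open>m / n\<close>. In the rows (fixed \<open>m\<close>) the identity
  \<open>\<Sum>\<^bsub>k dvd j\<^esub> \<Lambda> k = ln j\<close> avoids any loss from the number of divisors of \<open>j = k n\<close>.\<close>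

lemma near_diagonal_bound:
  fixes b :: "nat \<Rightarrow> real"
  assumes x: "x \<ge> 1"
  defines "X \<equiv> index_set x" and "B \<equiv> \<Sum>n\<in>index_set x. (b n)\<^sup>2 / real n"
    and "N \<equiv> \<lambda>m n. {k. real m / real n / 2 < real k \<and> real k < 2 * (real m / real n) \<and> real k \<noteq> real m / real n}"
  shows "(\<Sum>(m, n)\<in>{(m, n). m \<in> X \<and> n \<in> X \<and> n < m}. b m * b n * (\<Sum>k\<in>N m n. mangoldt k / \<bar>real m - real (k * n)\<bar>))
     \<le> 2 * (x * B) * (ln (2 * x) * (2 * (1 + ln (2 * x))))"
proof -
  let ?h = "2 * (1 + ln (2 * x))" and ?l = "ln (2 * x)"
  let ?g = "\<lambda>m n k. mangoldt k / \<bar>real m - real (k * n)\<bar>"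
  have l: "?l \<ge> 0" using x by simp
  have h: "?h \<ge> 0" using l by simp
  have fX: "finite X" by (simp add: X_def)
  have Xx: "0 < n" "real n \<le> x" if "n \<in> X" for n using that by (auto simp: X_def index_set_def)
  have Nk: "0 < k" "k * n \<noteq> m" "k * n < 2 * m" "real k \<le> 2 * x / real n" if mn: "m \<in> X" "n \<in> X" and k: "k \<in> N m n" for m n k
  proof -
    have pn: "real n > 0" "real m > 0" using Xx mn by auto
    have k': "real m / real n / 2 < real k" "real k < 2 * (real m / real n)" "real k \<noteq> real m / real n" using k by (auto simp: N_def)
    have "0 < real m / real n / 2" using pn by simp
    thus "0 < k" using k'(1) by linarith
    have "real k * real n < 2 * real m" using k'(2) pn by (simp add: field_simps)
    thus "k * n < 2 * m" by (simp flip: of_nat_mult)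
    show "k * n \<noteq> m" using k'(3) pn by auto
    have "2 * (real m / real n) \<le> 2 * x / real n" using Xx[OF mn(1)] pn by (simp add: divide_right_mono)
    thus "real k \<le> 2 * x / real n" using k'(2) by linarith
  qed
  have finN: "finite (N m n)" if mn: "m \<in> X" "n \<in> X" for m n
    by (rule finite_subset[of _ "{..nat \<lfloor>2 * x / real n\<rfloor>}"]) (use Nk(4)[OF mn] le_nat_floor in auto)
  have row: "(\<Sum>n\<in>{n\<in>X. n < m}. \<Sum>k\<in>N m n. ?g m n k) \<le> ?l * ?h" if m: "m \<in> X" for m
  proof -
    define J where "J = {j. 0 < j \<and> j < 2 * m \<and> j \<noteq> m}"
    have fJ: "finite J" unfolding J_def by simp
    have "(\<Sum>n\<in>{n\<in>X. n < m}. \<Sum>k\<in>N m n. ?g m n k) = (\<Sum>(n, k)\<in>Sigma {n\<in>X. n < m} (N m). ?g m n k)"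
      using fX finN[OF m] by (subst sum.Sigma) auto
    \<comment> \<open>For fixed \<open>m\<close> the pair \<open>(n, k)\<close> is recovered from
      \<open>(k * n, k)\<close>, so the sum is at most the one over all \<open>j\<close> and all
      divisors \<open>k\<close> of \<open>j\<close>; the added terms are nonnegative.\<close>
    also have "\<dots> \<le> (\<Sum>(j, k)\<in>Sigma J (\<lambda>j. {k. k dvd j}). mangoldt k / \<bar>real m - real j\<bar>)"
    proof (rule sum_le_included[where i = "\<lambda>(j, k). (j div k, k)"])
      show "finite (Sigma {n\<in>X. n < m} (N m))" using fX finN[OF m] by auto
      show "finite (Sigma J (\<lambda>j. {k. k dvd j}))" using fJ by (intro finite_SigmaI) (auto simp: J_def)
      show "\<forall>y\<in>Sigma J (\<lambda>j. {k. k dvd j}). 0 \<le> (case y of (j, k) \<Rightarrow> mangoldt k / \<bar>real m - real j\<bar>)"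
        by (auto simp: mangoldt_nonneg)
      show "\<forall>p\<in>Sigma {n\<in>X. n < m} (N m). \<exists>q\<in>Sigma J (\<lambda>j. {k. k dvd j}). (case q of (j, k) \<Rightarrow> (j div k, k)) = p \<and>
          (case p of (n, k) \<Rightarrow> ?g m n k) \<le> (case q of (j, k) \<Rightarrow> mangoldt k / \<bar>real m - real j\<bar>)"
      proof (clarify, goal_cases)
        case (1 n k)
        note nk = Nk[OF m 1(2) 1(1)]
        show ?case
          by (rule bexI[of _ "(k * n, k)"]) (use nk Xx[OF 1(2)] in \<open>auto simp: J_def\<close>)
      qed
    qed
    also have "\<dots> = (\<Sum>j\<in>J. \<Sum>k | k dvd j. mangoldt k / \<bar>real m - real j\<bar>)"
      using fJ by (subst sum.Sigma) (auto simp: J_def)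
    also have "\<dots> = (\<Sum>j\<in>J. ln (real j) * (1 / \<bar>real m - real j\<bar>))"
    proof (intro sum.cong refl)
      fix j assume "j \<in> J"
      hence "(\<Sum>k | k dvd j. mangoldt k) = ln (real j)" using mangoldt_sum[of j, where ?'a = real] by (auto simp: J_def)
      thus "(\<Sum>k | k dvd j. mangoldt k / \<bar>real m - real j\<bar>) = ln (real j) * (1 / \<bar>real m - real j\<bar>)"
        by (simp flip: sum_divide_distrib)
    qed
    also have "\<dots> \<le> (\<Sum>j\<in>J. ?l * (1 / \<bar>real m - real j\<bar>))"
    proof (intro sum_mono mult_right_mono)
      fix j assume "j \<in> J"
      hence "0 < j" "real j \<le> 2 * x" using Xx[OF m] by (auto simp: J_def)
      thus "ln (real j) \<le> ?l" by (subst ln_le_cancel_iff) auto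
    qed auto
    also have "\<dots> = ?l * (\<Sum>j\<in>J. 1 / \<bar>real m - real j\<bar>)" by (simp add: sum_distrib_left)
    also have "\<dots> \<le> ?l * ?h"
      using l fJ x Xx[OF m] by (intro mult_left_mono sum_inverse_dist_le) (auto simp: J_def)
    finally show ?thesis .
  qed
  \<comment> \<open>For fixed \<open>n\<close> the crude bound
    \<open>mangoldt k \<le> ln (2 * x)\<close> is enough. There are at most \<open>2 * x / n\<close>
    values of \<open>k\<close>, and this factor turns \<open>(b n)^2\<close> into
    \<open>x * (b n)^2 / n\<close>, the weight in \<open>x * B\<close>.\<close>
  have col: "(\<Sum>m\<in>{m\<in>X. n < m}. \<Sum>k\<in>N m n. ?g m n k) \<le> 2 * x / real n * (?l * ?h)" if n: "n \<in> X" for n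
  proof -
    define K where "K = {k. 0 < k \<and> real k \<le> 2 * x / real n}"
    have K: "K = index_set (2 * x / real n)" by (simp add: K_def index_set_def)
    have "(\<Sum>m\<in>{m\<in>X. n < m}. \<Sum>k\<in>N m n. ?g m n k) = (\<Sum>(m, k)\<in>Sigma {m\<in>X. n < m} (\<lambda>m. N m n). ?g m n k)"
      using fX finN[OF _ n] by (subst sum.Sigma) auto
    also have "\<dots> \<le> (\<Sum>(k, m)\<in>Sigma K (\<lambda>k. {m\<in>X. m \<noteq> k * n}). ?g m n k)"
    proof (rule sum_le_included[where i = prod.swap])
      show "finite (Sigma {m\<in>X. n < m} (\<lambda>m. N m n))" using fX finN[OF _ n] by auto
      show "finite (Sigma K (\<lambda>k. {m\<in>X. m \<noteq> k * n}))" using fX by (intro finite_SigmaI) (auto simp: K)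
      show "\<forall>y\<in>Sigma K (\<lambda>k. {m\<in>X. m \<noteq> k * n}). 0 \<le> (case y of (k, m) \<Rightarrow> ?g m n k)"
        by (auto simp: mangoldt_nonneg)
      show "\<forall>p\<in>Sigma {m\<in>X. n < m} (\<lambda>m. N m n). \<exists>q\<in>Sigma K (\<lambda>k. {m\<in>X. m \<noteq> k * n}). prod.swap q = p \<and>
          (case p of (m, k) \<Rightarrow> ?g m n k) \<le> (case q of (k, m) \<Rightarrow> ?g m n k)"
      proof (clarify, goal_cases)
        case (1 m k)
        note nk = Nk[OF 1(2) n 1(1)]
        show ?case by (rule bexI[of _ "(k, m)"]) (use nk 1 in \<open>auto simp: K_def\<close>)
      qed
    qed
    also have "\<dots> = (\<Sum>k\<in>K. \<Sum>m\<in>{m\<in>X. m \<noteq> k * n}. ?g m n k)"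
      using fX by (subst sum.Sigma) (auto simp: K)
    also have "\<dots> \<le> (\<Sum>k\<in>K. ?l * ?h)"
    proof (rule sum_mono)
      fix k assume "k \<in> K"
      hence k: "0 < k" "real k \<le> 2 * x / real n" by (auto simp: K_def)
      have kn: "real (k * n) \<le> 2 * x" using k Xx[OF n] by (simp add: field_simps)
      have "1 * real k \<le> real n * real k" using Xx[OF n] by (intro mult_right_mono) auto
      hence k2: "real k \<le> 2 * x" using kn by (simp add: mult.commute)
      have "(\<Sum>m\<in>{m\<in>X. m \<noteq> k * n}. ?g m n k) = mangoldt k * (\<Sum>m\<in>{m\<in>X. m \<noteq> k * n}. 1 / \<bar>real (k * n) - real m\<bar>)"
        unfolding sum_distrib_left by (intro sum.cong refl) (simp add: abs_minus_commute)
      also have "\<dots> \<le> ?l * ?h"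
      proof (intro mult_mono sum_inverse_dist_le)
        have "mangoldt k \<le> ln (real k)" by (rule mangoldt_le_ln)
        also have "\<dots> \<le> ?l" using k k2 by (subst ln_le_cancel_iff) auto
        finally show "mangoldt k \<le> ?l" .
        show "m \<noteq> k * n \<and> \<bar>real (k * n) - real m\<bar> \<le> 2 * x" if "m \<in> {m\<in>X. m \<noteq> k * n}" for m
          using that Xx[of m] kn x by (auto simp: abs_le_iff simp del: of_nat_mult intro: order_trans[of _ "real (k * n)"] order_trans[of _ "real m"])
      qed (use fX x l in \<open>auto intro!: sum_nonneg\<close>)
      finally show "(\<Sum>m\<in>{m\<in>X. m \<noteq> k * n}. ?g m n k) \<le> ?l * ?h" .
    qed
    also have "\<dots> = real (card K) * (?l * ?h)" by simp
    also have "\<dots> \<le> 2 * x / real n * (?l * ?h)"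
      using l h x unfolding K by (intro mult_right_mono card_index_set_le mult_nonneg_nonneg) auto
    finally show ?thesis .
  qed
  have B: "B \<ge> 0" unfolding B_def by (intro sum_nonneg) auto
  have "(\<Sum>(m, n)\<in>{(m, n). m \<in> X \<and> n \<in> X \<and> n < m}. b m * b n * (\<Sum>k\<in>N m n. ?g m n k)) \<le>
    ((\<Sum>m\<in>X. (b m)\<^sup>2 * (\<Sum>n\<in>{n\<in>X. n < m}. \<Sum>k\<in>N m n. ?g m n k)) + (\<Sum>n\<in>X. (b n)\<^sup>2 * (\<Sum>m\<in>{m\<in>X. n < m}. \<Sum>k\<in>N m n. ?g m n k))) / 2"
    by (rule sum_pairs_AM_GM[OF fX]) (auto intro!: sum_nonneg simp: mangoldt_nonneg)
  also have "\<dots> \<le> ((\<Sum>m\<in>X. (b m)\<^sup>2 * (?l * ?h)) + (\<Sum>n\<in>X. (b n)\<^sup>2 * (2 * x / real n * (?l * ?h)))) / 2"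
    by (intro divide_right_mono add_mono sum_mono mult_left_mono row col) auto
  also have "(\<Sum>m\<in>X. (b m)\<^sup>2 * (?l * ?h)) = (\<Sum>m\<in>X. (b m)\<^sup>2) * (?l * ?h)" by (simp add: sum_distrib_right)
  also have "(\<Sum>n\<in>X. (b n)\<^sup>2 * (2 * x / real n * (?l * ?h))) = 2 * (x * B) * (?l * ?h)"
    unfolding B_def X_def sum_distrib_left sum_distrib_right by (intro sum.cong refl) simp
  also have "((\<Sum>m\<in>X. (b m)\<^sup>2) * (?l * ?h) + 2 * (x * B) * (?l * ?h)) / 2 \<le> ((x * B) * (?l * ?h) + 2 * (x * B) * (?l * ?h)) / 2"
  proof -
    have "(\<Sum>m\<in>X. (b m)\<^sup>2) \<le> x * B" unfolding X_def B_def by (rule sum_squares_index_set_le)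
    hence "(\<Sum>m\<in>X. (b m)\<^sup>2) * (?l * ?h) \<le> (x * B) * (?l * ?h)" by (rule mult_right_mono) (use l h in simp)
    thus ?thesis by (intro divide_right_mono add_right_mono) auto
  qed
  also have "\<dots> \<le> 2 * (x * B) * (?l * ?h)"
    using mult_nonneg_nonneg[OF mult_nonneg_nonneg[of x B] mult_nonneg_nonneg[OF l h]] B x by (simp add: field_simps)
  finally show ?thesis .
qed

text \<open>Division by \<open>m\<close> sorts the four errors into three kernels: what is at most a
  multiple of \<open>y\<close> gives \<open>1 / n\<close> because \<open>y / m = 1 / n\<close>;
  \<open>1 / ln y \<le> m / (m - n)\<close> gives \<open>1 / (m - n)\<close>; in the near term the
  powers of \<open>m\<close> and \<open>n\<close> cancel completely. Each kernel has its own
  bilinear bound.\<close>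

lemma error_sum_bound:
  fixes b :: "nat \<Rightarrow> real"
  assumes x: "x \<ge> 2" and T: "T \<ge> 12" and b: "\<And>n. b n \<ge> 0"
  defines "X \<equiv> index_set x" and "B \<equiv> \<Sum>n\<in>index_set x. (b n)\<^sup>2 / real n" and "c \<equiv> 1 + 1 / (10 + ln x)"
  shows "(\<Sum>(m, n)\<in>{(m, n). m \<in> X \<and> n \<in> X \<and> n < m}. b m * b n / real m *
      ((real m / real n) powr c / (c - 1) + (real m / real n) powr c * (ln T * sqrt (ln T)) + ln T / ln (real m / real n)
          + (real m / real n) * (\<Sum>k | real m / real n / 2 < real k \<and> real k < 2 * (real m / real n) \<and> real k \<noteq> real m / real n.
                mangoldt k / \<bar>real m / real n - real k\<bar>)))
    \<le> 90 * (x * (ln (x * T))\<^sup>2 * B)"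
proof -
  let ?P = "{(m, n). m \<in> X \<and> n \<in> X \<and> n < m}"
  define near where "near = (\<lambda>m n. {k. real m / real n / 2 < real k \<and> real k < 2 * (real m / real n) \<and> real k \<noteq> real m / real n})"
  define l where "l = ln (x * T)"
  define S where "S = x * B"
  have fX: "finite X" by (simp add: X_def)
  have B: "B \<ge> 0" unfolding B_def by (intro sum_nonneg) auto
  have S: "S \<ge> 0" using B x by (simp add: S_def)
  have lx: "ln x \<ge> 0" using x by simp
  have lT: "ln T \<ge> 1" using T by (intro ln_ge_1) simp
  have lsum: "l = ln x + ln T" using x T by (simp add: l_def ln_mult)
  have l1: "l \<ge> 1" "ln x \<le> l" "ln T \<le> l" using lx lT lsum by auto
  have "ln (2::real) \<le> ln T" using T by simp
  moreover have "ln (2 * x) = ln 2 + ln x" using x by (simp add: ln_mult)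
  ultimately have l2x: "ln (2 * x) \<le> l" using lsum by linarith
  have c: "c > 1" "1 / (c - 1) = 10 + ln x" using lx by (auto simp: c_def)
  \<comment> \<open>Bound for the coefficient of the kernel \<open>1 / n\<close>: the factor 3 comes
    from \<open>y powr c \<le> 3 * y\<close>, and \<open>10 + ln x\<close> is
    \<open>1 / (c - 1)\<close>.\<close>
  define U where "U = 3 * ((10 + ln x) + ln T * sqrt (ln T))"
  have U: "U \<ge> 0" using lx lT by (simp add: U_def)
  have bound: "b m * b n / real m *
      ((real m / real n) powr c / (c - 1) + (real m / real n) powr c * (ln T * sqrt (ln T)) + ln T / ln (real m / real n)
          + (real m / real n) * (\<Sum>k\<in>near m n. mangoldt k / \<bar>real m / real n - real k\<bar>))
     \<le> U * (b m * b n / real n) + ln T * (b m * b n * (1 / (real m - real n)))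
       + b m * b n * (\<Sum>k\<in>near m n. mangoldt k / \<bar>real m - real (k * n)\<bar>)"
    if mn: "m \<in> X" "n \<in> X" "n < m" for m n
  proof -
    have pn: "real n > 0" "real m > 0" "real n < real m" "real m \<le> x" "real n \<ge> 1" using mn by (auto simp: X_def index_set_def)
    define y where "y = real m / real n"
    have y: "y > 1" "y \<le> x"
    proof -
      show "y > 1" using pn by (simp add: y_def)
      have "real m / real n \<le> real m / 1" using pn by (intro divide_left_mono) auto
      thus "y \<le> x" using pn by (simp add: y_def)
    qed
    have my: "y / real m = 1 / real n" using pn by (simp add: y_def)
    have bb: "b m * b n \<ge> 0" using b by simp
    \<comment> \<open>This is where \<open>c\<close> is adapted to \<open>x\<close>: since
      \<open>y \<le> x\<close>, the excess power is at most
      \<open>exp (ln x / (10 + ln x)) \<le> exp 1\<close>.\<close>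
    have "y powr c = y powr 1 * y powr (1 / (10 + ln x))" unfolding c_def by (rule powr_add)
    also have "y powr (1 / (10 + ln x)) \<le> x powr (1 / (10 + ln x))" using y lx by (intro powr_mono2) auto
    also have "x powr (1 / (10 + ln x)) = exp (ln x / (10 + ln x))" using x by (simp add: powr_def)
    also have "\<dots> \<le> exp 1" using lx by simp
    also have "\<dots> \<le> 3" using exp_le .
    finally have yc: "y powr c \<le> 3 * y" using y by simp
    have "y powr c / (c - 1) + y powr c * (ln T * sqrt (ln T)) = y powr c * ((10 + ln x) + ln T * sqrt (ln T))"
      unfolding c(2)[symmetric] by (simp add: algebra_simps)
    also have "\<dots> \<le> 3 * y * ((10 + ln x) + ln T * sqrt (ln T))" using yc lx lT by (intro mult_right_mono) auto
    finally have e1: "y powr c / (c - 1) + y powr c * (ln T * sqrt (ln T)) \<le> U * y" by (simp add: U_def mult_ac)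
    have "1 - 1 / y \<le> ln y" using y by (intro one_minus_inverse_le_ln) auto
    hence "(real m - real n) / real m \<le> ln y" using pn by (simp add: y_def diff_divide_distrib)
    moreover have "(real m - real n) / real m > 0" using pn by simp
    ultimately have "ln T / ln y \<le> ln T / ((real m - real n) / real m)" using lT by (intro divide_left_mono mult_pos_pos) auto
    hence e3: "ln T / ln y \<le> ln T * real m / (real m - real n)" by simp
    have e4: "(\<Sum>k\<in>near m n. mangoldt k / \<bar>y - real k\<bar>) = real n * (\<Sum>k\<in>near m n. mangoldt k / \<bar>real m - real (k * n)\<bar>)"
      unfolding sum_distrib_left
    proof (intro sum.cong refl)
      fix k
      have "y - real k = (real m - real (k * n)) / real n" using pn by (simp add: y_def field_simps)
      hence "\<bar>y - real k\<bar> = \<bar>real m - real (k * n)\<bar> / real n" using pn by (simp add: abs_divide)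
      thus "mangoldt k / \<bar>y - real k\<bar> = real n * (mangoldt k / \<bar>real m - real (k * n)\<bar>)" by simp
    qed
    let ?N = "\<Sum>k\<in>near m n. mangoldt k / \<bar>real m - real (k * n)\<bar>"
    have "b m * b n / real m * (y powr c / (c - 1) + y powr c * (ln T * sqrt (ln T)) + ln T / ln y + y * (real n * ?N))
       \<le> b m * b n / real m * (U * y + ln T * real m / (real m - real n) + y * (real n * ?N))"
      using e1 e3 bb pn y by (intro mult_left_mono add_mono) auto
    also have "\<dots> = U * (b m * b n) * (y / real m) + ln T * (b m * b n * (1 / (real m - real n))) * (real m / real m) + b m * b n * ?N * (y / real m * real n)"
      by (simp add: algebra_simps)
    also have "\<dots> = U * (b m * b n / real n) + ln T * (b m * b n * (1 / (real m - real n))) + b m * b n * ?N"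
      using pn unfolding my by simp
    finally show ?thesis unfolding e4[symmetric] unfolding y_def .
  qed
  have "(\<Sum>(m, n)\<in>?P. b m * b n / real m *
      ((real m / real n) powr c / (c - 1) + (real m / real n) powr c * (ln T * sqrt (ln T)) + ln T / ln (real m / real n)
          + (real m / real n) * (\<Sum>k\<in>near m n. mangoldt k / \<bar>real m / real n - real k\<bar>)))
     \<le> (\<Sum>(m, n)\<in>?P. U * (b m * b n / real n) + ln T * (b m * b n * (1 / (real m - real n)))
       + b m * b n * (\<Sum>k\<in>near m n. mangoldt k / \<bar>real m - real (k * n)\<bar>))"
    by (intro sum_mono) (use bound in \<open>auto simp del: of_nat_mult\<close>)
  also have "\<dots> = U * (\<Sum>(m, n)\<in>?P. b m * b n / real n) + ln T * (\<Sum>(m, n)\<in>?P. b m * b n * (1 / (real m - real n)))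
       + (\<Sum>(m, n)\<in>?P. b m * b n * (\<Sum>k\<in>near m n. mangoldt k / \<bar>real m - real (k * n)\<bar>))"
  proof -
    have "(\<Sum>(m, n)\<in>Q. U * f m n + t * g m n + h m n) = U * (\<Sum>(m, n)\<in>Q. f m n) + t * (\<Sum>(m, n)\<in>Q. g m n) + (\<Sum>(m, n)\<in>Q. h m n)"
      for Q :: "(nat \<times> nat) set" and f g h and t :: real
      by (simp add: case_prod_beta sum.distrib sum_distrib_left)
    thus ?thesis .
  qed
  also have "\<dots> \<le> U * (sqrt (1 + ln x) * S) + ln T * (2 * (1 + ln (2 * x)) * S) + 2 * S * (ln (2 * x) * (2 * (1 + ln (2 * x))))"
  proof (intro add_mono mult_left_mono)
    have "(\<Sum>(m, n)\<in>?P. b m * b n / real n) = (\<Sum>m\<in>X. \<Sum>n\<in>{n\<in>X. n < m}. b m * b n / real n)" by (rule sum_pairs_less(1)[OF fX])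
    also have "\<dots> \<le> (\<Sum>m\<in>X. \<Sum>n\<in>X. b m * b n / real n)" using fX b by (intro sum_mono sum_mono2) auto
    also have "\<dots> \<le> x * sqrt (1 + ln x) * B" unfolding X_def B_def using x b by (intro l1_bilinear_bound) auto
    finally show "(\<Sum>(m, n)\<in>?P. b m * b n / real n) \<le> sqrt (1 + ln x) * S" by (simp add: S_def mult_ac)
    show "(\<Sum>(m, n)\<in>?P. b m * b n * (1 / (real m - real n))) \<le> 2 * (1 + ln (2 * x)) * S"
      unfolding X_def B_def S_def using x by (intro hilbert_type_bound) auto
    show "(\<Sum>(m, n)\<in>?P. b m * b n * (\<Sum>k\<in>near m n. mangoldt k / \<bar>real m - real (k * n)\<bar>)) \<le> 2 * S * (ln (2 * x) * (2 * (1 + ln (2 * x))))"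
      unfolding X_def B_def S_def near_def using x by (intro near_diagonal_bound) auto
  qed (use U lT in auto)
  also have "\<dots> \<le> 90 * (l\<^sup>2 * S)"
  proof -
    have "sqrt (1 + ln x) \<le> sqrt (2 * l)" using l1 by simp
    also have "\<dots> = sqrt 2 * sqrt l" by (simp add: real_sqrt_mult)
    also have "\<dots> \<le> 2 * sqrt l" using l1 sqrt2_less_2 by (intro mult_right_mono) auto
    finally have s1: "sqrt (1 + ln x) \<le> 2 * sqrt l" .
    have sl: "sqrt l \<le> l" "sqrt l * sqrt l = l" using l1 by (auto intro: real_sqrt_le_iff[THEN iffD2] sqrt_le_D simp: real_sqrt_le_iff) (smt (verit) mult_left_mono mult_cancel_left1 real_le_lsqrt power2_eq_square)
    have "10 + ln x \<le> 11 * l" using l1 by linarith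
    hence u1: "(10 + ln x) * sqrt (1 + ln x) \<le> (11 * l) * (2 * l)"
      using s1 sl lx l1 by (intro mult_mono) auto
    have "ln T * sqrt (ln T) * sqrt (1 + ln x) \<le> l * sqrt l * (2 * sqrt l)"
      using s1 l1 lT lx by (intro mult_mono) auto
    also have "\<dots> = 2 * l * l" using sl(2) by (simp add: mult_ac)
    finally have u2: "ln T * sqrt (ln T) * sqrt (1 + ln x) \<le> 2 * l * l" .
    have "U * sqrt (1 + ln x) = 3 * ((10 + ln x) * sqrt (1 + ln x) + ln T * sqrt (ln T) * sqrt (1 + ln x))"
      by (simp add: U_def algebra_simps)
    also have "\<dots> \<le> 3 * ((11 * l) * (2 * l) + 2 * l * l)" by (intro mult_left_mono add_mono u1 u2) simp
    finally have v1: "U * sqrt (1 + ln x) \<le> 72 * (l * l)" by simp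
    have h: "1 + ln (2 * x) \<le> 2 * l" "1 + ln (2 * x) \<ge> 0" "ln (2 * x) \<ge> 0" using l2x l1 x by auto
    have v2: "ln T * (2 * (1 + ln (2 * x))) \<le> l * (2 * (2 * l))" using l1 lT h by (intro mult_mono) auto
    have v3: "2 * (ln (2 * x) * (2 * (1 + ln (2 * x)))) \<le> 2 * (l * (2 * (2 * l)))" using l1 h l2x by (intro mult_mono) auto
    have "U * (sqrt (1 + ln x) * S) + ln T * (2 * (1 + ln (2 * x)) * S) + 2 * S * (ln (2 * x) * (2 * (1 + ln (2 * x)))) =
       (U * sqrt (1 + ln x) + ln T * (2 * (1 + ln (2 * x))) + 2 * (ln (2 * x) * (2 * (1 + ln (2 * x))))) * S"
      by (simp add: algebra_simps)
    also have "\<dots> \<le> (90 * (l * l)) * S"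
    proof (rule mult_right_mono[OF _ S])
      \<comment> \<open>The three kernels contribute 72, 4 and 8 multiples of
        \<open>l * l\<close>.\<close>
      have "72 * (l * l) + l * (2 * (2 * l)) + 2 * (l * (2 * (2 * l))) \<le> 90 * (l * l)" using zero_le_square[of l] by (simp add: algebra_simps)
      thus "U * sqrt (1 + ln x) + ln T * (2 * (1 + ln (2 * x))) + 2 * (ln (2 * x) * (2 * (1 + ln (2 * x)))) \<le> 90 * (l * l)"
        using v1 v2 v3 by linarith
    qed
    finally show ?thesis by (simp add: power2_eq_square mult_ac)
  qed
  finally show ?thesis unfolding near_def S_def l_def by (simp add: mult_ac)
qed

text \<open>Substitute \<open>m = k * n\<close>. As \<open>mangoldt 1 = 0\<close>, only
  \<open>k > 1\<close> counts, so \<open>n < m\<close> and the sum runs over the same pairs as the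
  off-diagonal terms.\<close>

lemma mangoldt_pair_sum:
  fixes a :: "nat \<Rightarrow> complex" and x :: real
  defines "X \<equiv> index_set x"
  shows "(\<Sum>(k, n) | 0 < k \<and> 0 < n \<and> real (k * n) \<le> x. cnj (a (k * n)) * a n * mangoldt k / of_nat (k * n)) =
     (\<Sum>(m, n)\<in>{(m, n). m \<in> X \<and> n \<in> X \<and> n < m}. cnj (a m) * a n / of_nat m * of_real (\<Sum>k | real k = real m / real n. mangoldt k))"
proof -
  let ?P = "{(m, n). m \<in> X \<and> n \<in> X \<and> n < m}"
  let ?Q = "{(k, n). 0 < k \<and> 0 < n \<and> real (k * n) \<le> x}" and ?Q' = "{(k, n). 1 < k \<and> 0 < n \<and> real (k * n) \<le> x}"
  let ?f = "\<lambda>(k, n). cnj (a (k * n)) * a n * mangoldt k / of_nat (k * n) :: complex"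
  have fX: "finite X" by (simp add: X_def)
  have finP: "finite ?P" by (rule finite_subset[of _ "X \<times> X"]) (use fX in auto)
  have "?Q \<subseteq> X \<times> X"
  proof clarify
    fix k n :: nat assume kn: "0 < k" "0 < n" "real (k * n) \<le> x"
    have "k \<le> k * n" "n \<le> k * n" using kn by auto
    from this[THEN of_nat_mono, THEN order_trans, OF kn(3)]
    show "k \<in> X \<and> n \<in> X" using kn(1,2) by (simp add: X_def index_set_def)
  qed
  hence finQ: "finite ?Q" by (rule finite_subset) (use fX in auto)
  have finK: "finite {k. real k = real m / real n}" for m n
    by (rule finite_subset[of _ "{nat \<lfloor>real m / real n\<rfloor>}"]) (auto, metis floor_of_nat nat_int)
  have "Suc 0 < k" if "mangoldt k \<noteq> (0 :: complex)" "0 < k" for k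
    using that by (cases "k = Suc 0") auto
  hence "sum ?f ?Q = sum ?f ?Q'"
    by (intro sum.mono_neutral_right[OF finQ]) auto
  also have "\<dots> = (\<Sum>((m, n), k)\<in>Sigma ?P (\<lambda>(m, n). {k. real k = real m / real n}). cnj (a m) * a n / of_nat m * mangoldt k)"
  proof (rule sum.reindex_bij_witness[of _ "\<lambda>((m, n), k). (k, n)" "\<lambda>(k, n). ((k * n, n), k)"], goal_cases)
    case (2 p)
    obtain k n where p: "p = (k, n)" "1 < k" "0 < n" "real (k * n) \<le> x" using 2 by auto
    have nk: "n < k * n" using p by simp
    hence "real n \<le> x" using p(4) of_nat_less_iff[of n "k * n", where ?'a = real] by linarith
    with p nk show ?case by (simp add: X_def index_set_def)
  next
    case (4 q)
    obtain m n k where q: "q = ((m, n), k)" "m \<in> X" "n \<in> X" "n < m" "real k = real m / real n" using 4 by auto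
    have n0: "n > 0" using q by (auto simp: X_def index_set_def)
    hence "real k * real n = real m" using q by simp
    hence kn: "k * n = m" by (metis of_nat_eq_iff of_nat_mult)
    have "k \<noteq> 0" "k \<noteq> 1" using kn q by auto
    thus ?case using q kn n0 by (auto simp: X_def index_set_def simp del: of_nat_mult)
  next
    case (3 q)
    obtain m n k where q: "q = ((m, n), k)" "m \<in> X" "n \<in> X" "n < m" "real k = real m / real n" using 3 by auto
    have n0: "n > 0" using q by (auto simp: X_def index_set_def)
    hence "real k * real n = real m" using q by simp
    hence kn: "k * n = m" by (metis of_nat_eq_iff of_nat_mult)
    thus ?case using q by simp
  qed auto
  also have "\<dots> = (\<Sum>p\<in>?P. \<Sum>k\<in>(case p of (m, n) \<Rightarrow> {k. real k = real m / real n}). case p of (m, n) \<Rightarrow> cnj (a m) * a n / of_nat m * mangoldt k)"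
    using finP finK by (subst sum.Sigma) (auto simp: case_prod_beta)
  also have "\<dots> = (\<Sum>(m, n)\<in>?P. cnj (a m) * a n / of_nat m * of_real (\<Sum>k | real k = real m / real n. mangoldt k))"
    by (intro sum.cong refl) (auto simp: sum_distrib_left)
  finally show ?thesis .
qed

section \<open>Size of the resonant sum, and assembly of the estimates\<close>

lemma mangoldt_at_le_ln:
  assumes "y \<ge> 1"
  shows "(\<Sum>k | real k = y. mangoldt k) \<le> ln y" "(\<Sum>k | real k = y. mangoldt k :: real) \<ge> 0"
proof -
  show "(\<Sum>k | real k = y. mangoldt k) \<le> ln y"
  proof (cases "\<exists>k. real k = y")
    case True
    then obtain k where k: "real k = y" by blast
    hence "{k. real k = y} = {k}" by auto
    thus ?thesis using mangoldt_le_ln[of k] k by simp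
  next
    case False
    hence "{k. real k = y} = {}" by auto
    thus ?thesis using assms by (simp only: sum.empty) simp
  qed
  show "(\<Sum>k | real k = y. mangoldt k :: real) \<ge> 0" by (intro sum_nonneg mangoldt_nonneg)
qed

text \<open>Allows the coefficient of the main term to change by a bounded amount: the contour
  produces \<open>T1 - T0\<close> where \<open>T\<close> is wanted.\<close>

lemma mangoldt_pair_sum_bound:
  fixes a :: "nat \<Rightarrow> complex"
  assumes x: "x \<ge> 1"
  shows "norm (\<Sum>(k, n) | 0 < k \<and> 0 < n \<and> real (k * n) \<le> x. cnj (a (k * n)) * a n * mangoldt k / of_nat (k * n))
     \<le> ln x * (x * sqrt (1 + ln x) * (\<Sum>n\<in>index_set x. (cmod (a n))\<^sup>2 / real n))"
proof -
  let ?X = "index_set x"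
  let ?P = "{(m, n). m \<in> ?X \<and> n \<in> ?X \<and> n < m}"
  have "norm (\<Sum>(m, n)\<in>?P. cnj (a m) * a n / of_nat m * of_real (\<Sum>k | real k = real m / real n. mangoldt k))
     \<le> (\<Sum>(m, n)\<in>?P. ln x * (cmod (a m) * cmod (a n) / real n))"
  proof (rule sum_norm_le, clarify)
    fix m n assume mn: "m \<in> ?X" "n \<in> ?X" "n < m"
    have pn: "real n > 0" "real n < real m" "real m \<le> x" "1 \<le> real n" using mn by (auto simp: index_set_def)
    let ?L = "\<Sum>k | real k = real m / real n. mangoldt k :: real"
    have y1: "real m / real n \<ge> 1" using pn by simp
    have "real m / real n \<le> real m / 1" using pn by (intro divide_left_mono) auto
    hence "real m / real n \<le> x" using pn by linarith
    hence "ln (real m / real n) \<le> ln x" using y1 by (subst ln_le_cancel_iff) auto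
    hence L: "?L \<le> ln x" "?L \<ge> 0" using mangoldt_at_le_ln[OF y1] by linarith+
    have "norm (cnj (a m) * a n / of_nat m * of_real ?L) = ?L * (cmod (a m) * cmod (a n) / real m)"
      using L by (simp add: norm_mult norm_divide del: of_real_sum)
    also have "\<dots> \<le> ln x * (cmod (a m) * cmod (a n) / real n)"
      using L pn x by (intro mult_mono divide_left_mono) auto
    finally show "norm (cnj (a m) * a n / of_nat m * of_real ?L) \<le> ln x * (cmod (a m) * cmod (a n) / real n)" .
  qed
  also have "\<dots> = ln x * (\<Sum>m\<in>?X. \<Sum>n\<in>{n\<in>?X. n < m}. cmod (a m) * cmod (a n) / real n)"
    unfolding sum_pairs_less(1)[OF finite_index_set] sum_distrib_left ..
  also have "\<dots> \<le> ln x * (\<Sum>m\<in>?X. \<Sum>n\<in>?X. cmod (a m) * cmod (a n) / real n)"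
    using x by (intro mult_left_mono sum_mono sum_mono2) auto
  also have "\<dots> \<le> ln x * (x * sqrt (1 + ln x) * (\<Sum>n\<in>?X. (cmod (a n))\<^sup>2 / real n))"
    using x by (intro mult_left_mono l1_bilinear_bound) auto
  finally show ?thesis unfolding mangoldt_pair_sum .
qed

theorem theorem3p1:
  assumes "Riemann_Hypothesis"
  shows "\<exists>C::real. \<forall>(x::real) (T::real) (a::nat \<Rightarrow> complex). x \<ge> 2 \<longrightarrow> T > 1 \<longrightarrow>
    \<bar>(\<Sum>\<rho>\<in>zeros_upto T. real (zero_mult \<rho>) *
          (cmod (\<Sum>n | 0 < n \<and> real n \<le> x. a n / of_nat n powr \<rho>))\<^sup>2)
      - (real (zero_count T) * (\<Sum>n | 0 < n \<and> real n \<le> x. (cmod (a n))\<^sup>2 / real n)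
         - T / pi * Re (\<Sum>(k, n) | 0 < k \<and> 0 < n \<and> real (k * n) \<le> x.
                           cnj (a (k * n)) * a n * mangoldt k / of_nat (k * n)))\<bar>
    \<le> C * (x * (ln (x * T))\<^sup>2 * (\<Sum>n | 0 < n \<and> real n \<le> x. (cmod (a n))\<^sup>2 / real n))"
proof -
  note RH = assms
  obtain C T0 where C: "C > 0" and T0: "T0 \<in> {10..11}" and
    LG: "\<And>T. T \<ge> 12 \<Longrightarrow> \<exists>T1\<in>{T..T+1}. \<forall>c y. 1 < c \<longrightarrow> c \<le> 11 / 10 \<longrightarrow> 1 < y \<longrightarrow>
     norm (2 * pi * \<i> * (\<Sum>\<rho>\<in>zeros_upto T1 - zeros_upto T0. of_nat (zero_mult \<rho>) * of_real y powr \<rho>)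
        + \<i> * of_real (T1 - T0) * of_real (\<Sum>k | real k = y. mangoldt k))
     \<le> C * (y powr c / (c - 1) + y powr c * (ln T * sqrt (ln T)) + ln T / ln y
          + y * (\<Sum>k | y / 2 < real k \<and> real k < 2 * y \<and> real k \<noteq> y. mangoldt k / \<bar>y - real k\<bar>))"
    using landau_gonek[OF RH] by blast
  obtain W where W: "W > 0" and wz: "\<And>T. T \<ge> 10 \<Longrightarrow> real (\<Sum>\<rho>\<in>zeros_upto (T + 1) - zeros_upto T. zero_mult \<rho>) \<le> W * ln T"
    using window_zero_count[OF RH] by blast
  \<comment> \<open>An absolute constant. It bounds the number of zeros below \<open>T0\<close>, and
    the number of all zeros under consideration when \<open>T < 12\<close>.\<close>
  define NZ where "NZ = real (zero_count 12)"
  \<comment> \<open>\<open>180 * C\<close> is twice the constant 90 of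
    \<open>error_sum_bound\<close>, because the off-diagonal pairs enter with a factor 2. The others
    come from zeros up to 12 (with \<open>1 \<le> 4 * l^2\<close>), zeros between \<open>T\<close>
    and \<open>T1\<close> (with \<open>l \<le> 2 * l^2\<close>), and the changed coefficient of the
    main term.\<close>
  define K where "K = 180 * C + 4 * NZ + 2 * W + 12"
  have finz: "finite (zeros_upto T)" for T by (rule finite_zeros_upto[OF RH])
  have mono: "zeros_upto T \<subseteq> zeros_upto T'" if "T \<le> T'" for T T' using that by (auto simp: zeros_upto_def)
  have Rez: "Re \<rho> = 1 / 2" if "\<rho> \<in> zeros_upto T" for \<rho> T
    using that RH by (auto simp: zeros_upto_def Riemann_Hypothesis_def)
  have NZ: "NZ \<ge> 0" by (simp add: NZ_def)
  have small: "real (\<Sum>\<rho>\<in>zeros_upto T. zero_mult \<rho>) \<le> NZ" if "T \<le> 12" for T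
    unfolding NZ_def zero_count_def by (intro of_nat_mono sum_mono2 finz mono that) auto
  have "\<bar>(\<Sum>\<rho>\<in>zeros_upto T. real (zero_mult \<rho>) * (cmod (\<Sum>n\<in>index_set x. a n / of_nat n powr \<rho>))\<^sup>2)
      - (real (zero_count T) * (\<Sum>n\<in>index_set x. (cmod (a n))\<^sup>2 / real n)
         - T / pi * Re (\<Sum>(k, n) | 0 < k \<and> 0 < n \<and> real (k * n) \<le> x. cnj (a (k * n)) * a n * mangoldt k / of_nat (k * n)))\<bar>
    \<le> K * (x * (ln (x * T))\<^sup>2 * (\<Sum>n\<in>index_set x. (cmod (a n))\<^sup>2 / real n))"
    if x: "x \<ge> 2" and T: "T > 1" for x T and a :: "nat \<Rightarrow> complex"
  proof -
    let ?X = "index_set x"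
    let ?P = "{(m, n). m \<in> ?X \<and> n \<in> ?X \<and> n < m}"
    define B where "B = (\<Sum>n\<in>?X. (cmod (a n))\<^sup>2 / real n)"
    define S where "S = x * B"
    define l where "l = ln (x * T)"
    define M where "M = (\<Sum>(k, n) | 0 < k \<and> 0 < n \<and> real (k * n) \<le> x. cnj (a (k * n)) * a n * mangoldt k / of_nat (k * n))"
    \<comment> \<open>Subtracting the diagonal at every zero cancels the term with
      \<open>zero_count T\<close> exactly. The weighted sum \<open>D\<close> is additive in the set
      of zeros, which allows cuts at \<open>T0\<close>, \<open>T\<close> and
      \<open>T1\<close>.\<close>
    define dev where "dev = (\<lambda>\<rho>. (cmod (\<Sum>n\<in>?X. a n / of_nat n powr \<rho>))\<^sup>2 - B)"
    define D where "D = (\<lambda>Z. \<Sum>\<rho>\<in>Z. real (zero_mult \<rho>) * dev \<rho>)"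
    have B: "B \<ge> 0" unfolding B_def by (intro sum_nonneg) auto
    have "1 * B \<le> S" unfolding S_def using x B by (intro mult_right_mono) auto
    hence S: "S \<ge> 0" "B \<le> S" using B by auto
    have lsum: "l = ln x + ln T" using x T by (simp add: l_def ln_mult)
    have "1 - 1 / 2 \<le> ln (2::real)" by (rule one_minus_inverse_le_ln) simp
    moreover have "ln 2 \<le> ln x" using x by simp
    moreover have "ln T > 0" using T by simp
    ultimately have l: "l \<ge> 1 / 2" "ln x \<le> l" "ln x \<ge> 0" "ln T \<le> l" using lsum by auto
    have "1 * 1 \<le> (2 * l) * (2 * l)" using l by (intro mult_mono) auto
    hence l2: "1 \<le> 4 * l\<^sup>2" by (simp add: power2_eq_square)
    have "1 * l \<le> 2 * l * l" using l by (intro mult_right_mono) auto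
    hence ll2: "l \<le> 2 * l\<^sup>2" by (simp add: power2_eq_square)
    have S4: "S \<le> 4 * (l\<^sup>2 * S)" using mult_right_mono[OF l2 S(1)] by simp
    have X0: "0 \<notin> ?X" by (simp add: index_set_def)
    have dev_bd: "\<bar>dev \<rho>\<bar> \<le> S" if "\<rho> \<in> zeros_upto T'" for \<rho> T'
    proof -
      have "(cmod (\<Sum>n\<in>?X. a n / of_nat n powr \<rho>))\<^sup>2 \<le> real (card ?X) * B"
        unfolding B_def by (rule dirichlet_poly_squared(2)[OF finite_index_set X0 Rez[OF that]])
      also have "\<dots> \<le> S" unfolding S_def using x B by (intro mult_right_mono card_index_set_le) auto
      finally have "(cmod (\<Sum>n\<in>?X. a n / of_nat n powr \<rho>))\<^sup>2 \<le> S" .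
      moreover have "(cmod (\<Sum>n\<in>?X. a n / of_nat n powr \<rho>))\<^sup>2 \<ge> 0" by simp
      ultimately show ?thesis unfolding dev_def using B S by linarith
    qed
    have D_bd: "\<bar>D Z\<bar> \<le> S * real (\<Sum>\<rho>\<in>Z. zero_mult \<rho>)" if "Z \<subseteq> zeros_upto T'" for Z T'
    proof -
      have "\<bar>D Z\<bar> \<le> (\<Sum>\<rho>\<in>Z. \<bar>real (zero_mult \<rho>) * dev \<rho>\<bar>)" unfolding D_def by (rule sum_abs)
      also have "\<dots> \<le> (\<Sum>\<rho>\<in>Z. real (zero_mult \<rho>) * S)"
        using that dev_bd by (intro sum_mono) (auto simp: abs_mult intro!: mult_left_mono)
      finally show ?thesis by (simp add: sum_distrib_left mult.commute)
    qed
    have M_bd: "norm M \<le> 3 * (l\<^sup>2 * S)"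
    proof -
      have "sqrt (1 + ln x) \<le> sqrt ((1 + ln x) * (1 + ln x))" using l mult_right_mono[of 1 "1 + ln x" "1 + ln x"] by (intro real_sqrt_le_mono) auto
      hence sq: "sqrt (1 + ln x) \<le> 3 * l" using l by simp
      have "norm M \<le> ln x * (x * sqrt (1 + ln x) * B)"
        unfolding M_def B_def using x by (intro mangoldt_pair_sum_bound) auto
      also have "\<dots> = ln x * sqrt (1 + ln x) * S" by (simp add: S_def)
      also have "\<dots> \<le> l * (3 * l) * S" using l sq S by (intro mult_right_mono mult_mono) auto
      finally show ?thesis by (simp add: power2_eq_square)
    qed
    have M4: "\<bar>t / pi * Re M\<bar> \<le> 12 * (l\<^sup>2 * S)" if "0 \<le> t" "t \<le> 12" for t
    proof -
      have "t / pi \<le> 12 / 3" using that pi_gt3 by (intro frac_le) auto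
      hence "(t / pi) * \<bar>Re M\<bar> \<le> 4 * norm M" using that abs_Re_le_cmod[of M] by (intro mult_mono) auto
      hence "\<bar>t / pi * Re M\<bar> \<le> 4 * norm M" using that by (simp add: abs_mult)
      thus ?thesis using M_bd by linarith
    qed
    have lS: "l\<^sup>2 * S \<ge> 0" using S by simp
    have DN: "S * n \<le> NZ * (4 * (l\<^sup>2 * S))" if "n \<le> NZ" for n
    proof -
      have "S * n \<le> S * NZ" using that S by (intro mult_left_mono) auto
      also have "\<dots> \<le> NZ * (4 * (l\<^sup>2 * S))" using S4 NZ by (simp add: mult.commute mult_left_mono)
      finally show ?thesis .
    qed
    have "(\<Sum>\<rho>\<in>zeros_upto T. real (zero_mult \<rho>) * (cmod (\<Sum>n\<in>?X. a n / of_nat n powr \<rho>))\<^sup>2) - real (zero_count T) * B = D (zeros_upto T)"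
      by (simp add: D_def dev_def zero_count_def right_diff_distrib sum_subtractf sum_distrib_right)
    hence goal_eq: "(\<Sum>\<rho>\<in>zeros_upto T. real (zero_mult \<rho>) * (cmod (\<Sum>n\<in>?X. a n / of_nat n powr \<rho>))\<^sup>2)
       - (real (zero_count T) * B - T / pi * Re M) = D (zeros_upto T) + T / pi * Re M" by simp
    have "\<bar>D (zeros_upto T) + T / pi * Re M\<bar> \<le> K * (l\<^sup>2 * S)"
    proof (cases "T \<ge> 12")
      case False
      \<comment> \<open>For \<open>T < 12\<close> both the deviation and the main term are absorbed
        by the error term.\<close>
      have "\<bar>D (zeros_upto T)\<bar> \<le> NZ * (4 * (l\<^sup>2 * S))"
        using D_bd[OF order.refl, of T] DN[OF small[of T]] False by linarith
      moreover have "\<bar>T / pi * Re M\<bar> \<le> 12 * (l\<^sup>2 * S)" using False T by (intro M4) auto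
      moreover have "K * (l\<^sup>2 * S) = 180 * C * (l\<^sup>2 * S) + NZ * (4 * (l\<^sup>2 * S)) + 2 * W * (l\<^sup>2 * S) + 12 * (l\<^sup>2 * S)"
        by (simp add: K_def algebra_simps)
      moreover have "180 * C * (l\<^sup>2 * S) \<ge> 0" "2 * W * (l\<^sup>2 * S) \<ge> 0" using C W lS by auto
      ultimately show ?thesis by linarith
    next
      case T12: True
      from LG[OF T12] obtain T1 where T1: "T1 \<in> {T..T+1}" and
        LG': "\<And>c y. 1 < c \<Longrightarrow> c \<le> 11 / 10 \<Longrightarrow> 1 < y \<Longrightarrow>
         norm (2 * pi * \<i> * (\<Sum>\<rho>\<in>zeros_upto T1 - zeros_upto T0. of_nat (zero_mult \<rho>) * of_real y powr \<rho>)
            + \<i> * of_real (T1 - T0) * of_real (\<Sum>k | real k = y. mangoldt k))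
         \<le> C * (y powr c / (c - 1) + y powr c * (ln T * sqrt (ln T)) + ln T / ln y
              + y * (\<Sum>k | y / 2 < real k \<and> real k < 2 * y \<and> real k \<noteq> y. mangoldt k / \<bar>y - real k\<bar>))" by blast
      define Zs where "Zs = zeros_upto T1 - zeros_upto T0"
      define c where "c = 1 + 1 / (10 + ln x)"
      define Err where "Err = (\<lambda>y. y powr c / (c - 1) + y powr c * (ln T * sqrt (ln T)) + ln T / ln y
              + y * (\<Sum>k | y / 2 < real k \<and> real k < 2 * y \<and> real k \<noteq> y. mangoldt k / \<bar>y - real k\<bar>))"
      define Q where "Q = (\<lambda>y. \<Sum>\<rho>\<in>Zs. of_nat (zero_mult \<rho>) * of_real y powr \<rho>)"
      define Lam where "Lam = (\<lambda>y. of_real (\<Sum>k | real k = y. mangoldt k) :: complex)"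
      define w where "w = (\<lambda>m n. cnj (a m) * a n / of_nat m)"
      let ?d = "of_real ((T1 - T0) / (2 * pi)) :: complex"
      have "0 < 1 / (10 + ln x)" using l by simp
      moreover have "1 / (10 + ln x) \<le> 1 / 10" using l by (intro divide_left_mono) auto
      ultimately have c: "1 < c" "c \<le> 11 / 10" unfolding c_def by linarith+
      \<comment> \<open>The formula divided by \<open>2 * pi * \<i>\<close>; as
        \<open>2 * pi \<ge> 1\<close>, the constant \<open>C\<close> survives the division.\<close>
      have QL: "norm (Q y + ?d * Lam y) \<le> C * Err y" if y: "y > 1" for y
      proof -
        have "norm (Q y + ?d * Lam y) \<le> 2 * pi * norm (Q y + ?d * Lam y)"
          using mult_right_mono[of 1 "2 * pi" "norm (Q y + ?d * Lam y)"] pi_gt3 by simp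
        also have "\<dots> = norm (2 * pi * \<i> * (Q y + ?d * Lam y))" by (simp add: norm_mult)
        also have "2 * pi * \<i> * (Q y + ?d * Lam y) = 2 * pi * \<i> * Q y + \<i> * of_real (T1 - T0) * Lam y"
          by (simp add: field_simps)
        finally show ?thesis using LG'[OF c y] unfolding Q_def Zs_def Lam_def Err_def by linarith
      qed
      have DZs: "D Zs = 2 * Re (\<Sum>(m, n)\<in>?P. w m n * Q (real m / real n))"
      proof -
        have "D Zs = (\<Sum>\<rho>\<in>Zs. real (zero_mult \<rho>) * (2 * Re (\<Sum>(m, n)\<in>?P. w m n * of_real (real m / real n) powr \<rho>)))"
          unfolding D_def
        proof (intro sum.cong refl)
          fix \<rho> assume "\<rho> \<in> Zs"
          hence "Re \<rho> = 1 / 2" using Rez unfolding Zs_def by blast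
          from dirichlet_poly_squared(1)[OF finite_index_set X0 this, of a]
          show "real (zero_mult \<rho>) * dev \<rho> = real (zero_mult \<rho>) * (2 * Re (\<Sum>(m, n)\<in>?P. w m n * of_real (real m / real n) powr \<rho>))"
            unfolding dev_def B_def w_def by simp
        qed
        also have "\<dots> = 2 * Re (\<Sum>\<rho>\<in>Zs. of_nat (zero_mult \<rho>) * (\<Sum>(m, n)\<in>?P. w m n * of_real (real m / real n) powr \<rho>))"
          by (simp add: sum_distrib_left mult_ac del: of_real_divide)
        also have "(\<Sum>\<rho>\<in>Zs. of_nat (zero_mult \<rho>) * (\<Sum>(m, n)\<in>?P. w m n * of_real (real m / real n) powr \<rho>))
           = (\<Sum>p\<in>?P. \<Sum>\<rho>\<in>Zs. of_nat (zero_mult \<rho>) * (case p of (m, n) \<Rightarrow> w m n * of_real (real m / real n) powr \<rho>))"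
          unfolding sum_distrib_left by (rule sum.swap)
        also have "\<dots> = (\<Sum>(m, n)\<in>?P. w m n * Q (real m / real n))"
          unfolding Q_def sum_distrib_left by (intro sum.cong refl) (auto intro!: sum.cong)
        finally show ?thesis .
      qed
      have MP: "M = (\<Sum>(m, n)\<in>?P. w m n * Lam (real m / real n))"
        unfolding M_def w_def Lam_def by (rule mangoldt_pair_sum)
      have re2: "\<bar>2 * Re z\<bar> \<le> 2 * norm z" for z using abs_Re_le_cmod[of z] by (simp add: abs_mult)
      have "D Zs + (T1 - T0) / pi * Re M = 2 * Re (\<Sum>(m, n)\<in>?P. w m n * (Q (real m / real n) + ?d * Lam (real m / real n)))"
      proof -
        have "(\<Sum>(m, n)\<in>?P. w m n * (Q (real m / real n) + ?d * Lam (real m / real n))) =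
            (\<Sum>(m, n)\<in>?P. w m n * Q (real m / real n)) + ?d * M"
          unfolding MP by (simp add: case_prod_beta distrib_left sum.distrib sum_distrib_left mult_ac del: of_real_divide)
        moreover have "Re (?d * M) = (T1 - T0) / (2 * pi) * Re M" by (simp only: Re_complex_of_real times_complex.sel Im_complex_of_real)
        ultimately show ?thesis unfolding DZs by simp
      qed
      hence "\<bar>D Zs + (T1 - T0) / pi * Re M\<bar> \<le> 2 * norm (\<Sum>(m, n)\<in>?P. w m n * (Q (real m / real n) + ?d * Lam (real m / real n)))"
        by (simp only: re2)
      moreover have "norm (\<Sum>(m, n)\<in>?P. w m n * (Q (real m / real n) + ?d * Lam (real m / real n)))
          \<le> (\<Sum>(m, n)\<in>?P. C * (cmod (a m) * cmod (a n) / real m * Err (real m / real n)))"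
      proof (rule sum_norm_le, clarify)
        fix m n assume mn: "m \<in> ?X" "n \<in> ?X" "n < m"
        hence "real m / real n > 1" by (simp add: index_set_def)
        hence "norm (w m n) * norm (Q (real m / real n) + ?d * Lam (real m / real n)) \<le> norm (w m n) * (C * Err (real m / real n))"
          by (intro mult_left_mono QL) auto
        thus "norm (w m n * (Q (real m / real n) + ?d * Lam (real m / real n))) \<le> C * (cmod (a m) * cmod (a n) / real m * Err (real m / real n))"
          by (simp add: norm_mult norm_divide w_def mult_ac)
      qed
      moreover have "(\<Sum>(m, n)\<in>?P. C * (cmod (a m) * cmod (a n) / real m * Err (real m / real n))) = C * (\<Sum>(m, n)\<in>?P. cmod (a m) * cmod (a n) / real m * Err (real m / real n))"
        by (simp add: case_prod_beta sum_distrib_left)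
      moreover have "C * (\<Sum>(m, n)\<in>?P. cmod (a m) * cmod (a n) / real m * Err (real m / real n)) \<le> C * (90 * (x * l\<^sup>2 * B))"
        unfolding Err_def c_def l_def B_def using C by (intro mult_left_mono error_sum_bound[OF x T12]) auto
      moreover have "C * (90 * (x * l\<^sup>2 * B)) = 90 * C * (l\<^sup>2 * S)" by (simp add: S_def)
      ultimately have 1: "\<bar>D Zs + (T1 - T0) / pi * Re M\<bar> \<le> 180 * C * (l\<^sup>2 * S)" by linarith
      have T01: "T0 \<le> T1" "T0 \<le> 12" "T \<le> T1" using T0 T1 T12 by auto
      have 2: "\<bar>D (zeros_upto T0)\<bar> \<le> NZ * (4 * (l\<^sup>2 * S))"
        using D_bd[OF order.refl, of T0] DN[OF small[OF T01(2)]] by linarith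
      have 3: "\<bar>D (zeros_upto T1 - zeros_upto T)\<bar> \<le> 2 * W * (l\<^sup>2 * S)"
      proof -
        have "zeros_upto T1 - zeros_upto T \<subseteq> zeros_upto (T + 1) - zeros_upto T" using mono[of T1 "T + 1"] T1 by auto
        hence "(\<Sum>\<rho>\<in>zeros_upto T1 - zeros_upto T. zero_mult \<rho>) \<le> (\<Sum>\<rho>\<in>zeros_upto (T + 1) - zeros_upto T. zero_mult \<rho>)"
          using finz by (intro sum_mono2) auto
        hence "real (\<Sum>\<rho>\<in>zeros_upto T1 - zeros_upto T. zero_mult \<rho>) \<le> W * ln T"
          using wz[of T] T12 of_nat_mono[where ?'a = real] by (smt (verit) of_nat_le_iff)
        also have "\<dots> \<le> W * (2 * l\<^sup>2)" using W l ll2 by (intro mult_left_mono) auto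
        finally have "S * real (\<Sum>\<rho>\<in>zeros_upto T1 - zeros_upto T. zero_mult \<rho>) \<le> S * (W * (2 * l\<^sup>2))"
          using S by (intro mult_left_mono) auto
        moreover have "\<bar>D (zeros_upto T1 - zeros_upto T)\<bar> \<le> S * real (\<Sum>\<rho>\<in>zeros_upto T1 - zeros_upto T. zero_mult \<rho>)"
          by (rule D_bd[of _ T1]) auto
        ultimately show ?thesis by (simp add: mult_ac)
      qed
      \<comment> \<open>\<open>T - (T1 - T0)\<close> lies between 9 and 11, hence in the range of
        \<open>M4\<close>.\<close>
      have 4: "\<bar>(T - (T1 - T0)) / pi * Re M\<bar> \<le> 12 * (l\<^sup>2 * S)" using T0 T1 by (intro M4) auto
      have d1: "D (zeros_upto T1) = D Zs + D (zeros_upto T0)" unfolding D_def Zs_def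
        by (rule sum.subset_diff[OF mono[OF T01(1)] finz])
      have d2: "D (zeros_upto T1) = D (zeros_upto T1 - zeros_upto T) + D (zeros_upto T)" unfolding D_def
        by (rule sum.subset_diff[OF mono[OF T01(3)] finz])
      have d3: "T / pi * Re M = (T1 - T0) / pi * Re M + (T - (T1 - T0)) / pi * Re M"
        by (simp add: field_simps)
      have "K * (l\<^sup>2 * S) = 180 * C * (l\<^sup>2 * S) + NZ * (4 * (l\<^sup>2 * S)) + 2 * W * (l\<^sup>2 * S) + 12 * (l\<^sup>2 * S)"
        by (simp add: K_def algebra_simps)
      thus ?thesis using 1 2 3 4 d1 d2 d3 by linarith
    qed
    hence "\<bar>(\<Sum>\<rho>\<in>zeros_upto T. real (zero_mult \<rho>) * (cmod (\<Sum>n\<in>?X. a n / of_nat n powr \<rho>))\<^sup>2)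
       - (real (zero_count T) * B - T / pi * Re M)\<bar> \<le> K * (x * l\<^sup>2 * B)"
      unfolding goal_eq by (simp add: S_def mult_ac)
    thus ?thesis unfolding B_def M_def l_def .
  qed
  thus ?thesis unfolding index_set_def by blast
qed

end
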